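(* Let $N\ge 1$, $\sigma>0$, $\delta>0$, $a>0$, $b\ge 0$, and let $f(x)=a|x|^2+b$ for $x\in\mathbb{R}^N$. Consider the equation $$-\frac{\sigma^2}{2}\Delta u+\frac12|\nabla u|^2+\delta u=f(x)\quad\text{in }\mathbb{R}^N .$$ Then the unique solution $u$ that belongs to $W^{2,m}_{\mathrm{loc}}(\mathbb{R}^N)$ for all $m>N$ and satisfies $\liminf_{|x|\to\infty}u(x)|x|^{-2}\ge 0$ is $$u(x)=\beta|x|^2+\eta,\qquad \beta=\frac{-\delta+\sqrt{\delta^2+8a}}{4}>0,\qquad \eta=\frac{b+N\sigma^2\beta}{\delta}.$$
   Context: Solutions in $W^{2,m}_{\mathrm{loc}}(\mathbb{R}^N)$ satisfy the equation almost everywhere; $|\cdot|$ is the Euclidean norm. *)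

theory Defs
  imports "HOL-Analysis.Analysis"
begin

text \<open>Euclidean N-space is a type of class \<open>euclidean_space\<close>, with N = \<open>DIM('a)\<close>; multi-indices are
  lists of coordinate directions (elements of \<open>Basis\<close>), whose length is the order.\<close>

primrec iter_deriv :: "'a list \<Rightarrow> ('a::euclidean_space \<Rightarrow> real) \<Rightarrow> 'a \<Rightarrow> real" where
  "iter_deriv [] \<phi> = \<phi>"
| "iter_deriv (i # is) \<phi> = (\<lambda>x. frechet_derivative (iter_deriv is \<phi>) (at x) i)"

definition smooth_fun :: "('a::euclidean_space \<Rightarrow> real) \<Rightarrow> bool" where
  "smooth_fun \<phi> \<longleftrightarrow> (\<forall>is\<in>lists Basis. \<forall>x. iter_deriv is \<phi> differentiable (at x))"

definition test_function :: "('a::euclidean_space \<Rightarrow> real) \<Rightarrow> bool" where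
  "test_function \<phi> \<longleftrightarrow> smooth_fun \<phi> \<and> (\<exists>K. compact K \<and> (\<forall>x. x \<notin> K \<longrightarrow> \<phi> x = 0))"

text \<open>Elements of the function spaces below are functions, not classes modulo null sets; all the
  spaces are closed under modification on a null set.\<close>

definition Lp_loc :: "real \<Rightarrow> ('a::euclidean_space \<Rightarrow> real) set" where
  "Lp_loc p = {u. u \<in> borel_measurable lebesgue \<and>
     (\<forall>K. compact K \<longrightarrow> set_integrable lebesgue K (\<lambda>x. \<bar>u x\<bar> powr p))}"

definition has_weak_deriv ::
    "'a list \<Rightarrow> ('a::euclidean_space \<Rightarrow> real) \<Rightarrow> ('a \<Rightarrow> real) \<Rightarrow> bool" where
  "has_weak_deriv is u g \<longleftrightarrow> u \<in> Lp_loc 1 \<and> g \<in> Lp_loc 1 \<and>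
     (\<forall>\<phi>. test_function \<phi> \<longrightarrow>
        (LINT x|lebesgue. u x * iter_deriv is \<phi> x)
          = (- 1) ^ length is * (LINT x|lebesgue. g x * \<phi> x))"

text \<open>The empty multi-index is included, so membership entails \<open>u \<in> Lp_loc p\<close>.\<close>

definition Sobolev_loc :: "nat \<Rightarrow> real \<Rightarrow> ('a::euclidean_space \<Rightarrow> real) set" where
  "Sobolev_loc k p =
     {u. \<forall>is\<in>lists Basis. length is \<le> k \<longrightarrow> (\<exists>g\<in>Lp_loc p. has_weak_deriv is u g)}"

definition has_weak_gradient :: "('a::euclidean_space \<Rightarrow> real) \<Rightarrow> ('a \<Rightarrow> 'a) \<Rightarrow> bool" where
  "has_weak_gradient u G \<longleftrightarrow> (\<forall>i\<in>Basis. has_weak_deriv [i] u (\<lambda>x. G x \<bullet> i))"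

definition has_weak_Laplacian :: "('a::euclidean_space \<Rightarrow> real) \<Rightarrow> ('a \<Rightarrow> real) \<Rightarrow> bool" where
  "has_weak_Laplacian u L \<longleftrightarrow>
     (\<exists>D. (\<forall>i\<in>Basis. has_weak_deriv [i, i] u (D i)) \<and> L = (\<lambda>x. \<Sum>i\<in>Basis. D i x))"

text \<open>Weak derivatives are unique up to null sets, so the choice of \<open>G\<close> and \<open>L\<close> is immaterial.\<close>

definition solves_HJ_ae ::
    "real \<Rightarrow> real \<Rightarrow> ('a::euclidean_space \<Rightarrow> real) \<Rightarrow> ('a \<Rightarrow> real) \<Rightarrow> bool" where
  "solves_HJ_ae \<sigma> \<delta> f u \<longleftrightarrow>
     (\<exists>G L. has_weak_gradient u G \<and> has_weak_Laplacian u L \<and>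
        (AE x in lebesgue. - (\<sigma>\<^sup>2 / 2) * L x + 1 / 2 * (norm (G x))\<^sup>2 + \<delta> * u x = f x))"

text \<open>The limit inferior is the pointwise one of the given representative. If it is nonnegative
  for some representative, it is so for the continuous one (which exists for \<open>m > N\<close>).\<close>

definition admissible_solution ::
    "real \<Rightarrow> real \<Rightarrow> ('a::euclidean_space \<Rightarrow> real) \<Rightarrow> ('a \<Rightarrow> real) \<Rightarrow> bool" where
  "admissible_solution \<sigma> \<delta> f u \<longleftrightarrow>
     (\<forall>m. m > real DIM('a) \<longrightarrow> u \<in> Sobolev_loc 2 m) \<and>
     solves_HJ_ae \<sigma> \<delta> f u \<and>
     Liminf at_infinity (\<lambda>x. ereal (u x / (norm x)\<^sup>2)) \<ge> 0"

end

theory Submission imports Defs begin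

text \<open>For uniqueness, Morrey's inequality is applied to the weak gradient of a solution \<open>u\<close>, and then to
  \<open>u\<close> itself: both have continuous representatives, and the equation makes the Laplacian continuous
  too. Mollifications of \<open>u\<close> therefore converge locally uniformly together with their gradients and
  Laplacians, so the elementary maximum principle for smooth functions compares \<open>u\<close> with smooth
  barriers. On the ball of radius \<open>R\<close> these are the explicit solution plus \<open>\<epsilon> - \<sigma>\<^sup>2 ln (1 - |x|\<^sup>2 / R\<^sup>2)\<close>, which
  is infinite on the sphere and so needs no growth condition, and the explicit solution minus
  \<open>(\<gamma> |x|\<^sup>4 + C) / R\<^sup>2\<close> with \<open>\<gamma>\<close> slightly above \<open>\<beta>\<close>, which the growth condition keeps below \<open>u\<close> on the sphere.
  Both tend to the explicit solution as \<open>R\<close> grows.\<close>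

subsection \<open>Test functions\<close>

text \<open>Inserting \<beta>|x|^2 + \<eta> into the equation leaves
  \<open>2 * \<beta>\<^sup>2 + \<delta> * \<beta> = a\<close> for the coefficient of |x|^2. This has
  a negative root as well, hence there is a second quadratic solution, which only the growth
  condition excludes. The lower bound must therefore use that condition, while from above the
  quadratic gradient term is enough. The obstacle is that second derivatives of a solution exist
  only almost everywhere, so nothing can be read off at a single maximum point. Even after the
  regularity step the individual second derivatives need not be continuous; only their sum is. That
  is all the maximum principle requires, since at a contact point the gradients agree and the second
  derivatives enter through the Laplacian alone. Morrey's theorem is obtained by varying the scale
  of the mollification at a fixed point: the derivative in the scale \<epsilon> is a mollification
  of the weak gradient and of order \<epsilon>^(-1/2), hence integrable near 0.\<close>

definition flat_exp :: "nat \<Rightarrow> real \<Rightarrow> real" where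
  "flat_exp k t = (if t > 0 then exp (- inverse t) * inverse t ^ k else 0)"

lemma flat_exp_tendsto_0: "(flat_exp k \<longlongrightarrow> 0) (at 0)"
proof -
  have lim: "((\<lambda>y. y ^ k / exp y) \<longlongrightarrow> (0::real)) at_top"
    by (rule tendsto_power_div_exp_0)
  have "((\<lambda>t. inverse t ^ k / exp (inverse t)) \<longlongrightarrow> (0::real)) (at_right 0)"
    by (rule filterlim_compose[OF lim filterlim_inverse_at_top_right])
  then have R: "(flat_exp k \<longlongrightarrow> 0) (at_right 0)"
    by (rule Lim_transform_eventually)
       (auto simp: eventually_at_filter flat_exp_def exp_minus field_simps)
  have L: "(flat_exp k \<longlongrightarrow> 0) (at_left 0)"
    by (rule Lim_transform_eventually[OF tendsto_const]) (auto simp: eventually_at_filter flat_exp_def)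
  show ?thesis using R L filterlim_split_at by blast
qed

text \<open>The powers of \<open>inverse t\<close> are carried along because differentiation then
  stays within the family, so that smoothness of every order follows by induction.\<close>

lemma DERIV_flat_exp:
  "(flat_exp k has_real_derivative flat_exp (k + 2) t - real k * flat_exp (k + 1) t) (at t)"
proof (cases t "0::real" rule: linorder_cases)
  case less
  have "((\<lambda>t. 0) has_real_derivative 0) (at t)" by simp
  then have "(flat_exp k has_real_derivative 0) (at t)"
    by (rule has_field_derivative_transform_within_open[where S="{..<0}"])
       (use less in \<open>auto simp: flat_exp_def\<close>)
  then show ?thesis using less by (simp add: flat_exp_def)
next
  case equal
  \<comment> \<open>Dividing by t only raises the exponent: the difference quotient at 0 is again a
    member of the family.\<close>
  have "(flat_exp k has_real_derivative 0) (at 0)"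
    unfolding has_field_derivative_iff
  proof (rule Lim_transform_eventually[OF flat_exp_tendsto_0[of "k + 1"]])
    show "\<forall>\<^sub>F x in at 0. flat_exp (k + 1) x = (flat_exp k x - flat_exp k 0) / (x - 0)"
      by (auto simp: eventually_at_filter flat_exp_def divide_inverse mult_ac)
  qed
  then show ?thesis using equal by (simp add: flat_exp_def)
next
  case greater
  have d: "((\<lambda>t. exp (- inverse t) * inverse t ^ k) has_real_derivative
      exp (- inverse t) * (inverse t * inverse t) * inverse t ^ k
      + real k * inverse t ^ (k - 1) * (- (inverse t * inverse t)) * exp (- inverse t)) (at t)"
    using greater by (auto intro!: derivative_eq_intros)
  have "exp (- inverse t) * (inverse t * inverse t) * inverse t ^ k
      + real k * inverse t ^ (k - 1) * (- (inverse t * inverse t)) * exp (- inverse t)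
      = exp (- inverse t) * inverse t ^ (k + 2) - real k * (exp (- inverse t) * inverse t ^ (k + 1))"
    by (cases k) (simp_all add: mult_ac)
  from d[unfolded this] have "(flat_exp k has_real_derivative
      exp (- inverse t) * inverse t ^ (k + 2) - real k * (exp (- inverse t) * inverse t ^ (k + 1))) (at t)"
    by (rule has_field_derivative_transform_within_open[where S="{0<..}"])
       (use greater in \<open>auto simp: flat_exp_def\<close>)
  then show ?thesis using greater by (simp add: flat_exp_def)
qed

text \<open>A class of explicit functions that contains a compactly supported one and is closed under
  partial derivatives and affine substitutions.\<close>

inductive bumpy :: "('a::euclidean_space \<Rightarrow> real) \<Rightarrow> bool" where
  bumpy_const: "bumpy (\<lambda>x. c)"
| bumpy_inner: "bumpy (\<lambda>x. x \<bullet> v)"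
| bumpy_inner_self: "bumpy (\<lambda>x. x \<bullet> x)"
| bumpy_add: "bumpy p \<Longrightarrow> bumpy q \<Longrightarrow> bumpy (\<lambda>x. p x + q x)"
| bumpy_mult: "bumpy p \<Longrightarrow> bumpy q \<Longrightarrow> bumpy (\<lambda>x. p x * q x)"
| bumpy_flat_exp: "bumpy p \<Longrightarrow> bumpy (\<lambda>x. flat_exp k (p x))"

lemma bumpy_affine: "bumpy f \<Longrightarrow> bumpy (\<lambda>x. f (v + c *\<^sub>R x))"
proof (induction rule: bumpy.induct)
  case (bumpy_inner w)
  have "bumpy (\<lambda>x. v \<bullet> w + c * (x \<bullet> w))" by (intro bumpy.intros)
  then show ?case by (simp add: inner_add_left)
next
  case bumpy_inner_self
  have "bumpy (\<lambda>x. v \<bullet> v + ((2 * c) * (x \<bullet> v) + (c * c) * (x \<bullet> x)))"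
    by (intro bumpy.intros)
  also have "(\<lambda>x. v \<bullet> v + ((2 * c) * (x \<bullet> v) + (c * c) * (x \<bullet> x)))
      = (\<lambda>x. (v + c *\<^sub>R x) \<bullet> (v + c *\<^sub>R x))"
    by (auto simp: algebra_simps inner_commute)
  finally show ?case .
qed (auto intro: bumpy.intros)

text \<open>An explicit \<open>f'\<close> is carried through the induction, because the product and
  chain rules need the derivatives of the parts and not only their existence.\<close>

lemma bumpy_derivative:
  "bumpy f \<Longrightarrow> \<exists>f'. (\<forall>x. (f has_derivative f' x) (at x)) \<and> (\<forall>i. bumpy (\<lambda>x. f' x i))"
proof (induction rule: bumpy.induct)
  case (bumpy_const c)
  show ?case by (rule exI[of _ "\<lambda>x i. 0"]) (auto intro: bumpy.intros)
next
  case (bumpy_inner v)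
  show ?case
    by (rule exI[of _ "\<lambda>x i. i \<bullet> v"])
       (auto intro: bumpy.intros bounded_linear_imp_has_derivative bounded_linear_inner_left)
next
  case bumpy_inner_self
  have "bumpy (\<lambda>x::'a. 2 * (x \<bullet> i))" for i by (intro bumpy.intros)
  then show ?case
    by (intro exI[of _ "\<lambda>x i. 2 * (x \<bullet> i)"])
       (auto intro!: derivative_eq_intros simp: inner_commute)
next
  case (bumpy_add p q)
  then obtain p' q' where
    "\<forall>x. (p has_derivative p' x) (at x)" "\<forall>i. bumpy (\<lambda>x. p' x i)"
    "\<forall>x. (q has_derivative q' x) (at x)" "\<forall>i. bumpy (\<lambda>x. q' x i)" by blast
  then show ?case
    by (intro exI[of _ "\<lambda>x i. p' x i + q' x i"]) (auto intro: bumpy.intros has_derivative_add)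
next
  case (bumpy_mult p q)
  then obtain p' q' where d:
    "\<forall>x. (p has_derivative p' x) (at x)" "\<forall>i. bumpy (\<lambda>x. p' x i)"
    "\<forall>x. (q has_derivative q' x) (at x)" "\<forall>i. bumpy (\<lambda>x. q' x i)" by blast
  have "bumpy (\<lambda>x. p x * q' x i + p' x i * q x)" for i
    using d bumpy_mult by (intro bumpy.intros) auto
  moreover have "((\<lambda>x. p x * q x) has_derivative (\<lambda>i. p x * q' x i + p' x i * q x)) (at x)" for x
    using d by (intro has_derivative_mult) auto
  ultimately show ?case
    by (intro exI[of _ "\<lambda>x i. p x * q' x i + p' x i * q x"]) auto
next
  case (bumpy_flat_exp p k)
  then obtain p' where p': "\<forall>x. (p has_derivative p' x) (at x)" "\<forall>i. bumpy (\<lambda>x. p' x i)" by blast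
  let ?d = "\<lambda>x. flat_exp (k + 2) (p x) + (- real k) * flat_exp (k + 1) (p x)"
  have "((\<lambda>x. flat_exp k (p x)) has_derivative (\<lambda>i. ?d x * p' x i)) (at x)" for x
    using has_derivative_compose[OF p'(1)[rule_format, of x]
        DERIV_flat_exp[of k "p x", unfolded has_field_derivative_def]]
    by simp
  moreover have "bumpy (\<lambda>x. ?d x * p' x i)" for i
    using bumpy_flat_exp p' by (intro bumpy.intros) auto
  ultimately show ?case by (intro exI[of _ "\<lambda>x i. ?d x * p' x i"]) auto
qed

lemma bumpy_differentiable: "bumpy f \<Longrightarrow> f differentiable (at x)"
  by (drule bumpy_derivative) (auto simp: differentiable_def)

lemma bumpy_frechet_derivative:
  assumes "bumpy f" shows "bumpy (\<lambda>x. frechet_derivative f (at x) i)"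
proof -
  obtain f' where f': "\<And>x. (f has_derivative f' x) (at x)" "bumpy (\<lambda>x. f' x i)"
    using bumpy_derivative[OF assms] by blast
  then have "frechet_derivative f (at x) = f' x" for x
    by (metis frechet_derivative_at)
  with f' show ?thesis by simp
qed

lemma bumpy_iter_deriv: "bumpy f \<Longrightarrow> bumpy (iter_deriv is f)"
  by (induction "is") (auto intro: bumpy_frechet_derivative)

lemma smooth_fun_bumpy: "bumpy f \<Longrightarrow> smooth_fun f"
  unfolding smooth_fun_def using bumpy_iter_deriv bumpy_differentiable by blast

section \<open>Derivatives, affine substitutions and bounds of test functions\<close>

lemma iter_deriv_append: "iter_deriv (is @ js) f = iter_deriv is (iter_deriv js f)"
  by (induction "is") auto

lemma frechet_derivative_eq_0_outside:
  assumes "closed K" "\<And>x. x \<notin> K \<Longrightarrow> f x = 0" "x \<notin> K"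
  shows "frechet_derivative f (at x) i = (0::real)"
proof -
  have "(f has_derivative (\<lambda>_. 0)) (at x)"
    by (rule has_derivative_transform_within_open[of "\<lambda>_. 0" _ _ _ "- K"]) (use assms in auto)
  then show ?thesis using frechet_derivative_at by metis
qed

lemma iter_deriv_eq_0_outside:
  assumes "closed K" "\<And>x. x \<notin> K \<Longrightarrow> f x = 0" "x \<notin> K"
  shows "iter_deriv is f x = 0"
  using assms(3)
proof (induction "is" arbitrary: x)
  case (Cons i "is")
  show ?case using frechet_derivative_eq_0_outside[OF assms(1) Cons.IH Cons.prems] by simp
qed (use assms in auto)

lemma test_function_iter_deriv:
  assumes "test_function \<phi>" "is \<in> lists Basis"
  shows "test_function (iter_deriv is \<phi>)"
proof -
  obtain K where K: "compact K" "\<And>x. x \<notin> K \<Longrightarrow> \<phi> x = 0"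
    using assms unfolding test_function_def by auto
  have "\<forall>x. x \<notin> K \<longrightarrow> iter_deriv is \<phi> x = 0"
    using iter_deriv_eq_0_outside[OF compact_imp_closed] K by blast
  moreover have "smooth_fun (iter_deriv is \<phi>)"
    using assms unfolding test_function_def smooth_fun_def iter_deriv_append[symmetric] by auto
  ultimately show ?thesis using K unfolding test_function_def by blast
qed

text \<open>The chain rule, once per entry of the list. The scalar is allowed to be negative because
  mollification substitutes (x - y) / \<epsilon>, where it is -1/\<epsilon>.\<close>

lemma iter_deriv_affine:
  assumes "smooth_fun \<psi>" "is \<in> lists Basis"
  shows "iter_deriv is (\<lambda>y. \<psi> (v + c *\<^sub>R y)) = (\<lambda>y. c ^ length is * iter_deriv is \<psi> (v + c *\<^sub>R y))"
  using assms(2)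
proof (induction "is" rule: list.induct)
  case (Cons i "is")
  have d: "iter_deriv is \<psi> differentiable (at z)" for z
    using assms(1) Cons.prems unfolding smooth_fun_def by auto
  let ?D = "\<lambda>y. frechet_derivative (iter_deriv is \<psi>) (at (v + c *\<^sub>R y))"
  have "((\<lambda>y. iter_deriv is \<psi> (v + c *\<^sub>R y)) has_derivative (\<lambda>h. ?D y (c *\<^sub>R h))) (at y)" for y
    by (rule has_derivative_compose[OF _ d[unfolded frechet_derivative_works]])
       (auto intro!: derivative_eq_intros)
  then have "((\<lambda>y. c ^ length is * iter_deriv is \<psi> (v + c *\<^sub>R y)) has_derivative
      (\<lambda>h. c ^ length is * ?D y (c *\<^sub>R h))) (at y)" for y
    by (rule has_derivative_mult_right)
  then have "frechet_derivative (\<lambda>y. c ^ length is * iter_deriv is \<psi> (v + c *\<^sub>R y)) (at y) i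
      = c ^ length is * ?D y (c *\<^sub>R i)" for y
    by (metis frechet_derivative_at)
  moreover have "?D y (c *\<^sub>R i) = c * ?D y i" for y
    using linear_cmul[OF linear_frechet_derivative[OF d]] by simp
  moreover have "iter_deriv is (\<lambda>y. \<psi> (v + c *\<^sub>R y)) = (\<lambda>y. c ^ length is * iter_deriv is \<psi> (v + c *\<^sub>R y))"
    using Cons by auto
  ultimately show ?case by (simp add: mult.assoc mult.left_commute)
qed simp
lemma test_function_affine:
  assumes "test_function \<psi>" "c \<noteq> 0"
  shows "test_function (\<lambda>y. \<psi> (v + c *\<^sub>R y))"
proof -
  obtain K where K: "compact K" "\<And>x. x \<notin> K \<Longrightarrow> \<psi> x = 0"
    using assms unfolding test_function_def by auto
  have s: "smooth_fun \<psi>" using assms by (simp add: test_function_def)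
  have "smooth_fun (\<lambda>y. \<psi> (v + c *\<^sub>R y))"
    unfolding smooth_fun_def
  proof (intro ballI allI)
    fix "is" :: "'a list" and x assume i: "is \<in> lists Basis"
    have d: "iter_deriv is \<psi> differentiable (at z)" for z
      using s i unfolding smooth_fun_def by auto
    have "(\<lambda>y. v + c *\<^sub>R y) differentiable (at x)" by (intro derivative_intros)
    then have "(iter_deriv is \<psi> \<circ> (\<lambda>y. v + c *\<^sub>R y)) differentiable (at x)"
      by (rule differentiable_chain_at) (rule d)
    then have "(\<lambda>y. c ^ length is * iter_deriv is \<psi> (v + c *\<^sub>R y)) differentiable (at x)"
      by (intro differentiable_mult differentiable_const) (simp add: o_def)
    then show "iter_deriv is (\<lambda>y. \<psi> (v + c *\<^sub>R y)) differentiable at x"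
      by (simp add: iter_deriv_affine[OF s i])
  qed
  moreover have "compact ((\<lambda>z. (1 / c) *\<^sub>R (z - v)) ` K)"
    using K by (intro compact_continuous_image continuous_intros)
  moreover have "\<psi> (v + c *\<^sub>R y) = 0" if "y \<notin> (\<lambda>z. (1 / c) *\<^sub>R (z - v)) ` K" for y
  proof (rule K(2), rule)
    assume "v + c *\<^sub>R y \<in> K"
    then have "(1 / c) *\<^sub>R ((v + c *\<^sub>R y) - v) \<in> (\<lambda>z. (1 / c) *\<^sub>R (z - v)) ` K" by blast
    with that \<open>c \<noteq> 0\<close> show False by simp
  qed
  ultimately show ?thesis unfolding test_function_def by blast
qed

lemma test_function_continuous:
  assumes "test_function \<phi>" shows "continuous_on UNIV \<phi>"
proof -
  have "iter_deriv [] \<phi> differentiable (at x)" for x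
    using assms unfolding test_function_def smooth_fun_def by blast
  then show ?thesis
    by (intro continuous_at_imp_continuous_on ballI differentiable_imp_continuous_within) simp
qed

lemma continuous_compact_support_bounded:
  fixes \<phi> :: "'a::euclidean_space \<Rightarrow> real"
  assumes "continuous_on UNIV \<phi>" "\<And>x. norm x > r \<Longrightarrow> \<phi> x = 0"
  obtains M where "M > 0" "\<And>x. \<bar>\<phi> x\<bar> \<le> M"
proof -
  have "compact (\<phi> ` cball 0 r)"
    using assms(1) by (intro compact_continuous_image) (auto intro: continuous_on_subset)
  then obtain b where b: "b > 0" "\<forall>x\<in>\<phi> ` cball 0 r. norm x \<le> b"
    using compact_imp_bounded bounded_pos by metis
  have "\<bar>\<phi> x\<bar> \<le> b" for x
    using b assms(2)[of x] by (cases "norm x \<le> r") auto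
  with b that show ?thesis by blast
qed

lemma test_function_support_ball:
  assumes "test_function \<phi>" obtains r where "r > 0" "\<And>x. norm x > r \<Longrightarrow> \<phi> x = 0"
proof -
  obtain K where K: "compact K" "\<And>x. x \<notin> K \<Longrightarrow> \<phi> x = 0"
    using assms unfolding test_function_def by auto
  then obtain b where b: "b > 0" "\<forall>x\<in>K. norm x \<le> b"
    using compact_imp_bounded bounded_pos by metis
  have "\<phi> x = 0" if "norm x > b" for x
    using K(2)[of x] b that by force
  with b that show ?thesis by blast
qed

subsection \<open>Integrals against compactly supported kernels\<close>

lemma Lp_loc_1_measurable [measurable_dest]: "h \<in> Lp_loc 1 \<Longrightarrow> h \<in> borel_measurable lebesgue"
  by (simp add: Lp_loc_def)

lemma Lp_loc_1_integrable:
  assumes "h \<in> Lp_loc 1" "compact K"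
  shows "integrable lebesgue (\<lambda>x. indicator K x * h x)"
    and "integrable lebesgue (\<lambda>x. indicator K x * \<bar>h x\<bar>)"
proof -
  have [measurable]: "K \<in> sets lebesgue" "h \<in> borel_measurable lebesgue"
    using assms lmeasurable_compact by (auto simp: Lp_loc_1_measurable)
  show *: "integrable lebesgue (\<lambda>x. indicator K x * \<bar>h x\<bar>)"
    using assms unfolding Lp_loc_def set_integrable_def by simp
  show "integrable lebesgue (\<lambda>x. indicator K x * h x)"
    by (rule Bochner_Integration.integrable_bound[OF *]) (auto simp: abs_mult)
qed

lemma Lp_loc_1I:
  assumes "h \<in> borel_measurable lebesgue"
    and "\<And>K. compact K \<Longrightarrow> integrable lebesgue (\<lambda>x. indicator K x * \<bar>h x\<bar>)"
  shows "h \<in> Lp_loc 1"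
  using assms unfolding Lp_loc_def set_integrable_def by simp

lemma continuous_measurable_lebesgue:
  fixes k :: "'a::euclidean_space \<Rightarrow> real"
  shows "continuous_on UNIV k \<Longrightarrow> k \<in> borel_measurable lebesgue"
  using borel_measurable_continuous_onI measurable_completion by (metis measurable_lborel2)

lemma integrable_mult_kernel:
  fixes k :: "'a::euclidean_space \<Rightarrow> real"
  assumes h: "h \<in> Lp_loc 1" and k: "k \<in> borel_measurable lebesgue"
    and b: "\<And>x. \<bar>k x\<bar> \<le> M" and z: "\<And>x. norm x > R \<Longrightarrow> k x = 0"
  shows "integrable lebesgue (\<lambda>x. h x * k x)"
proof (rule Bochner_Integration.integrable_bound)
  show "integrable lebesgue (\<lambda>x. M * (indicator (cball 0 R) x * \<bar>h x\<bar>))"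
    using Lp_loc_1_integrable(2)[OF h, of "cball 0 R"] by simp
  show "(\<lambda>x. h x * k x) \<in> borel_measurable lebesgue"
    using h k by (intro borel_measurable_times) (auto simp: Lp_loc_1_measurable)
  have "0 \<le> M" using b[of 0] by linarith
  then show "AE x in lebesgue. norm (h x * k x) \<le> norm (M * (indicator (cball 0 R) x * \<bar>h x\<bar>))"
    using b z by (auto simp: abs_mult mult.commute[of "\<bar>h _\<bar>"] indicator_def intro!: mult_right_mono)
qed

lemma integrable_mult_continuous_kernel:
  fixes k :: "'a::euclidean_space \<Rightarrow> real"
  assumes "h \<in> Lp_loc 1" "continuous_on UNIV k" "\<And>x. norm x > R \<Longrightarrow> k x = 0"
  shows "integrable lebesgue (\<lambda>x. h x * k x)"
  using continuous_compact_support_bounded[OF assms(2,3)] integrable_mult_kernel[OF assms(1)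
      continuous_measurable_lebesgue[OF assms(2)]] assms(3) by metis

text \<open>Dominated convergence with majorant M |h| on the ball of radius \<open>R\<close>,
  integrable because \<open>h\<close> is locally so. The hypotheses are only eventual, since
  perturbed kernels share a support and a bound only once the perturbation is small.\<close>

lemma tendsto_integral_kernel:
  fixes k :: "nat \<Rightarrow> 'a::euclidean_space \<Rightarrow> real"
  assumes h: "h \<in> Lp_loc 1"
    and m: "\<forall>\<^sub>F n in sequentially. k n \<in> borel_measurable lebesgue"
    and b: "\<forall>\<^sub>F n in sequentially. \<forall>x. \<bar>k n x\<bar> \<le> M"
    and z: "\<forall>\<^sub>F n in sequentially. \<forall>x. norm x > R \<longrightarrow> k n x = 0"
    and l: "\<And>x. (\<lambda>n. k n x) \<longlonglongrightarrow> k0 x"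
  shows "(\<lambda>n. LINT x|lebesgue. h x * k n x) \<longlonglongrightarrow> (LINT x|lebesgue. h x * k0 x)"
proof -
  have "\<forall>\<^sub>F n in sequentially. k n \<in> borel_measurable lebesgue \<and> (\<forall>x. \<bar>k n x\<bar> \<le> M)
      \<and> (\<forall>x. norm x > R \<longrightarrow> k n x = 0)"
    using m b z by eventually_elim auto
  then obtain N where N: "\<And>n. k (n + N) \<in> borel_measurable lebesgue"
      "\<And>n x. \<bar>k (n + N) x\<bar> \<le> M" "\<And>n x. norm x > R \<Longrightarrow> k (n + N) x = 0"
    unfolding eventually_sequentially by (metis le_add2)
  have M: "0 \<le> M" using N(2)[of 0 0] by linarith
  have l': "(\<lambda>n. k (n + N) x) \<longlonglongrightarrow> k0 x" for x
    by (rule LIMSEQ_ignore_initial_segment[OF l])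
  have h_meas: "h \<in> borel_measurable lebesgue" using h by (rule Lp_loc_1_measurable)
  have k0: "k0 \<in> borel_measurable lebesgue"
    by (rule borel_measurable_LIMSEQ_real[OF l' N(1)])
  have "(\<lambda>n. LINT x|lebesgue. h x * k (n + N) x) \<longlonglongrightarrow> (LINT x|lebesgue. h x * k0 x)"
  proof (rule integral_dominated_convergence)
    show "integrable lebesgue (\<lambda>x. M * (indicator (cball 0 R) x * \<bar>h x\<bar>))"
      using Lp_loc_1_integrable(2)[OF h, of "cball 0 R"] by simp
    show "(\<lambda>x. h x * k0 x) \<in> borel_measurable lebesgue"
      using h_meas k0 by (rule borel_measurable_times)
    show "(\<lambda>x. h x * k (n + N) x) \<in> borel_measurable lebesgue" for n
      using h_meas N(1) by (rule borel_measurable_times)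
    show "AE x in lebesgue. (\<lambda>n. h x * k (n + N) x) \<longlonglongrightarrow> h x * k0 x"
      by (intro AE_I2 tendsto_mult l' tendsto_const)
    show "AE x in lebesgue. norm (h x * k (n + N) x) \<le> M * (indicator (cball 0 R) x * \<bar>h x\<bar>)" for n
      using N(2,3) M
      by (auto simp: abs_mult mult.commute[of "\<bar>h _\<bar>"] indicator_def intro!: mult_right_mono)
  qed
  then show ?thesis by (rule LIMSEQ_offset)
qed

text \<open>Differentiation under the integral sign: the mean value theorem bounds the difference
  quotients by \<open>M\<close>, and dominated convergence applies to them along sequences. The
  parameter will be a position on a coordinate line, the scale of a mollification, or a
  translation.\<close>

lemma DERIV_integral_kernel:
  fixes K :: "real \<Rightarrow> 'a::euclidean_space \<Rightarrow> real"
  assumes h: "h \<in> Lp_loc 1" and d: "d > 0"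
    and D: "\<And>\<tau> y. \<bar>\<tau> - t\<bar> < d \<Longrightarrow> ((\<lambda>\<tau>. K \<tau> y) has_real_derivative K' \<tau> y) (at \<tau>)"
    and b: "\<And>\<tau> y. \<bar>\<tau> - t\<bar> < d \<Longrightarrow> \<bar>K' \<tau> y\<bar> \<le> M"
    and z: "\<And>\<tau> y. \<bar>\<tau> - t\<bar> < d \<Longrightarrow> norm y > R \<Longrightarrow> K \<tau> y = 0"
    and c: "\<And>\<tau>. \<bar>\<tau> - t\<bar> < d \<Longrightarrow> continuous_on UNIV (K \<tau>)"
  shows "((\<lambda>\<tau>. LINT y|lebesgue. h y * K \<tau> y) has_real_derivative
    (LINT y|lebesgue. h y * K' t y)) (at t)"
  unfolding has_field_derivative_iff tendsto_at_iff_sequentially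
proof (intro allI impI)
  fix X :: "nat \<Rightarrow> real" assume X: "\<forall>i. X i \<in> UNIV - {t}" and lim: "X \<longlonglongrightarrow> t"
  have near: "\<forall>\<^sub>F n in sequentially. \<bar>X n - t\<bar> < d"
    using tendstoD[OF lim d] by (simp add: dist_real_def)
  let ?k = "\<lambda>n y. (K (X n) y - K t y) / (X n - t)"
  have int: "integrable lebesgue (\<lambda>y. h y * K \<tau> y)" if "\<bar>\<tau> - t\<bar> < d" for \<tau>
    using integrable_mult_continuous_kernel[OF h c[OF that] z[OF that]] .
  have mvt: "\<bar>K \<tau> y - K t y\<bar> \<le> M * \<bar>\<tau> - t\<bar>" if "\<bar>\<tau> - t\<bar> < d" for \<tau> y
  proof -
    have "norm (K \<tau> y - K t y) \<le> M * norm (\<tau> - t)"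
    proof (rule field_differentiable_bound[of "{t - d<..<t + d}" "\<lambda>\<tau>. K \<tau> y" "\<lambda>\<tau>. K' \<tau> y"])
      fix s assume "s \<in> {t - d<..<t + d}"
      then have "\<bar>s - t\<bar> < d" by (auto simp: abs_less_iff)
      then show "((\<lambda>\<tau>. K \<tau> y) has_field_derivative K' s y) (at s within {t - d<..<t + d})"
        and "norm (K' s y) \<le> M"
        using D[of s y] b[of s y] by (auto intro: has_field_derivative_at_within)
    qed (use that d in \<open>auto simp: abs_less_iff\<close>)
    then show ?thesis by simp
  qed
  have "(\<lambda>n. LINT y|lebesgue. h y * ?k n y) \<longlonglongrightarrow> (LINT y|lebesgue. h y * K' t y)"
  proof (rule tendsto_integral_kernel[OF h, where M = M and R = R])
    show "\<forall>\<^sub>F n in sequentially. ?k n \<in> borel_measurable lebesgue"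
      using near
    proof eventually_elim
      case (elim n)
      then have "continuous_on UNIV (?k n)"
        using X d by (intro continuous_intros c) auto
      then show ?case by (rule continuous_measurable_lebesgue)
    qed
    show "\<forall>\<^sub>F n in sequentially. \<forall>x. \<bar>?k n x\<bar> \<le> M"
      using near
    proof eventually_elim
      case (elim n)
      have "0 < \<bar>X n - t\<bar>" using X by auto
      then show ?case using mvt[OF elim] by (auto simp: abs_divide divide_le_eq)
    qed
    show "\<forall>\<^sub>F n in sequentially. \<forall>x. norm x > R \<longrightarrow> ?k n x = 0"
      using near by eventually_elim (use z d in auto)
    show "(\<lambda>n. ?k n x) \<longlonglongrightarrow> K' t x" for x
    proof -
      have "((\<lambda>\<tau>. (K \<tau> x - K t x) / (\<tau> - t)) \<longlongrightarrow> K' t x) (at t)"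
        using D[of t x] d unfolding has_field_derivative_iff by simp
      then show ?thesis
        using X lim unfolding tendsto_at_iff_sequentially by (auto simp: o_def)
    qed
  qed
  moreover have "\<forall>\<^sub>F n in sequentially. (LINT y|lebesgue. h y * ?k n y)
      = ((LINT y|lebesgue. h y * K (X n) y) - (LINT y|lebesgue. h y * K t y)) / (X n - t)"
    using near
  proof eventually_elim
    case (elim n)
    have "(LINT y|lebesgue. h y * ?k n y) = (LINT y|lebesgue. (h y * K (X n) y - h y * K t y) / (X n - t))"
      by (simp add: algebra_simps diff_divide_distrib)
    then show ?case using int[OF elim] int[of t] d by simp
  qed
  ultimately show "((\<lambda>\<tau>. ((LINT y|lebesgue. h y * K \<tau> y) - (LINT y|lebesgue. h y * K t y)) / (\<tau> - t)) \<circ> X)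
      \<longlonglongrightarrow> (LINT y|lebesgue. h y * K' t y)"
    unfolding o_def by (rule Lim_transform_eventually)
qed

lemma continuous_on_convolution:
  fixes \<psi> :: "'a::euclidean_space \<Rightarrow> real"
  assumes h: "h \<in> Lp_loc 1" and c: "continuous_on UNIV \<psi>" and z: "\<And>x. norm x > r \<Longrightarrow> \<psi> x = 0"
  shows "continuous_on UNIV (\<lambda>x. LINT y|lebesgue. h y * \<psi> (x - y))"
proof (unfold continuous_on_sequentially, intro allI ballI impI)
  fix X :: "nat \<Rightarrow> 'a" and x assume "(\<forall>n. X n \<in> UNIV) \<and> X \<longlonglongrightarrow> x"
  then have X: "X \<longlonglongrightarrow> x" by blast
  obtain M where M: "\<And>x. \<bar>\<psi> x\<bar> \<le> M" using continuous_compact_support_bounded[OF c z] by metis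
  have near: "\<forall>\<^sub>F n in sequentially. dist (X n) x < 1" by (rule tendstoD[OF X]) simp
  have "(\<lambda>n. LINT y|lebesgue. h y * \<psi> (X n - y)) \<longlonglongrightarrow> (LINT y|lebesgue. h y * \<psi> (x - y))"
  proof (rule tendsto_integral_kernel[OF h, where M = M and R = "norm x + 1 + r"])
    show "\<forall>\<^sub>F n in sequentially. (\<lambda>y. \<psi> (X n - y)) \<in> borel_measurable lebesgue"
      by (intro always_eventually allI continuous_measurable_lebesgue
          continuous_on_compose2[OF c] continuous_intros) auto
    show "\<forall>\<^sub>F n in sequentially. \<forall>y. norm y > norm x + 1 + r \<longrightarrow> \<psi> (X n - y) = 0"
      using near
    proof eventually_elim
      case (elim n)
      show ?case
      proof (intro allI impI z)
        fix y :: 'a assume "norm y > norm x + 1 + r"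
        moreover have "norm y \<le> norm (X n - y) + norm (X n - x) + norm x" by norm
        ultimately show "norm (X n - y) > r" using elim by (simp add: dist_norm)
      qed
    qed
    show "(\<lambda>n. \<psi> (X n - y)) \<longlonglongrightarrow> \<psi> (x - y)" for y
      by (rule continuous_on_tendsto_compose[OF c]) (auto intro!: tendsto_intros X)
  qed (use M in auto)
  then show "((\<lambda>x. LINT y|lebesgue. h y * \<psi> (x - y)) \<circ> X) \<longlonglongrightarrow> (LINT y|lebesgue. h y * \<psi> (x - y))"
    by (simp add: o_def)
qed

subsection \<open>Mollification\<close>

lemma continuous_Lp_loc:
  fixes f :: "'a::euclidean_space \<Rightarrow> real"
  assumes c: "continuous_on UNIV f" and p: "p \<ge> 0"
  shows "f \<in> Lp_loc p"
  unfolding Lp_loc_def set_integrable_def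
proof (intro CollectI conjI allI impI)
  show m: "f \<in> borel_measurable lebesgue" by (rule continuous_measurable_lebesgue[OF c])
  fix K :: "'a set" assume K: "compact K"
  then have "compact (f ` K)" using c by (intro compact_continuous_image) (auto intro: continuous_on_subset)
  then obtain b where b: "b > 0" "\<forall>x\<in>f ` K. norm x \<le> b"
    using compact_imp_bounded bounded_pos by metis
  have Km: "K \<in> sets lebesgue" "emeasure lebesgue K < \<infinity>"
    using lmeasurable_compact[OF K] by (auto simp: fmeasurable_def)
  show "integrable lebesgue (\<lambda>x. indicator K x *\<^sub>R (\<bar>f x\<bar> powr p))"
  proof (rule Bochner_Integration.integrable_bound)
    show "integrable lebesgue (\<lambda>x. b powr p * indicator K x)"
      using integrable_real_indicator[OF Km] by simp
    show "(\<lambda>x. indicator K x *\<^sub>R (\<bar>f x\<bar> powr p)) \<in> borel_measurable lebesgue"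
      using m Km(1) by measurable
    show "AE x in lebesgue. norm (indicator K x *\<^sub>R (\<bar>f x\<bar> powr p)) \<le> norm (b powr p * indicator K x)"
      using b p by (auto simp: indicator_def intro!: powr_mono2)
  qed
qed

text \<open>The points of \<open>S\<close> with negative value form an open null set, which must be
  empty. A general open \<open>S\<close> is needed to transfer the growth condition, which holds
  only far out.\<close>

lemma AE_continuous_nonneg:
  fixes f :: "'a::euclidean_space \<Rightarrow> real"
  assumes S: "open S" "continuous_on S f" and ae: "AE x in lebesgue. x \<in> S \<longrightarrow> f x \<ge> 0" and x: "x \<in> S"
  shows "f x \<ge> 0"
proof (rule ccontr)
  assume "\<not> f x \<ge> 0"
  define U where "U = S \<inter> f -` {..<0}"
  have "open U" unfolding U_def using S by (intro continuous_open_preimage) auto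
  moreover have "U \<noteq> {}" using x \<open>\<not> f x \<ge> 0\<close> by (auto simp: U_def)
  moreover have "negligible U"
  proof -
    have "AE x in lebesgue. x \<notin> U" using ae by (rule eventually_mono) (auto simp: U_def)
    then show ?thesis
      using AE_iff_null_sets[of U lebesgue] \<open>open U\<close> by (simp add: negligible_iff_null_sets)
  qed
  ultimately show False using open_not_negligible by blast
qed

lemma AE_continuous_eq:
  fixes f g :: "'a::euclidean_space \<Rightarrow> real"
  assumes "continuous_on UNIV f" "continuous_on UNIV g" and ae: "AE x in lebesgue. f x = g x"
  shows "f x = g x"
proof -
  have "0 \<le> f x - g x"
    by (rule AE_continuous_nonneg[of UNIV]) (use assms in \<open>auto intro!: continuous_intros elim!: eventually_mono\<close>)
  moreover have "0 \<le> g x - f x"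
    by (rule AE_continuous_nonneg[of UNIV]) (use assms in \<open>auto intro!: continuous_intros elim!: eventually_mono\<close>)
  ultimately show ?thesis by linarith
qed

lemma integral_affine_kernel:
  fixes \<psi> :: "'a::euclidean_space \<Rightarrow> real"
  assumes "continuous_on UNIV \<psi>" "\<epsilon> > 0"
  shows "(1 / \<epsilon>) ^ DIM('a) * (LINT y|lebesgue. \<psi> ((1 / \<epsilon>) *\<^sub>R (x - y))) = (LINT w|lebesgue. \<psi> w)"
proof -
  have m: "\<psi> \<in> borel_measurable borel" using assms(1) by (rule borel_measurable_continuous_onI)
  let ?T = "\<lambda>y. (1 / \<epsilon>) *\<^sub>R x + (- (1 / \<epsilon>)) *\<^sub>R y"
  have T: "?T \<in> borel_measurable borel" by measurable
  have "(LINT w|lborel. \<psi> w) = (LINT w|density (distr lborel borel ?T) (\<lambda>_. ennreal (\<bar>- (1 / \<epsilon>)\<bar> ^ DIM('a))). \<psi> w)"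
    by (subst lborel_affine[of "- (1 / \<epsilon>)" "(1 / \<epsilon>) *\<^sub>R x"]) (use assms in auto)
  also have "\<dots> = (LINT w|distr lborel borel ?T. (1 / \<epsilon>) ^ DIM('a) * \<psi> w)"
    using m assms by (subst integral_density) auto
  also have "\<dots> = (1 / \<epsilon>) ^ DIM('a) * (LINT y|lborel. \<psi> (?T y))"
    using m T by (subst integral_distr) auto
  finally have "(LINT w|lborel. \<psi> w) = (1 / \<epsilon>) ^ DIM('a) * (LINT y|lborel. \<psi> ((1 / \<epsilon>) *\<^sub>R (x - y)))"
    by (simp add: scaleR_diff_right)
  moreover have "(\<lambda>y. \<psi> ((1 / \<epsilon>) *\<^sub>R (x - y))) \<in> borel_measurable lborel"
    using m by measurable
  ultimately show ?thesis using m by (simp add: integral_completion)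
qed

text \<open>Kernels are supported in a cube with a corner at the origin, rather than centred, because
  \<open>integrable_ccontinuous_explicit\<close> averages over cubes with corner \<open>x\<close>.\<close>

definition anchored :: "('a::euclidean_space \<Rightarrow> real) \<Rightarrow> bool" where
  "anchored \<psi> \<longleftrightarrow> (\<forall>w. - w \<notin> cbox 0 One \<longrightarrow> \<psi> w = 0)"

lemma test_function_bumpy: "bumpy \<psi> \<Longrightarrow> anchored \<psi> \<Longrightarrow> test_function \<psi>"
  unfolding test_function_def
proof (intro conjI exI[of _ "uminus ` cbox 0 One"] allI impI)
  show "compact (uminus ` cbox (0::'a) One)" by (simp add: compact_negations)
  fix x :: 'a assume "anchored \<psi>" "x \<notin> uminus ` cbox 0 One"
  then show "\<psi> x = 0" unfolding anchored_def by (metis image_eqI minus_minus)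
qed (rule smooth_fun_bumpy)

lemma mollifier_exists:
  obtains \<rho> :: "'a::euclidean_space \<Rightarrow> real"
  where "bumpy \<rho>" "\<And>w. \<rho> w \<ge> 0" "anchored \<rho>" "(LINT w|lebesgue. \<rho> w) = 1"
proof -
  \<comment> \<open>A bump of radius 1/4 about the point with all coordinates -1/2, so that
    \<open>- w\<close> stays in the unit cube. The factors 1 and -1 are written out to fit
    \<open>bumpy_affine\<close> and the rules of \<open>bumpy\<close>.\<close>
  define f :: "'a \<Rightarrow> real" where
    "f = (\<lambda>w. flat_exp 0 (1 / 16 + (- 1) * (((1/2) *\<^sub>R One + 1 *\<^sub>R w) \<bullet> ((1/2) *\<^sub>R One + 1 *\<^sub>R w))))"
  have "bumpy (\<lambda>w::'a. ((1/2) *\<^sub>R One + 1 *\<^sub>R w) \<bullet> ((1/2) *\<^sub>R One + 1 *\<^sub>R w))"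
    by (rule bumpy_affine[OF bumpy_inner_self])
  then have b: "bumpy f" unfolding f_def by (intro bumpy.intros)
  have nn: "f w \<ge> 0" for w by (simp add: f_def flat_exp_def)
  have a: "anchored f"
    unfolding anchored_def
  proof (intro allI impI)
    fix w :: 'a assume w: "- w \<notin> cbox 0 One"
    show "f w = 0"
    proof (rule ccontr)
      assume "f w \<noteq> 0"
      then have "(norm ((1/2) *\<^sub>R One + w))\<^sup>2 < (1 / 4)\<^sup>2"
        unfolding power2_norm_eq_inner by (auto simp: f_def flat_exp_def power2_eq_square split: if_splits)
      then have n: "norm ((1/2) *\<^sub>R One + w) < 1 / 4" by (rule power2_less_imp_less) simp
      have coord: "\<bar>1/2 + w \<bullet> i\<bar> < 1 / 4" if "i \<in> Basis" for i
        using Basis_le_norm[OF that, of "(1/2) *\<^sub>R One + w"] n that by (simp add: inner_add_left)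
      have "0 \<bullet> i \<le> - w \<bullet> i \<and> - w \<bullet> i \<le> One \<bullet> i" if i: "i \<in> Basis" for i
      proof -
        have "1/2 + w \<bullet> i < 1/4" "- (1/2 + w \<bullet> i) < 1/4" using coord[OF i] by linarith+
        then show ?thesis using i by simp
      qed
      then have "- w \<in> cbox 0 One" by (simp add: mem_box)
      with w show False by blast
    qed
  qed
  have t: "test_function f" by (rule test_function_bumpy[OF b a])
  then obtain r where r: "\<And>x. norm x > r \<Longrightarrow> f x = 0" using test_function_support_ball by metis
  have c: "continuous_on UNIV f" by (rule test_function_continuous[OF t])
  have "(\<lambda>_. 1) \<in> Lp_loc 1" by (rule continuous_Lp_loc) auto
  from integrable_mult_continuous_kernel[OF this c r] have int: "integrable lebesgue f" by simp
  have I: "(LINT w|lebesgue. f w) > 0"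
  proof (rule ccontr)
    assume "\<not> ?thesis"
    then have "(LINT w|lebesgue. f w) = 0" using nn by (meson Bochner_Integration.integral_nonneg not_less order_antisym)
    then have "AE x in lebesgue. f x = 0"
      using integral_nonneg_eq_0_iff_AE[OF int] nn by auto
    from AE_continuous_eq[OF c continuous_on_const this] have "f ((- 1/2) *\<^sub>R One) = 0" .
    then show False by (simp add: f_def flat_exp_def)
  qed
  show ?thesis
  proof (rule that[of "\<lambda>w. inverse (LINT w|lebesgue. f w) * f w"])
    show "bumpy (\<lambda>w. inverse (LINT w|lebesgue. f w) * f w)" by (rule bumpy_mult[OF bumpy_const b])
    show "inverse (LINT w|lebesgue. f w) * f w \<ge> 0" for w using I nn by simp
    show "anchored (\<lambda>w. inverse (LINT w|lebesgue. f w) * f w)" using a by (simp add: anchored_def)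
    show "(LINT w|lebesgue. inverse (LINT w|lebesgue. f w) * f w) = 1" using I by simp
  qed
qed

text \<open>The convolution of \<open>h\<close> with \<epsilon>^(-N) \<psi> (w / \<epsilon>). The
  kernel is a parameter without normalisation, because differentiation in space replaces it by its
  derivatives and differentiation in the scale by its products with coordinates.\<close>

definition mollify :: "('a::euclidean_space \<Rightarrow> real) \<Rightarrow> ('a \<Rightarrow> real) \<Rightarrow> real \<Rightarrow> 'a \<Rightarrow> real" where
  "mollify h \<psi> \<epsilon> x = (1 / \<epsilon>) ^ DIM('a) * (LINT y|lebesgue. h y * \<psi> ((1 / \<epsilon>) *\<^sub>R (x - y)))"

text \<open>The kernel, as a function of y, is itself a test function. Differentiating it in y
  instead of x produces a sign for each order, and these cancel the signs in the definition of weak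
  derivatives. The left-hand side is what differentiating the mollification in x will turn out to
  be.\<close>

lemma mollify_weak_deriv:
  assumes "has_weak_deriv is u g" "test_function \<psi>" "is \<in> lists Basis" "\<epsilon> > 0"
  shows "(1 / \<epsilon>) ^ length is * mollify u (iter_deriv is \<psi>) \<epsilon> x = mollify g \<psi> \<epsilon> x"
proof -
  define v c where "v = (1 / \<epsilon>) *\<^sub>R x" and "c = - (1 / \<epsilon>)"
  have arg: "(1 / \<epsilon>) *\<^sub>R (x - y) = v + c *\<^sub>R y" for y by (simp add: scaleR_diff_right v_def c_def)
  have "c \<noteq> 0" using \<open>\<epsilon> > 0\<close> by (simp add: c_def)
  have smooth: "smooth_fun \<psi>" using assms by (simp add: test_function_def)
  have "test_function (\<lambda>y. \<psi> (v + c *\<^sub>R y))"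
    using assms \<open>c \<noteq> 0\<close> by (intro test_function_affine) auto
  with assms(1) have "(LINT y|lebesgue. u y * iter_deriv is (\<lambda>y. \<psi> (v + c *\<^sub>R y)) y)
      = (- 1) ^ length is * (LINT y|lebesgue. g y * \<psi> (v + c *\<^sub>R y))"
    unfolding has_weak_deriv_def by blast
  moreover have "u y * iter_deriv is (\<lambda>y. \<psi> (v + c *\<^sub>R y)) y
      = c ^ length is * (u y * iter_deriv is \<psi> (v + c *\<^sub>R y))" for y
    unfolding iter_deriv_affine[OF smooth assms(3)] by simp
  ultimately have "c ^ length is * (LINT y|lebesgue. u y * iter_deriv is \<psi> (v + c *\<^sub>R y))
      = (- 1) ^ length is * (LINT y|lebesgue. g y * \<psi> (v + c *\<^sub>R y))"
    by simp
  moreover have "c ^ length is = (- 1) ^ length is * (1 / \<epsilon>) ^ length is"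
    unfolding c_def by (subst power_mult_distrib[symmetric]) simp
  ultimately have eq: "(1 / \<epsilon>) ^ length is * (LINT y|lebesgue. u y * iter_deriv is \<psi> (v + c *\<^sub>R y))
      = (LINT y|lebesgue. g y * \<psi> (v + c *\<^sub>R y))"
    by (simp add: mult.assoc)
  show ?thesis
    unfolding mollify_def arg eq[symmetric] by (rule mult.left_commute)
qed

lemma test_function_directional_derivative:
  assumes "test_function \<psi>" "i \<in> Basis"
  shows "((\<lambda>t. \<psi> (v + t *\<^sub>R c *\<^sub>R i)) has_real_derivative c * iter_deriv [i] \<psi> (v + t *\<^sub>R c *\<^sub>R i)) (at t)"
proof -
  define p where "p = v + t *\<^sub>R c *\<^sub>R i"
  have "iter_deriv [] \<psi> differentiable (at p)"
    using assms unfolding test_function_def smooth_fun_def by blast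
  then have d: "\<psi> differentiable (at p)" by simp
  have "((\<lambda>t. v + t *\<^sub>R c *\<^sub>R i) has_derivative (\<lambda>s. s *\<^sub>R c *\<^sub>R i)) (at t)"
    by (auto intro!: derivative_eq_intros)
  from has_derivative_compose[OF this d[unfolded frechet_derivative_works p_def]]
  have "((\<lambda>t. \<psi> (v + t *\<^sub>R c *\<^sub>R i)) has_derivative
      (\<lambda>s. frechet_derivative \<psi> (at p) (s *\<^sub>R c *\<^sub>R i))) (at t)"
    unfolding p_def .
  moreover have "(\<lambda>s. frechet_derivative \<psi> (at p) (s *\<^sub>R c *\<^sub>R i)) = (*) (c * frechet_derivative \<psi> (at p) i)"
    unfolding linear_cmul[OF linear_frechet_derivative[OF d]] by (simp add: fun_eq_iff)
  ultimately show ?thesis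
    unfolding has_field_derivative_def by (simp add: p_def)
qed

lemma mollify_kernel_support:
  assumes "norm y > norm x + \<bar>\<epsilon>\<bar> * r" "\<And>w. norm w > r \<Longrightarrow> \<psi> w = (0::real)" "\<epsilon> \<noteq> 0"
  shows "\<psi> ((1 / \<epsilon>) *\<^sub>R (x - y)) = 0"
proof (rule assms(2))
  have "\<bar>\<epsilon>\<bar> * r < norm (x - y)" using assms(1) norm_triangle_ineq3[of y x] norm_minus_commute[of x y] by simp
  then show "r < norm ((1 / \<epsilon>) *\<^sub>R (x - y))" using assms(3) by (simp add: pos_less_divide_eq mult.commute)
qed

text \<open>Derivatives are taken only along coordinate lines, which is the form in which the
  maximum principle uses them.\<close>

lemma mollify_directional_derivative:
  assumes h: "h \<in> Lp_loc 1" and \<psi>: "test_function \<psi>" and i: "i \<in> Basis" and \<epsilon>: "\<epsilon> > 0"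
  shows "((\<lambda>t. mollify h \<psi> \<epsilon> (x + t *\<^sub>R i)) has_real_derivative
    (1 / \<epsilon>) * mollify h (iter_deriv [i] \<psi>) \<epsilon> (x + t *\<^sub>R i)) (at t)"
proof -
  let ?\<psi>' = "iter_deriv [i] \<psi>"
  have \<psi>': "test_function ?\<psi>'" using \<psi> i by (intro test_function_iter_deriv) auto
  obtain r where r: "r > 0" "\<And>x. norm x > r \<Longrightarrow> \<psi> x = 0" using test_function_support_ball[OF \<psi>] by metis
  obtain r' where "\<And>x. norm x > r' \<Longrightarrow> ?\<psi>' x = 0" using test_function_support_ball[OF \<psi>'] by metis
  then obtain M where M: "\<And>x. \<bar>?\<psi>' x\<bar> \<le> M"
    using continuous_compact_support_bounded[OF test_function_continuous[OF \<psi>']] by metis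
  let ?K = "\<lambda>s y. \<psi> ((1 / \<epsilon>) *\<^sub>R ((x + s *\<^sub>R i) - y))"
  let ?K' = "\<lambda>s y. (1 / \<epsilon>) * ?\<psi>' ((1 / \<epsilon>) *\<^sub>R ((x + s *\<^sub>R i) - y))"
  have "((\<lambda>s. LINT y|lebesgue. h y * ?K s y) has_real_derivative (LINT y|lebesgue. h y * ?K' t y)) (at t)"
  proof (rule DERIV_integral_kernel[OF h zero_less_one, where M = "(1 / \<epsilon>) * M"
        and R = "norm x + (\<bar>t\<bar> + 1) + \<bar>\<epsilon>\<bar> * r"])
    fix s y
    have arg: "(1 / \<epsilon>) *\<^sub>R ((x + s *\<^sub>R i) - y) = (1 / \<epsilon>) *\<^sub>R (x - y) + s *\<^sub>R (1 / \<epsilon>) *\<^sub>R i" for s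
      by (simp add: algebra_simps)
    show "((\<lambda>s. ?K s y) has_real_derivative ?K' s y) (at s)"
      unfolding arg by (rule test_function_directional_derivative[OF \<psi> i])
    show "\<bar>?K' s y\<bar> \<le> (1 / \<epsilon>) * M"
      using M \<epsilon> by (simp add: abs_mult divide_right_mono)
    show "continuous_on UNIV (?K s)"
      by (rule continuous_on_compose2[OF test_function_continuous[OF \<psi>]]) (auto intro!: continuous_intros)
    assume s: "\<bar>s - t\<bar> < 1" and y: "norm y > norm x + (\<bar>t\<bar> + 1) + \<bar>\<epsilon>\<bar> * r"
    have "norm (x + s *\<^sub>R i) \<le> norm x + \<bar>s\<bar>" using norm_triangle_ineq[of x "s *\<^sub>R i"] i by simp
    also have "\<dots> \<le> norm x + (\<bar>t\<bar> + 1)" using s by linarith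
    finally have "norm y > norm (x + s *\<^sub>R i) + \<bar>\<epsilon>\<bar> * r" using y by linarith
    then show "?K s y = 0" by (rule mollify_kernel_support) (use r \<epsilon> in auto)
  qed
  moreover have "(LINT y|lebesgue. h y * ?K' t y)
      = (1 / \<epsilon>) * (LINT y|lebesgue. h y * ?\<psi>' ((1 / \<epsilon>) *\<^sub>R ((x + t *\<^sub>R i) - y)))"
    by (subst integral_mult_right_zero[symmetric]) (simp only: mult.left_commute)
  ultimately have "((\<lambda>s. LINT y|lebesgue. h y * ?K s y) has_real_derivative
      (1 / \<epsilon>) * (LINT y|lebesgue. h y * ?\<psi>' ((1 / \<epsilon>) *\<^sub>R ((x + t *\<^sub>R i) - y)))) (at t)"
    by (simp only:)
  from DERIV_cmult[OF this, of "(1 / \<epsilon>) ^ DIM('a)"] show ?thesis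
    unfolding mollify_def by (simp only: mult.left_commute)
qed

lemma continuous_on_mollify:
  assumes h: "h \<in> Lp_loc 1" and \<psi>: "test_function \<psi>" and \<epsilon>: "\<epsilon> > 0"
  shows "continuous_on UNIV (mollify h \<psi> \<epsilon>)"
proof -
  obtain r where r: "r > 0" "\<And>x. norm x > r \<Longrightarrow> \<psi> x = 0" using test_function_support_ball[OF \<psi>] by metis
  have "continuous_on UNIV (\<lambda>x. LINT y|lebesgue. h y * \<psi> ((1 / \<epsilon>) *\<^sub>R (x - y)))"
  proof (rule continuous_on_convolution[OF h, where \<psi> = "\<lambda>w. \<psi> ((1 / \<epsilon>) *\<^sub>R w)" and r = "\<epsilon> * r"])
    show "continuous_on UNIV (\<lambda>w. \<psi> ((1 / \<epsilon>) *\<^sub>R w))"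
      by (rule continuous_on_compose2[OF test_function_continuous[OF \<psi>]]) (auto intro!: continuous_intros)
    show "\<psi> ((1 / \<epsilon>) *\<^sub>R w) = 0" if "norm w > \<epsilon> * r" for w
      using that \<epsilon> by (intro r(2)) (simp add: pos_less_divide_eq mult.commute)
  qed
  then show ?thesis unfolding mollify_def by (intro continuous_intros)
qed

section \<open>Estimates by averages over corner cubes, and convergence of mollifications\<close>

lemma anchored_kernel_support:
  fixes \<psi> :: "'a::euclidean_space \<Rightarrow> real"
  assumes "anchored \<psi>" "\<epsilon> > 0" "y \<notin> cbox x (x + \<epsilon> *\<^sub>R One)"
  shows "\<psi> ((1 / \<epsilon>) *\<^sub>R (x - y)) = 0"
proof -
  have "- ((1 / \<epsilon>) *\<^sub>R (x - y)) \<notin> cbox 0 One"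
  proof
    assume a: "- ((1 / \<epsilon>) *\<^sub>R (x - y)) \<in> cbox 0 One"
    have "x \<bullet> i \<le> y \<bullet> i \<and> y \<bullet> i \<le> (x + \<epsilon> *\<^sub>R One) \<bullet> i" if i: "i \<in> Basis" for i
    proof -
      have "0 \<le> (y \<bullet> i - x \<bullet> i) / \<epsilon>" "(y \<bullet> i - x \<bullet> i) / \<epsilon> \<le> 1"
        using a i by (auto simp: mem_box inner_diff_left diff_divide_distrib)
      then show ?thesis using i assms(2)
        by (simp add: inner_add_left zero_le_divide_iff divide_le_eq)
    qed
    then show False using assms(3) by (simp add: mem_box)
  qed
  with assms(1) show ?thesis unfolding anchored_def by blast
qed

lemma integral_indicator_corner_cube:
  fixes x :: "'a::euclidean_space"
  assumes "\<epsilon> > 0"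
  shows "(LINT y|lebesgue. indicator (cbox x (x + \<epsilon> *\<^sub>R One)) y) = \<epsilon> ^ DIM('a)"
proof -
  have "(LINT y|lebesgue. indicator (cbox x (x + \<epsilon> *\<^sub>R One)) y) = measure lebesgue (cbox x (x + \<epsilon> *\<^sub>R One))"
    by simp
  also have "\<dots> = (\<Prod>i\<in>Basis. (x + \<epsilon> *\<^sub>R One) \<bullet> i - x \<bullet> i)"
    using assms by (subst measure_completion) (auto simp: inner_add_left intro!: content_cbox)
  also have "\<dots> = (\<Prod>i\<in>(Basis::'a set). \<epsilon>)"
    by (intro prod.cong) (auto simp: inner_add_left)
  finally show ?thesis by simp
qed

lemma mollify_bound:
  fixes \<psi> :: "'a::euclidean_space \<Rightarrow> real"
  assumes g: "g \<in> Lp_loc 1" and \<psi>: "anchored \<psi>" "test_function \<psi>" "\<And>w. \<bar>\<psi> w\<bar> \<le> M" and \<epsilon>: "\<epsilon> > 0"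
  shows "\<bar>mollify g \<psi> \<epsilon> x\<bar> \<le>
    M * ((1 / \<epsilon>) ^ DIM('a) * (LINT y|lebesgue. indicator (cbox x (x + \<epsilon> *\<^sub>R One)) y * \<bar>g y\<bar>))"
proof -
  have M: "0 \<le> M" using \<psi>(3)[of 0] by linarith
  have "\<bar>LINT y|lebesgue. g y * \<psi> ((1 / \<epsilon>) *\<^sub>R (x - y))\<bar>
      \<le> (LINT y|lebesgue. M * (indicator (cbox x (x + \<epsilon> *\<^sub>R One)) y * \<bar>g y\<bar>))"
  proof (rule integral_abs_bound[THEN order_trans], rule integral_mono_AE')
    show "integrable lebesgue (\<lambda>y. M * (indicator (cbox x (x + \<epsilon> *\<^sub>R One)) y * \<bar>g y\<bar>))"
      using Lp_loc_1_integrable(2)[OF g, of "cbox x (x + \<epsilon> *\<^sub>R One)"] by simp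
    show "AE y in lebesgue. \<bar>g y * \<psi> ((1 / \<epsilon>) *\<^sub>R (x - y))\<bar>
        \<le> M * (indicator (cbox x (x + \<epsilon> *\<^sub>R One)) y * \<bar>g y\<bar>)"
    proof (rule AE_I2)
      fix y
      show "\<bar>g y * \<psi> ((1 / \<epsilon>) *\<^sub>R (x - y))\<bar> \<le> M * (indicator (cbox x (x + \<epsilon> *\<^sub>R One)) y * \<bar>g y\<bar>)"
      proof (cases "y \<in> cbox x (x + \<epsilon> *\<^sub>R One)")
        case True
        then show ?thesis
          using mult_left_mono[OF \<psi>(3)[of "(1 / \<epsilon>) *\<^sub>R (x - y)"], of "\<bar>g y\<bar>"]
          by (simp add: abs_mult mult.commute)
      next
        case False
        then show ?thesis using anchored_kernel_support[OF \<psi>(1) \<epsilon> False] M by simp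
      qed
    qed
    show "AE y in lebesgue. 0 \<le> M * (indicator (cbox x (x + \<epsilon> *\<^sub>R One)) y * \<bar>g y\<bar>)"
      using M by simp
  qed
  then have "\<bar>LINT y|lebesgue. g y * \<psi> ((1 / \<epsilon>) *\<^sub>R (x - y))\<bar>
      \<le> M * (LINT y|lebesgue. indicator (cbox x (x + \<epsilon> *\<^sub>R One)) y * \<bar>g y\<bar>)" by simp
  from mult_left_mono[OF this, of "(1 / \<epsilon>) ^ DIM('a)"] \<epsilon> show ?thesis
    unfolding mollify_def by (simp add: abs_mult mult_ac)
qed

lemma integrable_kernel:
  fixes \<psi> :: "'a::euclidean_space \<Rightarrow> real"
  assumes h: "h \<in> Lp_loc 1" and \<psi>: "test_function \<psi>" and \<epsilon>: "\<epsilon> > 0"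
  shows "integrable lebesgue (\<lambda>y. h y * \<psi> ((1 / \<epsilon>) *\<^sub>R (x - y)))"
proof -
  obtain r where r: "r > 0" "\<And>x. norm x > r \<Longrightarrow> \<psi> x = 0" using test_function_support_ball[OF \<psi>] by metis
  show ?thesis
  proof (rule integrable_mult_continuous_kernel[OF h])
    show "continuous_on UNIV (\<lambda>y. \<psi> ((1 / \<epsilon>) *\<^sub>R (x - y)))"
      by (rule continuous_on_compose2[OF test_function_continuous[OF \<psi>]]) (auto intro!: continuous_intros)
    show "\<psi> ((1 / \<epsilon>) *\<^sub>R (x - y)) = 0" if "norm y > norm x + \<bar>\<epsilon>\<bar> * r" for y
      by (rule mollify_kernel_support[OF that]) (use r \<epsilon> in auto)
  qed
qed

lemma Lp_loc_1_diff_const: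
  assumes h: "h \<in> Lp_loc 1" shows "(\<lambda>y. h y - c) \<in> Lp_loc 1"
proof (rule Lp_loc_1I)
  show m: "(\<lambda>y. h y - c) \<in> borel_measurable lebesgue" using Lp_loc_1_measurable[OF h] by measurable
  fix K :: "'a set" assume K: "compact K"
  have 1: "integrable lebesgue (\<lambda>y. indicator K y * h y)" by (rule Lp_loc_1_integrable(1)[OF h K])
  have "(\<lambda>_::'a. c) \<in> Lp_loc 1" by (rule continuous_Lp_loc) auto
  from Lp_loc_1_integrable(1)[OF this K] have "integrable lebesgue (\<lambda>y. indicator K y * c)" .
  from integrable_abs[OF Bochner_Integration.integrable_diff[OF 1 this]]
  show "integrable lebesgue (\<lambda>x. indicator K x * \<bar>h x - c\<bar>)"
    by (rule Bochner_Integration.integrable_cong[THEN iffD1, rotated 2]) (auto simp: indicator_def)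
qed

lemma mollify_diff_const:
  fixes \<rho> :: "'a::euclidean_space \<Rightarrow> real"
  assumes h: "h \<in> Lp_loc 1" and \<rho>: "test_function \<rho>" "(LINT w|lebesgue. \<rho> w) = 1" and \<epsilon>: "\<epsilon> > 0"
  shows "mollify (\<lambda>y. h y - c) \<rho> \<epsilon> x = mollify h \<rho> \<epsilon> x - c"
proof -
  let ?k = "\<lambda>y. \<rho> ((1 / \<epsilon>) *\<^sub>R (x - y))"
  have "(\<lambda>_::'a. c) \<in> Lp_loc 1" by (rule continuous_Lp_loc) auto
  from integrable_kernel[OF this \<rho>(1) \<epsilon>] have "integrable lebesgue (\<lambda>y. c * ?k y)" .
  then have "(LINT y|lebesgue. (h y - c) * ?k y) = (LINT y|lebesgue. h y * ?k y) - c * (LINT y|lebesgue. ?k y)"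
    using integrable_kernel[OF h \<rho>(1) \<epsilon>, of x] by (simp add: left_diff_distrib)
  then have "mollify (\<lambda>y. h y - c) \<rho> \<epsilon> x
      = mollify h \<rho> \<epsilon> x - c * ((1 / \<epsilon>) ^ DIM('a) * (LINT y|lebesgue. ?k y))"
    unfolding mollify_def by (simp only: right_diff_distrib mult.left_commute)
  then show ?thesis
    using integral_affine_kernel[OF test_function_continuous[OF \<rho>(1)] \<epsilon>, of x] \<rho>(2) by simp
qed

text \<open>As \<open>\<rho>\<close> has integral 1, subtracting a constant commutes with
  mollification. For \<open>c = h x\<close> the bound is a mean oscillation of \<open>h\<close> at
  \<open>x\<close>; it yields uniform convergence for continuous functions and convergence at
  Lebesgue points in general.\<close>

lemma mollify_minus_value_bound:
  fixes \<rho> :: "'a::euclidean_space \<Rightarrow> real"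
  assumes h: "h \<in> Lp_loc 1" and \<rho>: "anchored \<rho>" "test_function \<rho>" "(LINT w|lebesgue. \<rho> w) = 1"
    "\<And>w. \<bar>\<rho> w\<bar> \<le> M" and \<epsilon>: "\<epsilon> > 0"
  shows "\<bar>mollify h \<rho> \<epsilon> x - c\<bar> \<le>
    M * ((1 / \<epsilon>) ^ DIM('a) * (LINT y|lebesgue. indicator (cbox x (x + \<epsilon> *\<^sub>R One)) y * \<bar>h y - c\<bar>))"
  using mollify_bound[OF Lp_loc_1_diff_const[OF h, of c] \<rho>(1,2,4) \<epsilon>, of x]
  by (simp add: mollify_diff_const[OF h \<rho>(2,3) \<epsilon>])

lemma mollify_uniform_limit:
  fixes q :: "'a::euclidean_space \<Rightarrow> real"
  assumes q: "continuous_on UNIV q" and \<rho>: "anchored \<rho>" "test_function \<rho>" "(LINT w|lebesgue. \<rho> w) = 1"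
  shows "uniform_limit (cball 0 R) (\<lambda>n. mollify q \<rho> (1 / real (Suc n))) q sequentially"
proof (rule uniform_limitI)
  fix e :: real assume e: "e > 0"
  obtain r where "\<And>x. norm x > r \<Longrightarrow> \<rho> x = 0" using test_function_support_ball[OF \<rho>(2)] by metis
  then obtain M where M: "M > 0" "\<And>x. \<bar>\<rho> x\<bar> \<le> M"
    using continuous_compact_support_bounded[OF test_function_continuous[OF \<rho>(2)]] by metis
  let ?L = "norm (One::'a)"
  \<comment> \<open>The larger ball contains every cube of side at most 1 with its corner in the
    ball of radius \<open>R\<close>.\<close>
  have "uniformly_continuous_on (cball 0 (R + ?L)) q"
    using q by (intro compact_uniformly_continuous) (auto intro: continuous_on_subset)
  then obtain d where d: "d > 0"
    "\<And>x y. x \<in> cball 0 (R + ?L) \<Longrightarrow> y \<in> cball 0 (R + ?L) \<Longrightarrow> dist y x < d \<Longrightarrow> dist (q y) (q x) < e / (2 * M)"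
    unfolding uniformly_continuous_on_def using e M by (metis divide_pos_pos mult_pos_pos zero_less_numeral)
  have "(\<lambda>n. ?L * (1 / real (Suc n))) \<longlonglongrightarrow> ?L * 0"
    by (intro tendsto_mult tendsto_const LIMSEQ_inverse_real_of_nat[unfolded inverse_eq_divide])
  then have "\<forall>\<^sub>F n in sequentially. ?L * (1 / real (Suc n)) < d"
    using d by (intro order_tendstoD) auto
  then show "\<forall>\<^sub>F n in sequentially. \<forall>x\<in>cball 0 R. dist (mollify q \<rho> (1 / real (Suc n)) x) (q x) < e"
  proof eventually_elim
    case (elim n)
    define \<epsilon> where "\<epsilon> = 1 / real (Suc n)"
    have \<epsilon>: "0 < \<epsilon>" "\<epsilon> \<le> 1" "?L * \<epsilon> < d" using elim by (auto simp: \<epsilon>_def)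
    show ?case
    proof
      fix x :: 'a assume x: "x \<in> cball 0 R"
      let ?C = "cbox x (x + \<epsilon> *\<^sub>R One)"
      have q': "q \<in> Lp_loc 1" using q by (rule continuous_Lp_loc) simp
      have near: "\<bar>q y - q x\<bar> \<le> e / (2 * M)" if "y \<in> ?C" for y
      proof -
        have "\<bar>(y - x) \<bullet> i\<bar> \<le> \<bar>(\<epsilon> *\<^sub>R One) \<bullet> i\<bar>" if "i \<in> Basis" for i
          using \<open>y \<in> ?C\<close> that \<epsilon> by (auto simp: mem_box inner_diff_left inner_add_left)
        then have "norm (y - x) \<le> norm (\<epsilon> *\<^sub>R (One::'a))" by (rule norm_le_componentwise)
        then have n: "norm (y - x) \<le> ?L * \<epsilon>" using \<epsilon> by (simp add: mult.commute)
        have "?L * \<epsilon> \<le> ?L" using \<epsilon> by (simp add: mult_left_le)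
        moreover have "norm y \<le> norm x + norm (y - x)" by norm
        moreover have "norm x \<le> R" "0 \<le> ?L" using x by auto
        ultimately have "norm y \<le> R + ?L" "norm x \<le> R + ?L" "norm (y - x) < d"
          using n \<epsilon>(3) by linarith+
        then have "dist (q y) (q x) < e / (2 * M)"
          by (intro d(2)) (auto simp: dist_norm)
        then show ?thesis by (simp add: dist_real_def)
      qed
      have "(LINT y|lebesgue. indicator ?C y * \<bar>q y - q x\<bar>) \<le> (LINT y|lebesgue. (e / (2 * M)) * indicator ?C y)"
      proof (rule integral_mono)
        show "integrable lebesgue (\<lambda>y. indicator ?C y * \<bar>q y - q x\<bar>)"
          by (rule Lp_loc_1_integrable(2)[OF Lp_loc_1_diff_const[OF q']]) simp
        have "(\<lambda>_::'a. e / (2 * M)) \<in> Lp_loc 1" by (rule continuous_Lp_loc) auto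
        from Lp_loc_1_integrable(1)[OF this, of ?C]
        show "integrable lebesgue (\<lambda>y. (e / (2 * M)) * indicator ?C y)" by (simp add: mult.commute)
      qed (use near e M in \<open>auto simp: indicator_def\<close>)
      also have "\<dots> = e / (2 * M) * \<epsilon> ^ DIM('a)"
        using integral_indicator_corner_cube[OF \<epsilon>(1), of x] by simp
      finally have "(1 / \<epsilon>) ^ DIM('a) * (LINT y|lebesgue. indicator ?C y * \<bar>q y - q x\<bar>)
          \<le> (1 / \<epsilon>) ^ DIM('a) * (e / (2 * M) * \<epsilon> ^ DIM('a))"
        using \<epsilon> by (intro mult_left_mono) auto
      also have "\<dots> = e / (2 * M)" using \<epsilon> by (simp add: power_one_over field_simps)
      finally have "M * ((1 / \<epsilon>) ^ DIM('a) * (LINT y|lebesgue. indicator ?C y * \<bar>q y - q x\<bar>)) \<le> M * (e / (2 * M))"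
        using M by (intro mult_left_mono) auto
      also have "\<dots> = e / 2" using M by simp
      finally have "\<bar>mollify q \<rho> \<epsilon> x - q x\<bar> \<le> e / 2"
        using mollify_minus_value_bound[OF q' \<rho> M(2) \<epsilon>(1), of x "q x"] by linarith
      then show "dist (mollify q \<rho> (1 / real (Suc n)) x) (q x) < e"
        using e by (simp add: dist_real_def \<epsilon>_def)
    qed
  qed
qed

text \<open>Differentiation of integrals applies to |h - c| for a fixed \<open>c\<close> and leaves
  an exceptional null set depending on \<open>c\<close>. Restricting \<open>c\<close> to the
  rationals keeps the union of these sets null; the value \<open>h x\<close> is then approximated by
  a rational.\<close>

lemma AE_Lebesgue_point:
  fixes h :: "'a::euclidean_space \<Rightarrow> real"
  assumes h: "h \<in> Lp_loc 1"
  shows "AE x in lebesgue. \<forall>e>0. \<exists>d>0. \<forall>\<epsilon>. 0 < \<epsilon> \<and> \<epsilon> < d \<longrightarrow>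
    (1 / \<epsilon>) ^ DIM('a) * (LINT y|lebesgue. indicator (cbox x (x + \<epsilon> *\<^sub>R One)) y * \<bar>h y - h x\<bar>) < e"
proof -
  define A where "A c \<epsilon> x = (1 / \<epsilon>) ^ DIM('a) * (LINT y|lebesgue. indicator (cbox x (x + \<epsilon> *\<^sub>R One)) y * \<bar>h y - c\<bar>)" for c \<epsilon> x
  have int: "integrable lebesgue (\<lambda>y. indicator (cbox a b) y * \<bar>h y - c\<bar>)" for a b c
    by (rule Lp_loc_1_integrable(2)[OF Lp_loc_1_diff_const[OF h]]) simp
  then have si: "set_integrable lebesgue (cbox a b) (\<lambda>y. \<bar>h y - c\<bar>)" for a b c
    by (simp add: set_integrable_def)
  have "\<exists>N. negligible N \<and> (\<forall>x e. x \<notin> N \<longrightarrow> 0 < e \<longrightarrow>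
      (\<exists>d>0. \<forall>\<epsilon>. 0 < \<epsilon> \<and> \<epsilon> < d \<longrightarrow> \<bar>A c \<epsilon> x - \<bar>h x - c\<bar>\<bar> < e))" for c
  proof -
    obtain N where N: "negligible N"
      "\<And>x e. \<lbrakk>x \<notin> N; 0 < e\<rbrakk> \<Longrightarrow> \<exists>d>0. \<forall>\<epsilon>. 0 < \<epsilon> \<and> \<epsilon> < d \<longrightarrow>
         norm (integral (cbox x (x + \<epsilon> *\<^sub>R One)) (\<lambda>y. \<bar>h y - c\<bar>) /\<^sub>R \<epsilon> ^ DIM('a) - \<bar>h x - c\<bar>) < e"
      using integrable_ccontinuous_explicit[of "\<lambda>y. \<bar>h y - c\<bar>"] set_lebesgue_integral_eq_integral(1)[OF si] by metis
    have "integral (cbox x (x + \<epsilon> *\<^sub>R One)) (\<lambda>y. \<bar>h y - c\<bar>) /\<^sub>R \<epsilon> ^ DIM('a) = A c \<epsilon> x" for x \<epsilon>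
      unfolding A_def set_lebesgue_integral_eq_integral(2)[OF si, symmetric] set_lebesgue_integral_def
      by (simp add: power_one_over inverse_eq_divide)
    with N show ?thesis by (intro exI[of _ N]) auto
  qed
  then obtain N where N: "\<And>c. negligible (N c)" "\<And>c x e. x \<notin> N c \<Longrightarrow> 0 < e \<Longrightarrow>
      \<exists>d>0. \<forall>\<epsilon>. 0 < \<epsilon> \<and> \<epsilon> < d \<longrightarrow> \<bar>A c \<epsilon> x - \<bar>h x - c\<bar>\<bar> < e" by metis
  have "negligible (\<Union>c\<in>\<rat>. N c)"
    using N(1) by (intro negligible_countable_Union) (auto simp: countable_rat)
  then have "AE x in lebesgue. x \<notin> (\<Union>c\<in>\<rat>. N c)"
    by (intro AE_not_in) (simp add: negligible_iff_null_sets)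
  then have "AE x in lebesgue. \<forall>e>0. \<exists>d>0. \<forall>\<epsilon>. 0 < \<epsilon> \<and> \<epsilon> < d \<longrightarrow> A (h x) \<epsilon> x < e"
  proof (rule eventually_mono, intro allI impI)
    fix x and e :: real assume x: "x \<notin> (\<Union>c\<in>\<rat>. N c)" and e: "e > 0"
    \<comment> \<open>The average of |h - h x| exceeds that of |h - c| by at most |c - h x| < e/4,
      and the latter is below |h x - c| + e/4 for small cubes, which leaves 3e/4 in total.\<close>
    obtain c where c: "c \<in> \<rat>" "h x < c" "c < h x + e / 4"
      using Rats_dense_in_real[of "h x" "h x + e / 4"] e by auto
    obtain d where d: "d > 0" "\<And>\<epsilon>. 0 < \<epsilon> \<Longrightarrow> \<epsilon> < d \<Longrightarrow> \<bar>A c \<epsilon> x - \<bar>h x - c\<bar>\<bar> < e / 4"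
      using N(2)[of x c "e / 4"] x c e by auto
    have "A (h x) \<epsilon> x < e" if \<epsilon>: "0 < \<epsilon>" "\<epsilon> < d" for \<epsilon>
    proof -
      let ?C = "cbox x (x + \<epsilon> *\<^sub>R One)"
      have ic: "integrable lebesgue (\<lambda>y. \<bar>c - h x\<bar> * indicator ?C y)"
        using Lp_loc_1_integrable(1)[OF continuous_Lp_loc[of "\<lambda>_. \<bar>c - h x\<bar>" 1], of ?C]
        by (simp add: mult.commute)
      have "(LINT y|lebesgue. indicator ?C y * \<bar>h y - h x\<bar>)
          \<le> (LINT y|lebesgue. indicator ?C y * \<bar>h y - c\<bar> + \<bar>c - h x\<bar> * indicator ?C y)"
        by (rule integral_mono[OF int Bochner_Integration.integrable_add[OF int ic]])
           (auto simp: indicator_def)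
      also have "\<dots> = (LINT y|lebesgue. indicator ?C y * \<bar>h y - c\<bar>) + \<bar>c - h x\<bar> * \<epsilon> ^ DIM('a)"
        using Bochner_Integration.integral_add[OF int ic] integral_indicator_corner_cube[OF \<epsilon>(1), of x] by simp
      finally have "A (h x) \<epsilon> x \<le> (1 / \<epsilon>) ^ DIM('a) *
          ((LINT y|lebesgue. indicator ?C y * \<bar>h y - c\<bar>) + \<bar>c - h x\<bar> * \<epsilon> ^ DIM('a))"
        unfolding A_def using \<epsilon> by (intro mult_left_mono) auto
      also have "\<dots> = A c \<epsilon> x + \<bar>c - h x\<bar>"
        unfolding A_def using \<epsilon> by (simp add: distrib_left power_one_over)
      finally show ?thesis using d(2)[OF \<epsilon>] c by linarith
    qed
    with d(1) show "\<exists>d>0. \<forall>\<epsilon>. 0 < \<epsilon> \<and> \<epsilon> < d \<longrightarrow> A (h x) \<epsilon> x < e" by blast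
  qed
  then show ?thesis unfolding A_def .
qed

lemma AE_mollify_tendsto:
  fixes h :: "'a::euclidean_space \<Rightarrow> real"
  assumes h: "h \<in> Lp_loc 1" and \<rho>: "anchored \<rho>" "test_function \<rho>" "(LINT w|lebesgue. \<rho> w) = 1"
  shows "AE x in lebesgue. (\<lambda>n. mollify h \<rho> (1 / real (Suc n)) x) \<longlonglongrightarrow> h x"
  using AE_Lebesgue_point[OF h]
proof (rule eventually_mono)
  obtain r where "\<And>x. norm x > r \<Longrightarrow> \<rho> x = 0" using test_function_support_ball[OF \<rho>(2)] by metis
  then obtain M where M: "M > 0" "\<And>x. \<bar>\<rho> x\<bar> \<le> M"
    using continuous_compact_support_bounded[OF test_function_continuous[OF \<rho>(2)]] by metis
  fix x assume L: "\<forall>e>0. \<exists>d>0. \<forall>\<epsilon>. 0 < \<epsilon> \<and> \<epsilon> < d \<longrightarrow>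
    (1 / \<epsilon>) ^ DIM('a) * (LINT y|lebesgue. indicator (cbox x (x + \<epsilon> *\<^sub>R One)) y * \<bar>h y - h x\<bar>) < e"
  show "(\<lambda>n. mollify h \<rho> (1 / real (Suc n)) x) \<longlonglongrightarrow> h x"
  proof (rule tendstoI)
    fix e :: real assume e: "e > 0"
    then have "e / M > 0" using M by simp
    from L[rule_format, OF this] obtain d where d: "d > 0" "\<And>\<epsilon>. 0 < \<epsilon> \<Longrightarrow> \<epsilon> < d \<Longrightarrow>
      (1 / \<epsilon>) ^ DIM('a) * (LINT y|lebesgue. indicator (cbox x (x + \<epsilon> *\<^sub>R One)) y * \<bar>h y - h x\<bar>) < e / M"
      by blast
    have "\<forall>\<^sub>F n in sequentially. 1 / real (Suc n) < d"
      using LIMSEQ_inverse_real_of_nat[unfolded inverse_eq_divide] d(1) by (intro order_tendstoD)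
    then show "\<forall>\<^sub>F n in sequentially. dist (mollify h \<rho> (1 / real (Suc n)) x) (h x) < e"
    proof eventually_elim
      case (elim n)
      have pos: "0 < 1 / real (Suc n)" by simp
      from mult_strict_left_mono[OF d(2)[OF pos elim] M(1)]
        mollify_minus_value_bound[OF h \<rho> M(2) pos, of x "h x"]
      show ?case using M by (simp add: dist_real_def)
    qed
  qed
qed

subsection \<open>Morrey's inequality for mollifications\<close>

lemma test_function_has_derivative:
  assumes "test_function \<psi>"
  shows "(\<psi> has_derivative frechet_derivative \<psi> (at x)) (at x)"
proof -
  have "iter_deriv [] \<psi> differentiable (at x)"
    using assms unfolding test_function_def smooth_fun_def by blast
  then show ?thesis by (simp add: frechet_derivative_works)
qed

text \<open>The sum is the divergence of w \<psi> (w). Up to the factor -\<epsilon>^(-N-1), the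
  right-hand side at p = z / \<epsilon> is the derivative of \<epsilon>^(-N) \<psi> (z / \<epsilon>)
  with respect to \<epsilon>.\<close>

lemma sum_partial_derivs_coordinate_mult:
  fixes \<psi> :: "'a::euclidean_space \<Rightarrow> real"
  assumes "test_function \<psi>"
  shows "(\<Sum>j\<in>Basis. iter_deriv [j] (\<lambda>w. (w \<bullet> j) * \<psi> w) p)
    = real DIM('a) * \<psi> p + frechet_derivative \<psi> (at p) p"
proof -
  let ?D = "frechet_derivative \<psi> (at p)"
  have D: "(\<psi> has_derivative ?D) (at p)" by (rule test_function_has_derivative[OF assms])
  then have lin: "linear ?D" by (rule has_derivative_linear)
  have "iter_deriv [j] (\<lambda>w. (w \<bullet> j) * \<psi> w) p = (p \<bullet> j) * ?D j + \<psi> p" if "j \<in> Basis" for j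
  proof -
    have "((\<lambda>w. (w \<bullet> j) * \<psi> w) has_derivative (\<lambda>h. (p \<bullet> j) * ?D h + (h \<bullet> j) * \<psi> p)) (at p)"
      by (intro has_derivative_mult D) (auto intro!: derivative_eq_intros)
    from frechet_derivative_at[OF this, symmetric] show ?thesis using that by simp
  qed
  then have "(\<Sum>j\<in>Basis. iter_deriv [j] (\<lambda>w. (w \<bullet> j) * \<psi> w) p)
      = (\<Sum>j\<in>Basis. (p \<bullet> j) * ?D j) + real DIM('a) * \<psi> p"
    by (simp add: sum.distrib)
  also have "(\<Sum>j\<in>Basis. (p \<bullet> j) * ?D j) = ?D (\<Sum>j\<in>Basis. (p \<bullet> j) *\<^sub>R j)"
    using lin by (simp add: linear_sum linear_cmul)
  finally show ?thesis by (simp add: euclidean_representation)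
qed

text \<open>The scale derivative of the kernel is -1/\<epsilon> times the rescaled divergence of w
  \<psi> (w). A divergence can be passed on to \<open>h\<close> by weak differentiation, which
  yields a factor \<epsilon> and cancels the 1/\<epsilon>. In this way the weak gradient controls
  how averages of \<open>h\<close> change with the scale, in place of the usual integration along
  segments.\<close>

lemma mollify_scale_derivative:
  fixes \<psi> :: "'a::euclidean_space \<Rightarrow> real"
  assumes h: "h \<in> Lp_loc 1" and \<psi>: "test_function \<psi>"
    and \<psi>j: "\<And>j. j \<in> Basis \<Longrightarrow> test_function (\<lambda>w. (w \<bullet> j) * \<psi> w)"
    and g: "\<And>j. j \<in> Basis \<Longrightarrow> has_weak_deriv [j] h (g j)" and \<epsilon>: "\<epsilon> > 0"
  shows "((\<lambda>\<epsilon>. mollify h \<psi> \<epsilon> x) has_real_derivative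
    - (\<Sum>j\<in>Basis. mollify (g j) (\<lambda>w. (w \<bullet> j) * \<psi> w) \<epsilon> x)) (at \<epsilon>)"
proof -
  let ?N = "DIM('a)"
  define \<Phi> where "\<Phi> = (\<lambda>w. \<Sum>j\<in>Basis. iter_deriv [j] (\<lambda>w. (w \<bullet> j) * \<psi> w) w)"
  have \<psi>j': "test_function (iter_deriv [j] (\<lambda>w. (w \<bullet> j) * \<psi> w))" if "j \<in> Basis" for j
    by (rule test_function_iter_deriv[OF \<psi>j]) (use that in auto)
  obtain r where r: "r > 0" "\<And>w. norm w > r \<Longrightarrow> \<psi> w = 0" using test_function_support_ball[OF \<psi>] by metis
  have "\<Phi> w = 0" if "norm w > r" for w
  proof -
    have "iter_deriv [j] (\<lambda>w. (w \<bullet> j) * \<psi> w) w = 0" for j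
      by (rule iter_deriv_eq_0_outside[of "cball 0 r"]) (use r that in auto)
    then show ?thesis by (simp add: \<Phi>_def)
  qed
  moreover have c\<Phi>: "continuous_on UNIV \<Phi>"
    unfolding \<Phi>_def by (intro continuous_on_sum test_function_continuous \<psi>j')
  ultimately obtain M where M: "M > 0" "\<And>w. \<bar>\<Phi> w\<bar> \<le> M"
    using continuous_compact_support_bounded[of \<Phi>] by metis
  let ?K = "\<lambda>s y. (1 / s) ^ ?N * \<psi> ((1 / s) *\<^sub>R (x - y))"
  let ?K' = "\<lambda>s y. - (1 / s) * ((1 / s) ^ ?N * \<Phi> ((1 / s) *\<^sub>R (x - y)))"
  have "((\<lambda>s. LINT y|lebesgue. h y * ?K s y) has_real_derivative (LINT y|lebesgue. h y * ?K' \<epsilon> y)) (at \<epsilon>)"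
  \<comment> \<open>Within \<epsilon>/2 of \<epsilon> the scale stays away from 0 and below
    2\<epsilon>, which bounds the derivatives of the kernels and confines their supports to one
    ball.\<close>
  proof (rule DERIV_integral_kernel[OF h, where d = "\<epsilon> / 2" and M = "(2 / \<epsilon>) * ((2 / \<epsilon>) ^ ?N * M)"
        and R = "norm x + 2 * \<epsilon> * r"])
    fix s y assume s': "\<bar>s - \<epsilon>\<bar> < \<epsilon> / 2"
    then have s: "s > \<epsilon> / 2" "s < 2 * \<epsilon>" "s > 0" using \<epsilon> by linarith+
    have inv: "0 < 1 / s" "1 / s \<le> 2 / \<epsilon>" using s \<epsilon> by (auto simp: field_simps)
    show "((\<lambda>s. ?K s y) has_real_derivative ?K' s y) (at s)"
    proof -
      define z where "z = x - y"
      define p where "p = (1 / s) *\<^sub>R z"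
      have D: "(\<psi> has_derivative frechet_derivative \<psi> (at p)) (at p)"
        by (rule test_function_has_derivative[OF \<psi>])
      then have lin: "linear (frechet_derivative \<psi> (at p))" by (rule has_derivative_linear)
      have inv': "((\<lambda>s. 1 / s) has_real_derivative - (1 / s) * (1 / s)) (at s)"
        using DERIV_inverse[of s] s by (simp add: inverse_eq_divide power2_eq_square)
      from has_derivative_scaleR_left[OF this[unfolded has_field_derivative_def], of z]
      have "((\<lambda>s. (1 / s) *\<^sub>R z) has_derivative (\<lambda>t. (- (1 / s) * (1 / s) * t) *\<^sub>R z)) (at s)" .
      from has_derivative_compose[OF this D[unfolded p_def]]
      have "((\<lambda>s. \<psi> ((1 / s) *\<^sub>R z)) has_derivative
          (\<lambda>t. frechet_derivative \<psi> (at p) ((- (1 / s) * (1 / s) * t) *\<^sub>R z))) (at s)"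
        unfolding p_def .
      moreover have "frechet_derivative \<psi> (at p) ((- (1 / s) * (1 / s) * t) *\<^sub>R z)
          = (- (1 / s) * frechet_derivative \<psi> (at p) p) * t" for t
      proof -
        have "(- (1 / s) * (1 / s) * t) *\<^sub>R z = (- (1 / s) * t) *\<^sub>R p" by (simp add: p_def)
        then show ?thesis using linear_cmul[OF lin, of "- (1 / s) * t" p] by (simp only: real_scaleR_def mult_ac)
      qed
      ultimately have d1: "((\<lambda>s. \<psi> ((1 / s) *\<^sub>R z)) has_real_derivative
          - (1 / s) * frechet_derivative \<psi> (at p) p) (at s)"
        unfolding has_field_derivative_def by (simp only:)
      from DERIV_power[OF inv', of ?N]
      have d2: "((\<lambda>s. (1 / s) ^ ?N) has_real_derivative
          of_nat ?N * ((- (1 / s) * (1 / s)) * (1 / s) ^ (?N - Suc 0))) (at s)" .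
      have e: "(1 / s) * (1 / s) ^ (?N - Suc 0) = (1 / s) ^ ?N"
        using power_Suc[of "1 / s" "?N - Suc 0"] by simp
      have "of_nat ?N * ((- (1 / s) * (1 / s)) * (1 / s) ^ (?N - Suc 0))
          = - (1 / s) * (of_nat ?N * (1 / s) ^ ?N)"
        unfolding e[symmetric] by (simp only: mult_minus_left mult_minus_right mult.assoc mult.left_commute)
      from DERIV_mult[OF d2[unfolded this] d1]
      have "((\<lambda>s. (1 / s) ^ ?N * \<psi> ((1 / s) *\<^sub>R z)) has_real_derivative
          - (1 / s) * (of_nat ?N * (1 / s) ^ ?N) * \<psi> p
          + - (1 / s) * frechet_derivative \<psi> (at p) p * (1 / s) ^ ?N) (at s)"
        unfolding p_def .
      moreover have "- (1 / s) * (of_nat ?N * (1 / s) ^ ?N) * \<psi> p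
          + - (1 / s) * frechet_derivative \<psi> (at p) p * (1 / s) ^ ?N = - (1 / s) * ((1 / s) ^ ?N * \<Phi> p)"
        unfolding \<Phi>_def sum_partial_derivs_coordinate_mult[OF \<psi>] by algebra
      ultimately show ?thesis unfolding z_def p_def by simp
    qed
    have "\<bar>?K' s y\<bar> = (1 / s) * ((1 / s) ^ ?N * \<bar>\<Phi> ((1 / s) *\<^sub>R (x - y))\<bar>)"
      using s by (simp add: abs_mult)
    also have "\<dots> \<le> (2 / \<epsilon>) * ((2 / \<epsilon>) ^ ?N * M)"
      using inv M \<epsilon> by (intro mult_mono power_mono) auto
    finally show "\<bar>?K' s y\<bar> \<le> (2 / \<epsilon>) * ((2 / \<epsilon>) ^ ?N * M)" .
    show "continuous_on UNIV (?K s)"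
      by (intro continuous_intros continuous_on_compose2[OF test_function_continuous[OF \<psi>]]) auto
    assume y: "norm y > norm x + 2 * \<epsilon> * r"
    have "\<bar>s\<bar> * r \<le> 2 * \<epsilon> * r" using s r by (intro mult_right_mono) auto
    then have "norm y > norm x + \<bar>s\<bar> * r" using y by linarith
    then have "\<psi> ((1 / s) *\<^sub>R (x - y)) = 0" by (rule mollify_kernel_support) (use r s in auto)
    then show "?K s y = 0" by simp
  qed (use \<epsilon> in auto)
  moreover have "(LINT y|lebesgue. h y * ?K s y) = mollify h \<psi> s x" for s
    unfolding mollify_def by (subst integral_mult_right_zero[symmetric]) (simp only: mult.left_commute)
  moreover have "(LINT y|lebesgue. h y * ?K' \<epsilon> y)
      = - (\<Sum>j\<in>Basis. mollify (g j) (\<lambda>w. (w \<bullet> j) * \<psi> w) \<epsilon> x)"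
  proof -
    let ?\<Psi> = "\<lambda>j. iter_deriv [j] (\<lambda>w. (w \<bullet> j) * \<psi> w)"
    have "(LINT y|lebesgue. h y * ?K' \<epsilon> y) = - (1 / \<epsilon>) * mollify h \<Phi> \<epsilon> x"
    proof -
      have "(\<lambda>y. h y * ?K' \<epsilon> y) = (\<lambda>y. (- (1 / \<epsilon>) * (1 / \<epsilon>) ^ ?N) * (h y * \<Phi> ((1 / \<epsilon>) *\<^sub>R (x - y))))"
        by (simp only: mult_ac)
      then show ?thesis unfolding mollify_def by (simp only: integral_mult_right_zero mult.assoc)
    qed
    also have "mollify h \<Phi> \<epsilon> x = (\<Sum>j\<in>Basis. mollify h (?\<Psi> j) \<epsilon> x)"
    proof -
      have "(LINT y|lebesgue. h y * \<Phi> ((1 / \<epsilon>) *\<^sub>R (x - y)))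
          = (LINT y|lebesgue. (\<Sum>j\<in>Basis. h y * ?\<Psi> j ((1 / \<epsilon>) *\<^sub>R (x - y))))"
        unfolding \<Phi>_def by (simp only: sum_distrib_left)
      also have "\<dots> = (\<Sum>j\<in>Basis. LINT y|lebesgue. h y * ?\<Psi> j ((1 / \<epsilon>) *\<^sub>R (x - y)))"
        by (rule Bochner_Integration.integral_sum) (rule integrable_kernel[OF h \<psi>j' \<epsilon>])
      finally show ?thesis unfolding mollify_def by (simp only: sum_distrib_left)
    qed
    also have "\<dots> = (\<Sum>j\<in>Basis. \<epsilon> * mollify (g j) (\<lambda>w. (w \<bullet> j) * \<psi> w) \<epsilon> x)"
    proof (rule sum.cong[OF refl])
      fix j :: 'a assume j: "j \<in> Basis"
      have "(1 / \<epsilon>) ^ length [j] * mollify h (?\<Psi> j) \<epsilon> x = mollify (g j) (\<lambda>w. (w \<bullet> j) * \<psi> w) \<epsilon> x"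
        by (rule mollify_weak_deriv[OF g[OF j] \<psi>j[OF j] _ \<epsilon>]) (use j in auto)
      then show "mollify h (?\<Psi> j) \<epsilon> x = \<epsilon> * mollify (g j) (\<lambda>w. (w \<bullet> j) * \<psi> w) \<epsilon> x"
        using \<epsilon> by (auto simp: field_simps)
    qed
    finally show ?thesis using \<epsilon> by (simp add: sum_distrib_left[symmetric])
  qed
  ultimately show ?thesis by simp
qed

text \<open>Young's inequality in a form that takes the place of Hoelder's in Morrey's argument: averaged over
  a cube of side \<open>\<epsilon>\<close>, the right-hand side is integrable in \<open>\<epsilon>\<close> near 0.\<close>

lemma abs_le_inverse_sqrt_plus_powr:
  fixes a \<epsilon> :: real
  assumes "\<epsilon> > 0"
  shows "\<bar>a\<bar> \<le> 1 / sqrt \<epsilon> + \<epsilon> ^ N * \<bar>a\<bar> powr real (2 * N + 1)"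
proof (cases "\<bar>a\<bar> \<le> 1 / sqrt \<epsilon>")
  case True
  moreover have "0 \<le> \<epsilon> ^ N * \<bar>a\<bar> powr real (2 * N + 1)" using assms by simp
  ultimately show ?thesis by linarith
next
  case False
  then have a: "1 / sqrt \<epsilon> < \<bar>a\<bar>" by simp
  have pos: "0 < 1 / sqrt \<epsilon>" using assms by simp
  have "(1 / sqrt \<epsilon>)\<^sup>2 \<le> \<bar>a\<bar>\<^sup>2" using a pos by (intro power_mono) auto
  then have "1 / \<epsilon> \<le> \<bar>a\<bar>\<^sup>2" using assms by (simp add: power_divide)
  then have "1 \<le> \<epsilon> * \<bar>a\<bar>\<^sup>2" using assms by (simp add: divide_le_eq mult.commute)
  then have "1 \<le> (\<epsilon> * \<bar>a\<bar>\<^sup>2) ^ N" by (rule one_le_power)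
  then have "\<bar>a\<bar> * 1 \<le> \<bar>a\<bar> * (\<epsilon> * \<bar>a\<bar>\<^sup>2) ^ N" by (intro mult_left_mono) auto
  also have "b * (\<epsilon> * b\<^sup>2) ^ N = \<epsilon> ^ N * b ^ (2 * N + 1)" for b
    by (simp add: power_mult_distrib power_mult[symmetric] mult_ac)
  also have "\<bar>a\<bar> ^ (2 * N + 1) = \<bar>a\<bar> powr real (2 * N + 1)"
    using a pos by (intro powr_realpow[symmetric]) linarith
  finally show ?thesis using pos by linarith
qed

lemma corner_cube_subset_cball:
  fixes x :: "'a::euclidean_space"
  assumes "norm x \<le> R" "0 < \<epsilon>" "\<epsilon> \<le> 1"
  shows "cbox x (x + \<epsilon> *\<^sub>R One) \<subseteq> cball 0 (R + norm (One::'a))"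
proof
  fix y assume y: "y \<in> cbox x (x + \<epsilon> *\<^sub>R One)"
  have "\<bar>(y - x) \<bullet> i\<bar> \<le> \<bar>One \<bullet> i\<bar>" if "i \<in> Basis" for i
    using y that assms(2,3) by (fastforce simp: mem_box inner_diff_left inner_add_left)
  then have "norm (y - x) \<le> norm (One::'a)" by (rule norm_le_componentwise)
  moreover have "norm y \<le> norm x + norm (y - x)" by norm
  ultimately show "y \<in> cball 0 (R + norm (One::'a))" using assms(1) by simp
qed

text \<open>The factor \<epsilon>^N in Young's inequality cancels the \<epsilon>^(-N) of the
  average; this is what fixes the exponent 2N + 1. The cube is enlarged to a fixed ball so that the
  remaining integral depends on neither \<open>x\<close> nor \<open>\<epsilon>\<close>.\<close>

lemma mollify_bound_powr:
  fixes \<psi> :: "'a::euclidean_space \<Rightarrow> real"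
  assumes g: "g \<in> Lp_loc 1" "g \<in> Lp_loc (real (2 * DIM('a) + 1))"
    and \<psi>: "anchored \<psi>" "test_function \<psi>" "\<And>w. \<bar>\<psi> w\<bar> \<le> M"
    and \<epsilon>: "0 < \<epsilon>" "\<epsilon> \<le> 1" and x: "norm x \<le> R"
  shows "\<bar>mollify g \<psi> \<epsilon> x\<bar> \<le> M * (1 / sqrt \<epsilon> +
    (LINT y|lebesgue. indicator (cball 0 (R + norm (One::'a))) y * \<bar>g y\<bar> powr real (2 * DIM('a) + 1)))"
proof -
  let ?N = "DIM('a)" and ?C = "cbox x (x + \<epsilon> *\<^sub>R One)" and ?B = "cball 0 (R + norm (One::'a))"
  let ?p = "real (2 * DIM('a) + 1)"
  have M: "0 \<le> M" using \<psi>(3)[of 0] by linarith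
  have i1: "integrable lebesgue (\<lambda>y. (1 / sqrt \<epsilon>) * indicator ?C y)"
    using Lp_loc_1_integrable(1)[OF continuous_Lp_loc[of "\<lambda>_. 1 / sqrt \<epsilon>" 1], of ?C]
    by (simp add: mult.commute)
  have i2: "integrable lebesgue (\<lambda>y. indicator ?B y * \<bar>g y\<bar> powr ?p)"
    using g(2) unfolding Lp_loc_def set_integrable_def by simp
  have "(LINT y|lebesgue. indicator ?C y * \<bar>g y\<bar>)
      \<le> (LINT y|lebesgue. (1 / sqrt \<epsilon>) * indicator ?C y + \<epsilon> ^ ?N * (indicator ?B y * \<bar>g y\<bar> powr ?p))"
  proof (rule integral_mono)
    show "integrable lebesgue (\<lambda>y. indicator ?C y * \<bar>g y\<bar>)"
      by (rule Lp_loc_1_integrable(2)[OF g(1)]) simp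
    show "integrable lebesgue (\<lambda>y. (1 / sqrt \<epsilon>) * indicator ?C y + \<epsilon> ^ ?N * (indicator ?B y * \<bar>g y\<bar> powr ?p))"
      by (rule Bochner_Integration.integrable_add[OF i1 integrable_mult_right]) (rule i2)
    fix y
    show "indicator ?C y * \<bar>g y\<bar> \<le> (1 / sqrt \<epsilon>) * indicator ?C y + \<epsilon> ^ ?N * (indicator ?B y * \<bar>g y\<bar> powr ?p)"
    proof (cases "y \<in> ?C")
      case True
      then have "y \<in> ?B" using corner_cube_subset_cball[OF x \<epsilon>] by blast
      with True show ?thesis using abs_le_inverse_sqrt_plus_powr[OF \<epsilon>(1), of "g y" ?N] by simp
    next
      case False
      then show ?thesis using \<epsilon> by simp
    qed
  qed
  also have "\<dots> = (1 / sqrt \<epsilon>) * \<epsilon> ^ ?N + \<epsilon> ^ ?N * (LINT y|lebesgue. indicator ?B y * \<bar>g y\<bar> powr ?p)"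
    using i1 i2 integral_indicator_corner_cube[OF \<epsilon>(1), of x]
    by (subst Bochner_Integration.integral_add) auto
  finally have "(1 / \<epsilon>) ^ ?N * (LINT y|lebesgue. indicator ?C y * \<bar>g y\<bar>) \<le> (1 / \<epsilon>) ^ ?N *
      ((1 / sqrt \<epsilon>) * \<epsilon> ^ ?N + \<epsilon> ^ ?N * (LINT y|lebesgue. indicator ?B y * \<bar>g y\<bar> powr ?p))"
    using \<epsilon> by (intro mult_left_mono) auto
  also have "\<dots> = ((1 / \<epsilon>) ^ ?N * \<epsilon> ^ ?N) * (1 / sqrt \<epsilon> + (LINT y|lebesgue. indicator ?B y * \<bar>g y\<bar> powr ?p))"
    by algebra
  also have "(1 / \<epsilon>) ^ ?N * \<epsilon> ^ ?N = 1" using \<epsilon> by (simp add: power_one_over)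
  finally have "(1 / \<epsilon>) ^ ?N * (LINT y|lebesgue. indicator ?C y * \<bar>g y\<bar>)
      \<le> 1 / sqrt \<epsilon> + (LINT y|lebesgue. indicator ?B y * \<bar>g y\<bar> powr ?p)" by simp
  from mult_left_mono[OF this M] show ?thesis
    using mollify_bound[OF g(1) \<psi> \<epsilon>(1), of x] by linarith
qed

text \<open>The scale derivative is of order \<epsilon>^(-1/2), and its integral up to \<epsilon> is
  of order \<epsilon>^(1/2). The kernel is assumed \<open>bumpy\<close> because this class is closed
  under the products with coordinates that enter the scale derivative.\<close>

lemma mollify_oscillation:
  fixes \<psi> :: "'a::euclidean_space \<Rightarrow> real"
  assumes h: "h \<in> Lp_loc 1" and \<psi>: "bumpy \<psi>" "anchored \<psi>"
    and g: "\<And>j. j \<in> Basis \<Longrightarrow> has_weak_deriv [j] h (g j)"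
      "\<And>j. j \<in> Basis \<Longrightarrow> g j \<in> Lp_loc (real (2 * DIM('a) + 1))"
  obtains C where "C \<ge> 0" "\<And>x \<epsilon> \<epsilon>'. norm x \<le> R \<Longrightarrow> 0 < \<epsilon>' \<Longrightarrow> \<epsilon>' \<le> \<epsilon> \<Longrightarrow> \<epsilon> \<le> 1 \<Longrightarrow>
    \<bar>mollify h \<psi> \<epsilon> x - mollify h \<psi> \<epsilon>' x\<bar> \<le> C * sqrt \<epsilon>"
proof -
  let ?\<psi> = "\<lambda>j w. (w \<bullet> j) * \<psi> w"
  define J where "J j = (LINT y|lebesgue. indicator (cball 0 (R + norm (One::'a))) y * \<bar>g j y\<bar> powr real (2 * DIM('a) + 1))" for j
  have J: "J j \<ge> 0" for j unfolding J_def by (intro Bochner_Integration.integral_nonneg) auto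
  have t: "test_function \<psi>" using test_function_bumpy \<psi> by blast
  have aj: "anchored (?\<psi> j)" for j using \<psi>(2) by (simp add: anchored_def)
  have tj: "test_function (?\<psi> j)" for j
    by (rule test_function_bumpy[OF _ aj]) (intro bumpy.intros \<psi>)
  have "\<exists>M>0. \<forall>w. \<bar>?\<psi> j w\<bar> \<le> M" for j
    using test_function_support_ball[OF tj[of j]]
      continuous_compact_support_bounded[OF test_function_continuous[OF tj[of j]]] by metis
  then obtain M where M: "\<And>j. M j > 0" "\<And>j w. \<bar>?\<psi> j w\<bar> \<le> M j" by metis
  define C where "C = (\<Sum>j\<in>Basis. M j * (1 + J j))"
  have C: "C \<ge> 0" unfolding C_def using M(1) J by (intro sum_nonneg mult_nonneg_nonneg) (auto intro: less_imp_le add_nonneg_nonneg)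
  let ?F' = "\<lambda>x \<epsilon>. - (\<Sum>j\<in>Basis. mollify (g j) (?\<psi> j) \<epsilon> x)"
  have bound: "\<bar>?F' x \<epsilon>\<bar> \<le> C / sqrt \<epsilon>" if "norm x \<le> R" "0 < \<epsilon>" "\<epsilon> \<le> 1" for x \<epsilon>
  proof -
    have "\<bar>?F' x \<epsilon>\<bar> \<le> (\<Sum>j\<in>Basis. \<bar>mollify (g j) (?\<psi> j) \<epsilon> x\<bar>)" by simp
    also have "\<dots> \<le> (\<Sum>j\<in>Basis. M j * (1 + J j) / sqrt \<epsilon>)"
    proof (rule sum_mono)
      fix j :: 'a assume j: "j \<in> Basis"
      have "g j \<in> Lp_loc 1" using g(1)[OF j] by (simp add: has_weak_deriv_def)
      from mollify_bound_powr[OF this g(2)[OF j] aj tj M(2) that(2,3,1)]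
      have "\<bar>mollify (g j) (?\<psi> j) \<epsilon> x\<bar> \<le> M j * (1 / sqrt \<epsilon> + J j)" unfolding J_def .
      also have "\<dots> \<le> M j * (1 / sqrt \<epsilon> + J j * (1 / sqrt \<epsilon>))"
      proof -
        have "1 \<le> 1 / sqrt \<epsilon>" using that by simp
        then have "J j * 1 \<le> J j * (1 / sqrt \<epsilon>)" using J by (intro mult_left_mono)
        then show ?thesis using M(1)[of j] by (intro mult_left_mono) auto
      qed
      also have "\<dots> = M j * (1 + J j) / sqrt \<epsilon>" by (simp add: algebra_simps add_divide_distrib)
      finally show "\<bar>mollify (g j) (?\<psi> j) \<epsilon> x\<bar> \<le> M j * (1 + J j) / sqrt \<epsilon>" .
    qed
    finally show ?thesis unfolding C_def by (simp add: sum_divide_distrib)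
  qed
  have "\<bar>mollify h \<psi> \<epsilon> x - mollify h \<psi> \<epsilon>' x\<bar> \<le> (2 * C) * sqrt \<epsilon>"
    if x: "norm x \<le> R" and \<epsilon>: "0 < \<epsilon>'" "\<epsilon>' \<le> \<epsilon>" "\<epsilon> \<le> 1" for x \<epsilon> \<epsilon>'
  proof -
    have dF: "((\<lambda>\<epsilon>. mollify h \<psi> \<epsilon> x) has_real_derivative ?F' x s) (at s)" if "\<epsilon>' \<le> s" for s
      using mollify_scale_derivative[OF h t tj g(1), of s x] that \<epsilon> by simp
    have dG: "((\<lambda>\<epsilon>. 2 * C * sqrt \<epsilon>) has_real_derivative C / sqrt s) (at s)" if "\<epsilon>' \<le> s" for s
    proof -
      have "s > 0" using that \<epsilon> by simp
      moreover have "2 * C * (inverse (sqrt s) / 2) = C / sqrt s" by (simp add: inverse_eq_divide)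
      ultimately show ?thesis using DERIV_cmult[OF DERIV_real_sqrt, of s "2 * C"] by (simp only:)
    qed
    have F': "\<bar>?F' x s\<bar> \<le> C / sqrt s" if "\<epsilon>' \<le> s" "s \<le> \<epsilon>" for s
      using bound[OF x, of s] that \<epsilon> by simp
    \<comment> \<open>The bound on the derivative is integrated by monotonicity:
      \<open>2 * C * sqrt \<epsilon>\<close> minus, and then plus, the mollification is
      nondecreasing in the scale.\<close>
    have "2 * C * sqrt \<epsilon>' - mollify h \<psi> \<epsilon>' x \<le> 2 * C * sqrt \<epsilon> - mollify h \<psi> \<epsilon> x"
    proof (rule DERIV_nonneg_imp_nondecreasing[OF \<epsilon>(2)])
      fix s assume s: "\<epsilon>' \<le> s" "s \<le> \<epsilon>"
      show "\<exists>y. ((\<lambda>\<epsilon>. 2 * C * sqrt \<epsilon> - mollify h \<psi> \<epsilon> x) has_real_derivative y) (at s) \<and> 0 \<le> y"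
        using DERIV_diff[OF dG[OF s(1)] dF[OF s(1)]] F'[OF s] by (intro exI conjI) (assumption, linarith)
    qed
    moreover have "2 * C * sqrt \<epsilon>' + mollify h \<psi> \<epsilon>' x \<le> 2 * C * sqrt \<epsilon> + mollify h \<psi> \<epsilon> x"
    proof (rule DERIV_nonneg_imp_nondecreasing[OF \<epsilon>(2)])
      fix s assume s: "\<epsilon>' \<le> s" "s \<le> \<epsilon>"
      show "\<exists>y. ((\<lambda>\<epsilon>. 2 * C * sqrt \<epsilon> + mollify h \<psi> \<epsilon> x) has_real_derivative y) (at s) \<and> 0 \<le> y"
        using DERIV_add[OF dG[OF s(1)] dF[OF s(1)]] F'[OF s] by (intro exI conjI) (assumption, linarith)
    qed
    moreover have "0 \<le> 2 * C * sqrt \<epsilon>'" using C \<epsilon> by simp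
    ultimately show ?thesis by linarith
  qed
  with C that[of "2 * C"] show ?thesis by simp
qed

text \<open>The oscillation estimate makes the mollifications uniformly Cauchy on each ball, so
  their limit is continuous; at almost every point that limit is \<open>h\<close>.\<close>

theorem Morrey_continuous_representative:
  fixes h :: "'a::euclidean_space \<Rightarrow> real"
  assumes h: "h \<in> Lp_loc 1"
    and g: "\<And>j. j \<in> Basis \<Longrightarrow> \<exists>g\<in>Lp_loc (real (2 * DIM('a) + 1)). has_weak_deriv [j] h g"
  shows "\<exists>q. continuous_on UNIV q \<and> (AE x in lebesgue. h x = q x)"
proof -
  obtain g where g: "\<And>j. j \<in> Basis \<Longrightarrow> has_weak_deriv [j] h (g j)"
      "\<And>j. j \<in> Basis \<Longrightarrow> g j \<in> Lp_loc (real (2 * DIM('a) + 1))"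
    using g by metis
  obtain \<rho> :: "'a \<Rightarrow> real" where \<rho>: "bumpy \<rho>" "anchored \<rho>" "(LINT w|lebesgue. \<rho> w) = 1"
    using mollifier_exists by metis
  have t: "test_function \<rho>" by (rule test_function_bumpy[OF \<rho>(1,2)])
  let ?F = "\<lambda>n. mollify h \<rho> (1 / real (Suc n))"
  define q where "q = (\<lambda>x. lim (\<lambda>n. ?F n x))"
  have ul: "uniform_limit (cball 0 R) ?F q sequentially" for R
  proof -
    obtain C where C: "C \<ge> 0" "\<And>x \<epsilon> \<epsilon>'. norm x \<le> R \<Longrightarrow> 0 < \<epsilon>' \<Longrightarrow> \<epsilon>' \<le> \<epsilon> \<Longrightarrow> \<epsilon> \<le> 1 \<Longrightarrow>
        \<bar>mollify h \<rho> \<epsilon> x - mollify h \<rho> \<epsilon>' x\<bar> \<le> C * sqrt \<epsilon>"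
      using mollify_oscillation[OF h \<rho>(1,2) g, where R = R] by metis
    have "uniformly_Cauchy_on (cball 0 R) ?F"
    proof (rule uniformly_Cauchy_onI')
      fix e :: real assume e: "e > 0"
      have "(\<lambda>n. C * sqrt (1 / real (Suc n))) \<longlonglongrightarrow> C * sqrt 0"
        by (intro tendsto_intros LIMSEQ_inverse_real_of_nat[unfolded inverse_eq_divide])
      then have "\<forall>\<^sub>F n in sequentially. C * sqrt (1 / real (Suc n)) < e"
        using e by (intro order_tendstoD) auto
      then obtain N where N: "\<And>n. n \<ge> N \<Longrightarrow> C * sqrt (1 / real (Suc n)) < e"
        unfolding eventually_sequentially by blast
      have "dist (?F m x) (?F n x) < e" if "x \<in> cball 0 R" "m \<ge> N" "m < n" for x m n
      proof -
        have "\<bar>?F m x - ?F n x\<bar> \<le> C * sqrt (1 / real (Suc m))"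
          by (rule C(2)) (use that in \<open>auto simp: frac_le\<close>)
        then show ?thesis using N[OF that(2)] by (simp add: dist_real_def)
      qed
      then show "\<exists>M. \<forall>x\<in>cball 0 R. \<forall>m\<ge>M. \<forall>n>m. dist (?F m x) (?F n x) < e" by blast
    qed
    then show ?thesis
      unfolding q_def uniformly_convergent_uniform_limit_iff[symmetric] by (rule Cauchy_uniformly_convergent)
  qed
  have "continuous_on (cball 0 R) q" for R
    by (rule uniform_limit_theorem[OF _ ul])
       (auto intro!: always_eventually continuous_on_subset[OF continuous_on_mollify[OF h t]])
  then have "isCont q x" for x
    by (rule continuous_on_interior[of "cball 0 (norm x + 1)"]) simp
  then have "continuous_on UNIV q" by (simp add: continuous_at_imp_continuous_on)
  moreover have "AE x in lebesgue. h x = q x"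
    using AE_mollify_tendsto[OF h \<rho>(2) t \<rho>(3)]
    by (rule eventually_mono) (simp add: q_def limI)
  ultimately show ?thesis by blast
qed

subsection \<open>Regularity and approximation of solutions\<close>

lemma integral_mult_test_function_cong_AE:
  fixes g g' :: "'a::euclidean_space \<Rightarrow> real"
  assumes g: "g \<in> borel_measurable lebesgue" "g' \<in> borel_measurable lebesgue" "AE x in lebesgue. g x = g' x"
    and k: "continuous_on UNIV k"
  shows "(LINT x|lebesgue. g x * k x) = (LINT x|lebesgue. g' x * k x)"
proof (rule integral_cong_AE)
  show "AE x in lebesgue. g x * k x = g' x * k x" using g(3) by (rule eventually_mono) simp
qed (use g continuous_measurable_lebesgue[OF k] in \<open>auto intro!: borel_measurable_times\<close>)

lemma mollify_cong_AE:
  fixes g g' :: "'a::euclidean_space \<Rightarrow> real"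
  assumes "g \<in> borel_measurable lebesgue" "g' \<in> borel_measurable lebesgue" "AE x in lebesgue. g x = g' x"
    and \<psi>: "test_function \<psi>"
  shows "mollify g \<psi> \<epsilon> x = mollify g' \<psi> \<epsilon> x"
proof -
  have "continuous_on UNIV (\<lambda>y. \<psi> ((1 / \<epsilon>) *\<^sub>R (x - y)))"
    by (rule continuous_on_compose2[OF test_function_continuous[OF \<psi>]]) (auto intro!: continuous_intros)
  from integral_mult_test_function_cong_AE[OF assms(1-3) this] show ?thesis
    by (simp add: mollify_def)
qed

lemma mollify_sum:
  fixes D :: "'i \<Rightarrow> 'a::euclidean_space \<Rightarrow> real"
  assumes D: "\<And>i. i \<in> A \<Longrightarrow> D i \<in> Lp_loc 1" and \<psi>: "test_function \<psi>" "\<epsilon> > 0"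
  shows "mollify (\<lambda>y. \<Sum>i\<in>A. D i y) \<psi> \<epsilon> x = (\<Sum>i\<in>A. mollify (D i) \<psi> \<epsilon> x)"
proof -
  have "(LINT y|lebesgue. (\<Sum>i\<in>A. D i y) * \<psi> ((1 / \<epsilon>) *\<^sub>R (x - y)))
      = (\<Sum>i\<in>A. LINT y|lebesgue. D i y * \<psi> ((1 / \<epsilon>) *\<^sub>R (x - y)))"
    unfolding sum_distrib_right
    by (rule Bochner_Integration.integral_sum) (rule integrable_kernel[OF D \<psi>])
  then show ?thesis by (simp only: mollify_def sum_distrib_left)
qed

lemma has_weak_deriv_cong_AE:
  fixes u g g' :: "'a::euclidean_space \<Rightarrow> real"
  assumes w: "has_weak_deriv is u g" and g': "g' \<in> Lp_loc 1" and ae: "AE x in lebesgue. g x = g' x"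
  shows "has_weak_deriv is u g'"
  unfolding has_weak_deriv_def
proof (intro conjI allI impI)
  have g: "g \<in> Lp_loc 1" and u: "u \<in> Lp_loc 1" using w by (auto simp: has_weak_deriv_def)
  show "u \<in> Lp_loc 1" by fact
  show "g' \<in> Lp_loc 1" by fact
  fix \<phi> :: "'a \<Rightarrow> real" assume t: "test_function \<phi>"
  have "(LINT x|lebesgue. g x * \<phi> x) = (LINT x|lebesgue. g' x * \<phi> x)"
    using g g' ae test_function_continuous[OF t]
    by (intro integral_mult_test_function_cong_AE Lp_loc_1_measurable)
  then show "(LINT x|lebesgue. u x * iter_deriv is \<phi> x) = (- 1) ^ length is * (LINT x|lebesgue. g' x * \<phi> x)"
    using w t by (simp add: has_weak_deriv_def)
qed

text \<open>The list \<open>[i, j]\<close> differentiates by \<open>j\<close> first, so the identity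
  for \<open>[i]\<close> is tested with the \<open>j\<close>-derivative of \<phi>. Second weak
  derivatives of \<open>u\<close> thereby become weak derivatives of its gradient, to which Morrey's
  theorem applies.\<close>

lemma has_weak_deriv_partial:
  assumes "has_weak_deriv [i] u g" "has_weak_deriv [i, j] u h" "j \<in> Basis"
  shows "has_weak_deriv [j] g h"
  unfolding has_weak_deriv_def
proof (intro conjI allI impI)
  show "g \<in> Lp_loc 1" "h \<in> Lp_loc 1" using assms by (auto simp: has_weak_deriv_def)
  fix \<phi> :: "'a \<Rightarrow> real" assume t: "test_function \<phi>"
  have "test_function (iter_deriv [j] \<phi>)" by (rule test_function_iter_deriv[OF t]) (use assms in auto)
  with assms(1) have "(LINT x|lebesgue. u x * iter_deriv [i] (iter_deriv [j] \<phi>) x)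
      = (- 1) ^ length [i] * (LINT x|lebesgue. g x * iter_deriv [j] \<phi> x)"
    unfolding has_weak_deriv_def by blast
  moreover have "(LINT x|lebesgue. u x * iter_deriv [i, j] \<phi> x)
      = (- 1) ^ length [i, j] * (LINT x|lebesgue. h x * \<phi> x)"
    using assms(2) t unfolding has_weak_deriv_def by blast
  ultimately show "(LINT x|lebesgue. g x * iter_deriv [j] \<phi> x) = (- 1) ^ length [j] * (LINT x|lebesgue. h x * \<phi> x)"
    by simp
qed

lemma uniform_limit_sum:
  fixes F :: "'i \<Rightarrow> nat \<Rightarrow> 'b \<Rightarrow> real"
  assumes "\<And>i. i \<in> A \<Longrightarrow> uniform_limit X (F i) (l i) sequentially"
  shows "uniform_limit X (\<lambda>n x. \<Sum>i\<in>A. F i n x) (\<lambda>x. \<Sum>i\<in>A. l i x) sequentially"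
  using assms
  by (induction A rule: infinite_finite_induct) (auto intro: uniform_limit_intros)

text \<open>The functions \<open>w n\<close>, with partial derivatives \<open>p n i\<close> and pure second ones \<open>s n i\<close>, approximate \<open>v\<close>
  and have vanishing residual in \<open>- c \<Delta>v + k |\<nabla>v|\<^sup>2 + \<delta> v = f\<close>. The sign of \<open>k\<close> is free so that lower bounds
  follow by passing to \<open>- v\<close>.\<close>

definition C2_approximation ::
    "real \<Rightarrow> real \<Rightarrow> real \<Rightarrow> ('a::euclidean_space \<Rightarrow> real) \<Rightarrow> ('a \<Rightarrow> real)
      \<Rightarrow> (nat \<Rightarrow> 'a \<Rightarrow> real) \<Rightarrow> (nat \<Rightarrow> 'a \<Rightarrow> 'a \<Rightarrow> real) \<Rightarrow> (nat \<Rightarrow> 'a \<Rightarrow> 'a \<Rightarrow> real) \<Rightarrow> bool" where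
  "C2_approximation c k \<delta> f v w p s \<longleftrightarrow>
     (\<forall>n. continuous_on UNIV (w n)) \<and>
     (\<forall>n x t. \<forall>i\<in>Basis. ((\<lambda>t. w n (x + t *\<^sub>R i)) has_real_derivative p n i (x + t *\<^sub>R i)) (at t)) \<and>
     (\<forall>n x t. \<forall>i\<in>Basis. ((\<lambda>t. p n i (x + t *\<^sub>R i)) has_real_derivative s n i (x + t *\<^sub>R i)) (at t)) \<and>
     (\<forall>R. uniform_limit (cball 0 R) w v sequentially) \<and>
     (\<forall>R. uniform_limit (cball 0 R)
        (\<lambda>n x. - (c * (\<Sum>i\<in>Basis. s n i x)) + k * (\<Sum>i\<in>Basis. (p n i x)\<^sup>2) + \<delta> * w n x) f sequentially)"

text \<open>Gradient and Laplacian are those supplied by the equation, the integrability of the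
  second derivatives comes from \<open>Sobolev_loc\<close>; \<open>has_weak_deriv_partial\<close>
  joins the two without uniqueness of weak derivatives. Mollification does not commute with squaring
  the gradient, so the approximations do not solve a mollified equation. But every term of the
  equation converges uniformly on balls, and so does the whole.\<close>

theorem solution_has_C2_approximation:
  fixes u :: "'a::euclidean_space \<Rightarrow> real"
  assumes S: "u \<in> Sobolev_loc 2 (real (2 * DIM('a) + 1))" and eq: "solves_HJ_ae \<sigma> \<delta> f u"
    and f: "continuous_on UNIV f" and \<sigma>: "\<sigma> > 0"
  obtains v w p s where "continuous_on UNIV v" "AE x in lebesgue. u x = v x"
    "C2_approximation (\<sigma>\<^sup>2 / 2) (1 / 2) \<delta> f v w p s"
proof -
  let ?m = "real (2 * DIM('a) + 1)"
  obtain G L where G: "has_weak_gradient u G" and L: "has_weak_Laplacian u L"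
    and ae: "AE x in lebesgue. - (\<sigma>\<^sup>2 / 2) * L x + 1 / 2 * (norm (G x))\<^sup>2 + \<delta> * u x = f x"
    using eq unfolding solves_HJ_ae_def by blast
  obtain D where D: "\<And>i. i \<in> Basis \<Longrightarrow> has_weak_deriv [i, i] u (D i)" and LD: "L = (\<lambda>x. \<Sum>i\<in>Basis. D i x)"
    using L unfolding has_weak_Laplacian_def by blast
  have Gi: "has_weak_deriv [i] u (\<lambda>x. G x \<bullet> i)" if "i \<in> Basis" for i
    using G that unfolding has_weak_gradient_def by blast
  have u1: "u \<in> Lp_loc 1" using Gi[OF SOME_Basis] by (simp add: has_weak_deriv_def)
  have D1: "D i \<in> Lp_loc 1" if "i \<in> Basis" for i using D[OF that] by (simp add: has_weak_deriv_def)
  have "\<exists>q. continuous_on UNIV q \<and> (AE x in lebesgue. G x \<bullet> i = q x)" if i: "i \<in> Basis" for i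
  proof (rule Morrey_continuous_representative)
    show "(\<lambda>x. G x \<bullet> i) \<in> Lp_loc 1" using Gi[OF i] by (simp add: has_weak_deriv_def)
    fix j :: 'a assume j: "j \<in> Basis"
    have "[i, j] \<in> lists Basis" "length [i, j] \<le> 2" using i j by auto
    then obtain g where g: "g \<in> Lp_loc ?m" "has_weak_deriv [i, j] u g"
      using S unfolding Sobolev_loc_def by blast
    then show "\<exists>g\<in>Lp_loc ?m. has_weak_deriv [j] (\<lambda>x. G x \<bullet> i) g"
      using has_weak_deriv_partial[OF Gi[OF i] g(2) j] by blast
  qed
  then obtain q where q: "\<And>i. i \<in> Basis \<Longrightarrow> continuous_on UNIV (q i)"
      "\<And>i. i \<in> Basis \<Longrightarrow> AE x in lebesgue. G x \<bullet> i = q i x" by metis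
  have wq: "has_weak_deriv [i] u (q i)" if "i \<in> Basis" for i
    by (rule has_weak_deriv_cong_AE[OF Gi[OF that] continuous_Lp_loc[OF q(1)[OF that]] q(2)[OF that]]) simp
  have "\<exists>v. continuous_on UNIV v \<and> (AE x in lebesgue. u x = v x)"
    by (rule Morrey_continuous_representative[OF u1]) (use wq q(1) continuous_Lp_loc in force)
  then obtain v where v: "continuous_on UNIV v" "AE x in lebesgue. u x = v x" by blast
  \<comment> \<open>The equation solved for the Laplacian, with continuous functions on the
    right.\<close>
  define l where "l = (\<lambda>x. (2 / \<sigma>\<^sup>2) * (1 / 2 * (\<Sum>i\<in>Basis. (q i x)\<^sup>2) + \<delta> * v x - f x))"
  have cl: "continuous_on UNIV l" unfolding l_def by (intro continuous_intros q v f)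
  have l: "AE x in lebesgue. L x = l x"
  proof -
    have "AE x in lebesgue. \<forall>i\<in>Basis. G x \<bullet> i = q i x"
      using q(2) by (intro AE_finite_allI) auto
    with ae v(2) show ?thesis
    proof eventually_elim
      case (elim x)
      have "(norm (G x))\<^sup>2 = (\<Sum>i\<in>Basis. (q i x)\<^sup>2)"
        using elim(3) unfolding power2_norm_eq_inner euclidean_inner[of "G x" "G x"]
        by (simp add: power2_eq_square)
      then have "\<sigma>\<^sup>2 / 2 * L x = 1 / 2 * (\<Sum>i\<in>Basis. (q i x)\<^sup>2) + \<delta> * v x - f x"
        using elim(1,2) by simp
      then have "(2 / \<sigma>\<^sup>2) * (\<sigma>\<^sup>2 / 2 * L x) = l x" by (simp only: l_def)
      then show ?case using \<sigma> by simp
    qed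
  qed
  obtain \<rho> :: "'a \<Rightarrow> real" where \<rho>: "bumpy \<rho>" "anchored \<rho>" "(LINT w|lebesgue. \<rho> w) = 1"
    using mollifier_exists by metis
  have t: "test_function \<rho>" by (rule test_function_bumpy[OF \<rho>(1,2)])
  \<comment> \<open>Here \<open>p\<close> mollifies the continuous \<open>q i\<close> and so
    converges uniformly for each \<open>i\<close>; \<open>s\<close> mollifies the single second
    derivatives \<open>D i\<close>, whose convergence is controlled only after summation.\<close>
  define w where "w n = mollify u \<rho> (1 / real (Suc n))" for n
  define p where "p n i = mollify (q i) \<rho> (1 / real (Suc n))" for n i
  define s where "s n i = mollify (D i) \<rho> (1 / real (Suc n))" for n i
  have "uniform_limit (cball 0 R) w v sequentially" for R
  proof -
    have "w n x = mollify v \<rho> (1 / real (Suc n)) x" for n x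
      unfolding w_def
      by (rule mollify_cong_AE[OF Lp_loc_1_measurable[OF u1] continuous_measurable_lebesgue[OF v(1)] v(2) t])
    then have "w = (\<lambda>n. mollify v \<rho> (1 / real (Suc n)))" by (intro ext)
    then show ?thesis using mollify_uniform_limit[OF v(1) \<rho>(2) t \<rho>(3), of R] by (simp only:)
  qed
  note lim_w = this
  have lim_p: "uniform_limit (cball 0 R) (\<lambda>n x. p n i x) (q i) sequentially" if "i \<in> Basis" for R i
    using mollify_uniform_limit[OF q(1)[OF that] \<rho>(2) t \<rho>(3), of R] unfolding p_def .
  have lim_s: "uniform_limit (cball 0 R) (\<lambda>n x. \<Sum>i\<in>Basis. s n i x) l sequentially" for R
  proof -
    have "(\<Sum>i\<in>Basis. s n i x) = mollify l \<rho> (1 / real (Suc n)) x" for n x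
    proof -
      have "(\<Sum>i\<in>Basis. s n i x) = mollify L \<rho> (1 / real (Suc n)) x"
        unfolding s_def LD by (rule mollify_sum[symmetric]) (use D1 t in auto)
      also have "\<dots> = mollify l \<rho> (1 / real (Suc n)) x"
        by (rule mollify_cong_AE[OF _ continuous_measurable_lebesgue[OF cl] l t])
           (unfold LD, intro borel_measurable_sum Lp_loc_1_measurable D1)
      finally show ?thesis .
    qed
    then show ?thesis using mollify_uniform_limit[OF cl \<rho>(2) t \<rho>(3), of R] by simp
  qed
  have "uniform_limit (cball 0 R)
      (\<lambda>n x. - ((\<sigma>\<^sup>2 / 2) * (\<Sum>i\<in>Basis. s n i x)) + 1 / 2 * (\<Sum>i\<in>Basis. (p n i x)\<^sup>2) + \<delta> * w n x)
      (\<lambda>x. - ((\<sigma>\<^sup>2 / 2) * l x) + 1 / 2 * (\<Sum>i\<in>Basis. (q i x)\<^sup>2) + \<delta> * v x) sequentially" for R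
  proof -
    have "uniform_limit (cball 0 R) (\<lambda>n x. p n i x * p n i x) (\<lambda>x. q i x * q i x) sequentially"
      if i: "i \<in> Basis" for i
    proof -
      have "compact (q i ` cball 0 R)"
        using q(1)[OF i] by (intro compact_continuous_image) (auto intro: continuous_on_subset)
      then have "bounded (q i ` cball 0 R)" by (rule compact_imp_bounded)
      then show ?thesis using lim_p[OF i] by (intro uniform_lim_mult)
    qed
    then have "uniform_limit (cball 0 R) (\<lambda>n x. \<Sum>i\<in>Basis. (p n i x)\<^sup>2) (\<lambda>x. \<Sum>i\<in>Basis. (q i x)\<^sup>2) sequentially"
      unfolding power2_eq_square by (rule uniform_limit_sum)
    then show ?thesis
      by (intro uniform_limit_add uniform_limit_uminus lim_w lim_s
          bounded_linear.uniform_limit[OF bounded_linear_mult_right])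
  qed
  moreover have "- ((\<sigma>\<^sup>2 / 2) * l x) + 1 / 2 * (\<Sum>i\<in>Basis. (q i x)\<^sup>2) + \<delta> * v x = f x" for x
    unfolding l_def using \<sigma> by (simp add: field_simps)
  ultimately have lim_f: "uniform_limit (cball 0 R)
      (\<lambda>n x. - ((\<sigma>\<^sup>2 / 2) * (\<Sum>i\<in>Basis. s n i x)) + 1 / 2 * (\<Sum>i\<in>Basis. (p n i x)\<^sup>2) + \<delta> * w n x)
      f sequentially" for R
    by (simp only:)
  have pos: "0 < 1 / real (Suc n)" for n by simp
  \<comment> \<open>Rewritten as mollifications of \<open>u\<close> with differentiated kernels, the
    mollified weak derivatives are seen to be classical derivatives of \<open>w n\<close>.\<close>
  have p_eq: "p n i x = (1 / (1 / real (Suc n))) * mollify u (iter_deriv [i] \<rho>) (1 / real (Suc n)) x"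
    if "i \<in> Basis" for n i x
    using mollify_weak_deriv[OF wq[OF that] t _ pos, of n x] that unfolding p_def by simp
  have s_eq: "s n i x = (1 / (1 / real (Suc n))) * ((1 / (1 / real (Suc n))) *
      mollify u (iter_deriv [i] (iter_deriv [i] \<rho>)) (1 / real (Suc n)) x)" if "i \<in> Basis" for n i x
    using mollify_weak_deriv[OF D[OF that] t _ pos, of n x] that unfolding s_def by (simp add: power2_eq_square)
  have "C2_approximation (\<sigma>\<^sup>2 / 2) (1 / 2) \<delta> f v w p s"
    unfolding C2_approximation_def
  proof (intro conjI allI ballI lim_w lim_f)
    show "continuous_on UNIV (w n)" for n unfolding w_def by (rule continuous_on_mollify[OF u1 t pos])
    fix n x and r :: real and i :: 'a assume i: "i \<in> Basis"
    show "((\<lambda>r. w n (x + r *\<^sub>R i)) has_real_derivative p n i (x + r *\<^sub>R i)) (at r)"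
      unfolding w_def p_eq[OF i] by (rule mollify_directional_derivative[OF u1 t i pos])
    have "test_function (iter_deriv [i] \<rho>)" by (rule test_function_iter_deriv[OF t]) (use i in auto)
    from DERIV_cmult[OF mollify_directional_derivative[OF u1 this i pos]]
    show "((\<lambda>r. p n i (x + r *\<^sub>R i)) has_real_derivative s n i (x + r *\<^sub>R i)) (at r)"
      unfolding s_eq[OF i] p_eq[OF i] .
  qed
  with v that show ?thesis by blast
qed

subsection \<open>Comparison\<close>

text \<open>The second derivative is given at 0 only. If it were positive, \<open>f'\<close> would
  be positive just to the right of 0 and \<open>f\<close> would increase there.\<close>

lemma second_derivative_at_maximum:
  fixes f :: "real \<Rightarrow> real"
  assumes d: "d > 0" and f': "\<And>t. \<bar>t\<bar> < d \<Longrightarrow> (f has_real_derivative f' t) (at t)"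
    and f'': "(f' has_real_derivative l) (at 0)" and max: "\<And>t. \<bar>t\<bar> < d \<Longrightarrow> f t \<le> f 0"
  shows "f' 0 = 0" "l \<le> 0"
proof -
  show z: "f' 0 = 0"
    by (rule DERIV_local_max[OF f'[of 0] d]) (use max d in auto)
  show "l \<le> 0"
  proof (rule ccontr)
    assume "\<not> l \<le> 0"
    then obtain e where e: "e > 0" "\<And>h. 0 < h \<Longrightarrow> h < e \<Longrightarrow> f' 0 < f' (0 + h)"
      using DERIV_pos_inc_right[OF f''] by auto
    define b where "b = min e d / 2"
    have b: "0 < b" "b < e" "b < d" using e d by (auto simp: b_def)
    have "f 0 < f b"
    proof (rule DERIV_pos_imp_increasing_open[OF b(1)])
      fix t assume "0 < t" "t < b"
      then show "\<exists>y. (f has_real_derivative y) (at t) \<and> 0 < y"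
        using f'[of t] e(2)[of t] z b by (intro exI[of _ "f' t"]) auto
    next
      show "continuous_on {0..b} f"
      proof (intro continuous_at_imp_continuous_on ballI)
        fix t assume "t \<in> {0..b}"
        then show "isCont f t" using b by (intro DERIV_isCont[OF f']) auto
      qed
    qed
    with max[of b] b show False by simp
  qed
qed

text \<open>At an interior maximum of \<open>w n - T\<close> the gradients agree, so the quadratic
  terms cancel whatever the sign of \<open>k\<close>, and the Laplacians are ordered. What remains
  is \<delta> times the difference, bounded by the residual; hence the residual is made smaller than
  \<delta> times the permitted error.\<close>

theorem C2_approximation_comparison:
  fixes v T :: "'a::euclidean_space \<Rightarrow> real"
  assumes A: "C2_approximation c k \<delta> f v w p s" and c: "c \<ge> 0" and \<delta>: "\<delta> > 0"
    and T: "continuous_on (cball 0 r) T"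
    and T1: "\<And>i x. i \<in> Basis \<Longrightarrow> norm x < r \<Longrightarrow> ((\<lambda>t. T (x + t *\<^sub>R i)) has_real_derivative T1 i x) (at 0)"
    and T2: "\<And>i x. i \<in> Basis \<Longrightarrow> norm x < r \<Longrightarrow> ((\<lambda>t. T1 i (x + t *\<^sub>R i)) has_real_derivative T2 i x) (at 0)"
    and super: "\<And>x. norm x < r \<Longrightarrow>
      f x \<le> - (c * (\<Sum>i\<in>Basis. T2 i x)) + k * (\<Sum>i\<in>Basis. (T1 i x)\<^sup>2) + \<delta> * T x"
    and bdry: "\<And>x. norm x = r \<Longrightarrow> v x \<le> T x"
    and x: "norm x \<le> r"
  shows "v x \<le> T x"
proof (rule field_le_epsilon)
  fix e :: real assume e: "e > 0"
  let ?B = "cball (0::'a) r"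
  let ?R = "\<lambda>n x. - (c * (\<Sum>i\<in>Basis. s n i x)) + k * (\<Sum>i\<in>Basis. (p n i x)\<^sup>2) + \<delta> * w n x"
  have cw: "continuous_on UNIV (w n)" for n using A by (simp add: C2_approximation_def)
  have w1: "((\<lambda>t. w n (x + t *\<^sub>R i)) has_real_derivative p n i (x + t *\<^sub>R i)) (at t)" if "i \<in> Basis" for n x t i
    using A that by (simp add: C2_approximation_def)
  have w2: "((\<lambda>t. p n i (x + t *\<^sub>R i)) has_real_derivative s n i (x + t *\<^sub>R i)) (at t)" if "i \<in> Basis" for n x t i
    using A that by (simp add: C2_approximation_def)
  have "uniform_limit ?B w v sequentially" "uniform_limit ?B ?R f sequentially"
    using A unfolding C2_approximation_def by blast+
  then have "\<forall>\<^sub>F n in sequentially. (\<forall>x\<in>?B. dist (w n x) (v x) < e / 2) \<and> (\<forall>x\<in>?B. dist (?R n x) (f x) < \<delta> * (e / 2))"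
    using e \<delta> by (intro eventually_conj uniform_limitD) auto
  from eventually_happens'[OF trivial_limit_sequentially this]
  obtain n where n: "\<And>x. x \<in> ?B \<Longrightarrow> \<bar>w n x - v x\<bar> < e / 2" "\<And>x. x \<in> ?B \<Longrightarrow> \<bar>?R n x - f x\<bar> < \<delta> * (e / 2)"
    unfolding dist_real_def by blast
  have "continuous_on ?B (\<lambda>x. w n x - T x)"
    by (intro continuous_intros T continuous_on_subset[OF cw]) auto
  then obtain z where z: "z \<in> ?B" "\<And>y. y \<in> ?B \<Longrightarrow> w n y - T y \<le> w n z - T z"
    using continuous_attains_sup[of ?B "\<lambda>x. w n x - T x"] x by (metis compact_cball empty_iff mem_cball_0)
  have "w n z - T z \<le> e / 2"
  proof (cases "norm z = r")
    case True
    then show ?thesis using n(1)[OF z(1)] bdry[OF True] by linarith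
  next
    case False
    then have zr: "norm z < r" using z by simp
    define d where "d = r - norm z"
    have d: "d > 0" using zr by (simp add: d_def)
    have near: "norm (z + t *\<^sub>R i) < r" if "\<bar>t\<bar> < d" "i \<in> Basis" for t i
      using norm_triangle_ineq[of z "t *\<^sub>R i"] that by (simp add: d_def)
    have crit: "p n i z = T1 i z \<and> s n i z - T2 i z \<le> 0" if i: "i \<in> Basis" for i
    proof -
      have 1: "((\<lambda>t. w n (z + t *\<^sub>R i) - T (z + t *\<^sub>R i)) has_real_derivative
          p n i (z + t *\<^sub>R i) - T1 i (z + t *\<^sub>R i)) (at t)" if "\<bar>t\<bar> < d" for t
      proof (rule DERIV_diff[OF w1[OF i]])
        \<comment> \<open>The hypothesis differentiates at parameter 0 from every base point; moving
          the base point along the line gives the derivative at \<open>t\<close>.\<close>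
        have "((\<lambda>a. T (z + t *\<^sub>R i + a *\<^sub>R i)) has_real_derivative T1 i (z + t *\<^sub>R i)) (at 0)"
          by (rule T1[OF i near[OF that i]])
        then have "((\<lambda>a. T (z + (a + t) *\<^sub>R i)) has_real_derivative T1 i (z + t *\<^sub>R i)) (at 0)"
          by (simp add: algebra_simps)
        then show "((\<lambda>t. T (z + t *\<^sub>R i)) has_real_derivative T1 i (z + t *\<^sub>R i)) (at t)"
          using DERIV_shift[of "\<lambda>t. T (z + t *\<^sub>R i)" _ 0 t] by simp
      qed
      have 2: "((\<lambda>t. p n i (z + t *\<^sub>R i) - T1 i (z + t *\<^sub>R i)) has_real_derivative s n i z - T2 i z) (at 0)"
        using DERIV_diff[OF w2[OF i, of n z 0] T2[OF i zr]] by simp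
      have 3: "w n (z + t *\<^sub>R i) - T (z + t *\<^sub>R i) \<le> w n (z + 0 *\<^sub>R i) - T (z + 0 *\<^sub>R i)" if "\<bar>t\<bar> < d" for t
        using z(2)[of "z + t *\<^sub>R i"] near[OF that i] by simp
      from second_derivative_at_maximum[OF d 1 2 3] show ?thesis by simp
    qed
    have "c * (\<Sum>i\<in>Basis. s n i z) \<le> c * (\<Sum>i\<in>Basis. T2 i z)"
      using crit c by (intro mult_left_mono sum_mono) auto
    moreover have "(\<Sum>i\<in>Basis. (p n i z)\<^sup>2) = (\<Sum>i\<in>Basis. (T1 i z)\<^sup>2)"
      using crit by (intro sum.cong) auto
    ultimately have "\<delta> * w n z - \<delta> * T z \<le> ?R n z - f z" using super[OF zr] by simp
    also have "\<dots> \<le> \<delta> * (e / 2)" using n(2)[OF z(1)] by linarith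
    finally have "\<delta> * (w n z - T z) \<le> \<delta> * (e / 2)" by (simp add: right_diff_distrib)
    then show ?thesis using \<delta> by simp
  qed
  moreover have "w n x - T x \<le> w n z - T z" using x by (intro z(2)) simp
  moreover have "\<bar>w n x - v x\<bar> < e / 2" using x by (intro n(1)) simp
  ultimately show "v x \<le> T x + e" by linarith
qed

lemma C2_approximation_uminus:
  assumes "C2_approximation c k \<delta> f v w p s"
  shows "C2_approximation c (- k) \<delta> (\<lambda>x. - f x) (\<lambda>x. - v x) (\<lambda>n x. - w n x)
    (\<lambda>n i x. - p n i x) (\<lambda>n i x. - s n i x)"
proof -
  have "uniform_limit (cball 0 R) (\<lambda>n x. - (- (c * (\<Sum>i\<in>Basis. s n i x)) + k * (\<Sum>i\<in>Basis. (p n i x)\<^sup>2) + \<delta> * w n x))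
      (\<lambda>x. - f x) sequentially" for R
    using assms by (intro uniform_limit_uminus) (simp add: C2_approximation_def)
  then show ?thesis
    using assms unfolding C2_approximation_def
    by (auto intro!: continuous_intros DERIV_minus uniform_limit_uminus simp: sum_negf)
qed

subsection \<open>Radial barriers\<close>

lemma DERIV_norm_power2_line:
  fixes i y :: "'a::euclidean_space"
  assumes "i \<in> Basis"
  shows "((\<lambda>t. (norm (y + t *\<^sub>R i))\<^sup>2) has_real_derivative 2 * (y \<bullet> i)) (at 0)"
proof -
  have "(norm (y + t *\<^sub>R i))\<^sup>2 = (norm y)\<^sup>2 + 2 * t * (y \<bullet> i) + t * t" for t
    using assms unfolding power2_norm_eq_inner by (simp add: algebra_simps inner_commute)
  then show ?thesis by (auto intro!: derivative_eq_intros)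
qed

text \<open>Barriers are written as functions of q = |x|^2 instead of |x|, which keeps them smooth
  at the origin. The Laplacian becomes 2N g' + 4q g'' and the squared gradient 4q g'^2.\<close>

lemma radial_comparison:
  fixes v :: "'a::euclidean_space \<Rightarrow> real"
  assumes A: "C2_approximation c k \<delta> f v w p s" and c: "c \<ge> 0" and \<delta>: "\<delta> > 0"
    and g: "\<And>q. 0 \<le> q \<Longrightarrow> q \<le> r\<^sup>2 \<Longrightarrow> (g has_real_derivative g' q) (at q)"
    and g': "\<And>q. 0 \<le> q \<Longrightarrow> q \<le> r\<^sup>2 \<Longrightarrow> (g' has_real_derivative g'' q) (at q)"
    and f: "\<And>x. f x = F ((norm x)\<^sup>2)"
    and super: "\<And>q. 0 \<le> q \<Longrightarrow> q \<le> r\<^sup>2 \<Longrightarrow>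
      F q \<le> - (c * (2 * real DIM('a) * g' q + 4 * q * g'' q)) + k * (4 * q * (g' q)\<^sup>2) + \<delta> * g q"
    and bdry: "\<And>x. norm x = r \<Longrightarrow> v x \<le> g (r\<^sup>2)"
    and x: "norm x \<le> r"
  shows "v x \<le> g ((norm x)\<^sup>2)"
proof -
  let ?T1 = "\<lambda>i x. 2 * (x \<bullet> i) * g' ((norm x)\<^sup>2)"
  let ?T2 = "\<lambda>i x. 2 * g' ((norm x)\<^sup>2) + 4 * (x \<bullet> i)\<^sup>2 * g'' ((norm x)\<^sup>2)"
  have le: "(norm y)\<^sup>2 \<le> r\<^sup>2" if "norm y \<le> r" for y :: 'a using that by (intro power_mono) auto
  have chain: "((\<lambda>t. G ((norm (y + t *\<^sub>R i))\<^sup>2)) has_real_derivative G' * (2 * (y \<bullet> i))) (at 0)"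
    if "i \<in> Basis" "(G has_real_derivative G') (at ((norm y)\<^sup>2))" for G G' and i y :: 'a
    using DERIV_chain2[of G G' "\<lambda>t. (norm (y + t *\<^sub>R i))\<^sup>2" 0 _ UNIV]
      DERIV_norm_power2_line[OF that(1), of y] that(2) by simp
  have sq: "(\<Sum>i\<in>Basis. (y \<bullet> i)\<^sup>2) = (norm y)\<^sup>2" for y :: 'a
    unfolding power2_norm_eq_inner euclidean_inner[of y y] by (simp add: power2_eq_square)
  show ?thesis
  proof (rule C2_approximation_comparison[OF A c \<delta>, where r = r and ?T1.0 = ?T1 and ?T2.0 = ?T2])
    show "continuous_on (cball (0::'a) r) (\<lambda>x. g ((norm x)\<^sup>2))"
    proof (rule continuous_on_compose2[of "{0..r\<^sup>2}" g])
      show "continuous_on {0..r\<^sup>2} g"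
        using g by (intro continuous_at_imp_continuous_on ballI) (auto intro!: DERIV_isCont)
    qed (use le in \<open>auto intro!: continuous_intros\<close>)
  next
    fix i y :: 'a assume i: "i \<in> Basis" and y: "norm y < r"
    from chain[OF i g[of "(norm y)\<^sup>2"]] le[of y] y
    show "((\<lambda>t. g ((norm (y + t *\<^sub>R i))\<^sup>2)) has_real_derivative ?T1 i y) (at 0)" by (simp add: mult_ac)
    from chain[OF i g'[of "(norm y)\<^sup>2"]] le[of y] y
    have 1: "((\<lambda>t. g' ((norm (y + t *\<^sub>R i))\<^sup>2)) has_real_derivative g'' ((norm y)\<^sup>2) * (2 * (y \<bullet> i))) (at 0)"
      by simp
    have 2: "((\<lambda>t. 2 * ((y + t *\<^sub>R i) \<bullet> i)) has_real_derivative 2) (at 0)"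
      using i by (auto intro!: derivative_eq_intros simp: inner_add_left)
    from DERIV_mult[OF 2 1]
    show "((\<lambda>t. ?T1 i (y + t *\<^sub>R i)) has_real_derivative ?T2 i y) (at 0)"
      by (simp add: power2_eq_square mult_ac)
  next
    fix y :: 'a assume y: "norm y < r"
    have "(\<Sum>i\<in>Basis. ?T2 i y) = 2 * real DIM('a) * g' ((norm y)\<^sup>2) + 4 * (norm y)\<^sup>2 * g'' ((norm y)\<^sup>2)"
      unfolding sum.distrib sum_distrib_right[symmetric] sum_distrib_left[symmetric] sq by simp
    moreover have "(\<Sum>i\<in>Basis. (?T1 i y)\<^sup>2) = 4 * (norm y)\<^sup>2 * (g' ((norm y)\<^sup>2))\<^sup>2"
      unfolding power_mult_distrib sum_distrib_right[symmetric] sum_distrib_left[symmetric] sq by simp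
    ultimately show "f y \<le> - (c * (\<Sum>i\<in>Basis. ?T2 i y)) + k * (\<Sum>i\<in>Basis. (?T1 i y)\<^sup>2) + \<delta> * g ((norm y)\<^sup>2)"
      using super[of "(norm y)\<^sup>2"] le[of y] y by (simp add: f)
  next
    fix y :: 'a assume "norm y = r"
    then show "v y \<le> g ((norm y)\<^sup>2)" using bdry by simp
  qed (rule x)
qed

text \<open>In the supersolution \<open>\<beta> q + \<eta> + e - \<sigma>\<^sup>2 ln (1 - q / R\<^sup>2)\<close>, \<open>q = |x|\<^sup>2\<close>, the factor \<open>\<sigma>\<^sup>2\<close> makes the squared
  gradient cancel the most singular part of the Laplacian at the sphere of radius \<open>R\<close>.\<close>

lemma blow_up_barrier_supersolution:
  fixes \<sigma> \<delta> a b \<beta> \<eta> e N R q :: real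
  assumes \<beta>: "\<beta> \<ge> 0" and \<delta>: "\<delta> > 0" and e: "e > 0"
    and E: "2 * \<beta>\<^sup>2 + \<delta> * \<beta> = a" "\<delta> * \<eta> = b + N * \<sigma>\<^sup>2 * \<beta>"
    and q: "0 \<le> q" "q < R\<^sup>2"
    and R: "\<sigma> ^ 4 * N \<le> 4 * \<beta> * \<sigma>\<^sup>2 * R\<^sup>2" "\<sigma> ^ 4 * N \<le> \<delta> * e * R\<^sup>2"
  shows "a * q + b \<le> - (\<sigma>\<^sup>2 / 2 * (2 * N * (\<beta> + \<sigma>\<^sup>2 / (R\<^sup>2 - q)) + 4 * q * (\<sigma>\<^sup>2 / (R\<^sup>2 - q)\<^sup>2)))
    + 1 / 2 * (4 * q * (\<beta> + \<sigma>\<^sup>2 / (R\<^sup>2 - q))\<^sup>2) + \<delta> * (\<beta> * q + \<eta> + e - \<sigma>\<^sup>2 * ln (1 - q / R\<^sup>2))"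
proof -
  define d where "d = 1 / (R\<^sup>2 - q)"
  define l where "l = ln (1 - q / R\<^sup>2)"
  have D: "R\<^sup>2 - q > 0" using q by simp
  have R0: "R\<^sup>2 > 0" using q by linarith
  have l: "l \<le> 0" unfolding l_def using q R0 by (intro ln_le_zero_iff[THEN iffD2]) (auto simp: divide_less_eq)
  \<comment> \<open>The two conditions on \<open>R\<close> are combined with weights q and R^2 - q.
    Near the sphere the cross term of the squared gradient absorbs the remaining part of the
    Laplacian; near the centre the term \<delta> e does.\<close>
  have "\<sigma> ^ 4 * N * R\<^sup>2 \<le> (4 * \<beta> * \<sigma>\<^sup>2 * q + \<delta> * e * (R\<^sup>2 - q)) * R\<^sup>2"
  proof -
    have "\<sigma> ^ 4 * N * q + \<sigma> ^ 4 * N * (R\<^sup>2 - q) \<le> 4 * \<beta> * \<sigma>\<^sup>2 * R\<^sup>2 * q + \<delta> * e * R\<^sup>2 * (R\<^sup>2 - q)"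
      using R D q by (intro add_mono mult_right_mono) auto
    then show ?thesis by (simp add: algebra_simps)
  qed
  then have "\<sigma> ^ 4 * N \<le> 4 * \<beta> * \<sigma>\<^sup>2 * q + \<delta> * e * (R\<^sup>2 - q)"
    using R0 by simp
  then have "0 \<le> d * (4 * \<beta> * \<sigma>\<^sup>2 * q + \<delta> * e * (R\<^sup>2 - q) - \<sigma> ^ 4 * N)"
    using D by (simp add: d_def)
  moreover have "d * (\<delta> * e * (R\<^sup>2 - q)) = \<delta> * e" using D by (simp add: d_def)
  ultimately have main: "0 \<le> 4 * \<beta> * \<sigma>\<^sup>2 * q * d + \<delta> * e - \<sigma> ^ 4 * N * d" by (simp add: algebra_simps)
  have "0 \<le> - (\<delta> * \<sigma>\<^sup>2 * l)" using \<delta> l by (simp add: mult_nonneg_nonpos)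
  moreover have "- (\<sigma>\<^sup>2 / 2 * (2 * N * (\<beta> + \<sigma>\<^sup>2 * d) + 4 * q * (\<sigma>\<^sup>2 * d\<^sup>2)))
      + 1 / 2 * (4 * q * (\<beta> + \<sigma>\<^sup>2 * d)\<^sup>2) + \<delta> * (\<beta> * q + \<eta> + e - \<sigma>\<^sup>2 * l)
      = (2 * \<beta>\<^sup>2 + \<delta> * \<beta>) * q + (\<delta> * \<eta> - N * \<sigma>\<^sup>2 * \<beta>)
        + (4 * \<beta> * \<sigma>\<^sup>2 * q * d + \<delta> * e - \<sigma> ^ 4 * N * d) - \<delta> * \<sigma>\<^sup>2 * l"
    by algebra
  ultimately have "a * q + b \<le> - (\<sigma>\<^sup>2 / 2 * (2 * N * (\<beta> + \<sigma>\<^sup>2 * d) + 4 * q * (\<sigma>\<^sup>2 * d\<^sup>2)))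
      + 1 / 2 * (4 * q * (\<beta> + \<sigma>\<^sup>2 * d)\<^sup>2) + \<delta> * (\<beta> * q + \<eta> + e - \<sigma>\<^sup>2 * l)"
    using main unfolding E by linarith
  then show ?thesis unfolding d_def l_def by (simp add: power_divide)
qed

text \<open>With no bound on the growth of \<open>v\<close> from above, the barrier has to dominate
  arbitrary values on the sphere. Being infinite at radius \<open>R\<close>, it does so at a radius
  \<open>r\<close> close enough to \<open>R\<close>, and its value at \<open>x\<close> does not
  depend on \<open>r\<close>.\<close>

lemma solution_upper_bound:
  fixes v :: "'a::euclidean_space \<Rightarrow> real"
  assumes A: "C2_approximation (\<sigma>\<^sup>2 / 2) (1 / 2) \<delta> (\<lambda>x. a * (norm x)\<^sup>2 + b) v w p s"
    and v: "continuous_on UNIV v" and pos: "\<sigma> > 0" "\<delta> > 0" "\<beta> > 0" "\<eta> \<ge> 0"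
    and E: "2 * \<beta>\<^sup>2 + \<delta> * \<beta> = a" "\<delta> * \<eta> = b + real DIM('a) * \<sigma>\<^sup>2 * \<beta>"
  shows "v x \<le> \<beta> * (norm x)\<^sup>2 + \<eta>"
proof (rule field_le_epsilon)
  fix e0 :: real assume "e0 > 0"
  \<comment> \<open>One half for the constant in the barrier, the other for its logarithm at
    \<open>x\<close>.\<close>
  define e where "e = e0 / 2"
  have e: "e > 0" using \<open>e0 > 0\<close> by (simp add: e_def)
  let ?N = "real DIM('a)"
  \<comment> \<open>Each summand secures one of the inequalities listed below: the two conditions of
    the barrier, |x|^2 at most half of R^2, and a logarithmic term of at most \<open>e\<close> at
    \<open>x\<close>. The leading 1 ensures R \<le> R^2.\<close>
  define R where "R = 1 + \<sigma> ^ 4 * ?N / (4 * \<beta> * \<sigma>\<^sup>2) + \<sigma> ^ 4 * ?N / (\<delta> * e) + 2 * (norm x)\<^sup>2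
    + 2 * \<sigma>\<^sup>2 * (norm x)\<^sup>2 / e"
  have terms: "0 \<le> \<sigma> ^ 4 * ?N / (4 * \<beta> * \<sigma>\<^sup>2)" "0 \<le> \<sigma> ^ 4 * ?N / (\<delta> * e)" "0 \<le> 2 * (norm x)\<^sup>2"
    "0 \<le> 2 * \<sigma>\<^sup>2 * (norm x)\<^sup>2 / e" using pos e by auto
  then have R1: "R \<ge> 1" unfolding R_def by linarith
  then have RR: "R \<le> R\<^sup>2" by (simp add: power2_eq_square)
  have "\<sigma> ^ 4 * ?N / (4 * \<beta> * \<sigma>\<^sup>2) \<le> R\<^sup>2" "\<sigma> ^ 4 * ?N / (\<delta> * e) \<le> R\<^sup>2" "2 * (norm x)\<^sup>2 \<le> R\<^sup>2"
    "2 * \<sigma>\<^sup>2 * (norm x)\<^sup>2 / e \<le> R\<^sup>2"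
    using RR terms unfolding R_def by linarith+
  then have R: "\<sigma> ^ 4 * ?N \<le> 4 * \<beta> * \<sigma>\<^sup>2 * R\<^sup>2" "\<sigma> ^ 4 * ?N \<le> \<delta> * e * R\<^sup>2" "2 * (norm x)\<^sup>2 \<le> R\<^sup>2"
    "2 * \<sigma>\<^sup>2 * (norm x)\<^sup>2 \<le> e * R\<^sup>2"
    using pos e by (simp_all add: divide_le_eq mult.commute)
  have R2: "R\<^sup>2 > 0" using R1 by simp
  have "compact (v ` cball 0 R)" using v by (intro compact_continuous_image) (auto intro: continuous_on_subset)
  then obtain M where M: "M > 0" "\<forall>y\<in>v ` cball 0 R. norm y \<le> M"
    using compact_imp_bounded bounded_pos by metis
  \<comment> \<open>This will be 1 - r^2 / R^2. The exponential makes the logarithmic term at least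
    \<open>M\<close> on the sphere of radius \<open>r\<close>; the bound 1/2 keeps \<open>x\<close>
    inside that sphere.\<close>
  define \<theta> where "\<theta> = min (1 / 2) (exp (- (M / \<sigma>\<^sup>2)))"
  have \<theta>: "0 < \<theta>" "\<theta> \<le> 1 / 2" "\<theta> \<le> exp (- (M / \<sigma>\<^sup>2))" by (auto simp: \<theta>_def)
  define r where "r = R * sqrt (1 - \<theta>)"
  have r2: "r\<^sup>2 = R\<^sup>2 * (1 - \<theta>)" using \<theta> by (simp add: r_def power_mult_distrib)
  have r0: "0 \<le> r" using R1 \<theta> by (simp add: r_def)
  have rR: "r\<^sup>2 < R\<^sup>2" unfolding r2 using \<theta> R2 by (simp add: mult_less_cancel_left1)
  have rR': "r \<le> R" using rR R1 power2_le_imp_le[of r R] by linarith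
  have "(norm x)\<^sup>2 \<le> r\<^sup>2"
  proof -
    have "R\<^sup>2 * (1 / 2) \<le> R\<^sup>2 * (1 - \<theta>)" using \<theta> R2 by (intro mult_left_mono) auto
    then show ?thesis unfolding r2 using R(3) by linarith
  qed
  then have xr: "norm x \<le> r" using r0 by (rule power2_le_imp_le)
  let ?g = "\<lambda>q. \<beta> * q + \<eta> + e - \<sigma>\<^sup>2 * ln (1 - q / R\<^sup>2)"
  let ?g' = "\<lambda>q. \<beta> + \<sigma>\<^sup>2 / (R\<^sup>2 - q)"
  let ?g'' = "\<lambda>q. \<sigma>\<^sup>2 / (R\<^sup>2 - q)\<^sup>2"
  have "v x \<le> ?g ((norm x)\<^sup>2)"
  proof (rule radial_comparison[OF A, where r = r and g = ?g and g' = ?g' and g'' = ?g'' and F = "\<lambda>q. a * q + b"])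
    fix q assume q: "0 \<le> q" "q \<le> r\<^sup>2"
    then have qR: "q < R\<^sup>2" using rR by linarith
    then have p: "1 - q / R\<^sup>2 > 0" "R\<^sup>2 - q \<noteq> 0" using R2 by (auto simp: divide_less_eq)
    have i: "((\<lambda>q. 1 - q / R\<^sup>2) has_real_derivative - (1 / R\<^sup>2)) (at q)"
      using DERIV_diff[OF DERIV_const[of 1] DERIV_cdivide[OF DERIV_ident, of "R\<^sup>2"]] by simp
    have "((\<lambda>q. ln (1 - q / R\<^sup>2)) has_real_derivative inverse (1 - q / R\<^sup>2) * (- (1 / R\<^sup>2))) (at q)"
      by (rule DERIV_chain2[OF DERIV_ln[OF p(1)] i])
    moreover have "inverse (1 - q / R\<^sup>2) * (- (1 / R\<^sup>2)) = - (1 / (R\<^sup>2 - q))"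
    proof -
      have "(1 - q / R\<^sup>2) * R\<^sup>2 = R\<^sup>2 - q" using R2 by (simp add: left_diff_distrib)
      then show ?thesis by (simp add: inverse_eq_divide)
    qed
    ultimately have "((\<lambda>q. ln (1 - q / R\<^sup>2)) has_real_derivative - (1 / (R\<^sup>2 - q))) (at q)" by (simp only:)
    note log_deriv = DERIV_cmult[OF this, of "\<sigma>\<^sup>2"]
    have "((\<lambda>q. \<beta> * q + \<eta> + e) has_real_derivative \<beta>) (at q)" by (auto intro!: derivative_eq_intros)
    from DERIV_diff[OF this log_deriv]
    show "(?g has_real_derivative ?g' q) (at q)" by simp
    have "((\<lambda>q. R\<^sup>2 - q) has_real_derivative - 1) (at q)" by (auto intro!: derivative_eq_intros)
    from DERIV_cmult[OF DERIV_inverse_fun[OF this p(2)], of "\<sigma>\<^sup>2"]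
    have "((\<lambda>q. \<sigma>\<^sup>2 * inverse (R\<^sup>2 - q)) has_real_derivative ?g'' q) (at q)"
      by (simp add: divide_inverse power2_eq_square)
    from DERIV_add[OF DERIV_const[of \<beta>] this]
    show "(?g' has_real_derivative ?g'' q) (at q)" by (simp add: divide_inverse)
    show "a * q + b \<le> - (\<sigma>\<^sup>2 / 2 * (2 * real DIM('a) * ?g' q + 4 * q * ?g'' q)) + 1 / 2 * (4 * q * (?g' q)\<^sup>2) + \<delta> * ?g q"
      by (rule blow_up_barrier_supersolution) (use pos e E q(1) qR R in auto)
  next
    fix y :: 'a assume y: "norm y = r"
    then have "\<bar>v y\<bar> \<le> M" using M(2) rR' by auto
    moreover have "1 - r\<^sup>2 / R\<^sup>2 = \<theta>" unfolding r2 using R2 by simp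
    moreover have "M \<le> - (\<sigma>\<^sup>2 * ln \<theta>)"
    proof -
      have "ln \<theta> \<le> - (M / \<sigma>\<^sup>2)" using \<theta> by (metis exp_gt_zero ln_exp ln_le_cancel_iff)
      then have "\<sigma>\<^sup>2 * ln \<theta> \<le> \<sigma>\<^sup>2 * (- (M / \<sigma>\<^sup>2))" by (intro mult_left_mono) auto
      then show ?thesis using pos by simp
    qed
    moreover have "0 \<le> \<beta> * r\<^sup>2" using pos by simp
    ultimately show "v y \<le> ?g (r\<^sup>2)" using pos(4) e by (simp only:)
  qed (use pos xr in auto)
  moreover have "- (\<sigma>\<^sup>2 * ln (1 - (norm x)\<^sup>2 / R\<^sup>2)) \<le> e"
  proof -
    define z where "z = (norm x)\<^sup>2 / R\<^sup>2"
    have z: "0 \<le> z" "z \<le> 1 / 2" using R(3) R2 by (auto simp: z_def divide_le_eq)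
    \<comment> \<open>The lower bound -z - 2z^2 for ln (1 - z) on [0, 1/2] then gives -2z.\<close>
    have "2 * z\<^sup>2 \<le> z" using mult_left_mono[OF z(2) z(1)] by (simp add: power2_eq_square)
    then have "- ln (1 - z) \<le> 2 * z" using ln_one_minus_pos_lower_bound[OF z] by linarith
    then have "\<sigma>\<^sup>2 * - ln (1 - z) \<le> \<sigma>\<^sup>2 * (2 * z)" by (intro mult_left_mono) auto
    also have "\<dots> = 2 * \<sigma>\<^sup>2 * (norm x)\<^sup>2 / R\<^sup>2" by (simp add: z_def)
    also have "\<dots> \<le> e" using R(4) R2 by (simp add: divide_le_eq)
    finally show ?thesis by (simp add: z_def)
  qed
  ultimately show "v x \<le> \<beta> * (norm x)\<^sup>2 + \<eta> + e0" by (simp add: e_def)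
qed

text \<open>The subsolution \<open>\<beta> r\<^sup>2 + \<eta> - \<gamma> r\<^sup>4 / R\<^sup>2 - C / R\<^sup>2\<close> tends to \<open>\<beta> r\<^sup>2 + \<eta>\<close> as \<open>R\<close> grows. For \<open>r = R\<close> it
  lies below \<open>- \<epsilon> R\<^sup>2\<close> as \<open>\<gamma> > \<beta>\<close>; it is a subsolution as \<open>8 \<gamma> < 8 \<beta> + \<delta>\<close>. The constant \<open>C\<close> maximises
  \<open>B q - A q\<^sup>2\<close>.\<close>

lemma quartic_barrier_subsolution:
  fixes \<sigma> \<delta> a b \<beta> \<eta> N y q \<gamma> A B C :: real
  assumes pos: "\<delta> > 0" "\<beta> > 0"
    and E: "2 * \<beta>\<^sup>2 + \<delta> * \<beta> = a" "\<delta> * \<eta> = b + N * \<sigma>\<^sup>2 * \<beta>"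
    and q: "0 \<le> q" "y * q \<le> 1" "0 \<le> y"
    and defs: "\<gamma> = \<beta> + \<delta> / 16" "A = \<gamma> * \<delta> / 2" "B = 2 * \<sigma>\<^sup>2 * \<gamma> * (N + 2)" "C = B\<^sup>2 / (4 * A) / \<delta>"
  shows "- (a * q + b) \<le> - (\<sigma>\<^sup>2 / 2 * (2 * N * (- \<beta> + 2 * \<gamma> * y * q) + 4 * q * (2 * \<gamma> * y)))
    + - (1 / 2) * (4 * q * (- \<beta> + 2 * \<gamma> * y * q)\<^sup>2) + \<delta> * (- (\<beta> * q + \<eta>) + \<gamma> * y * q\<^sup>2 + C * y)"
proof -
  have \<gamma>: "\<gamma> > 0" and A: "A > 0" using pos by (auto simp: defs)
  \<comment> \<open>Here \<open>y\<close> stands for 1 / R^2, and \<open>B\<close> is the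
    coefficient of \<open>y * q\<close> that \<sigma>^2 / 2 times the Laplacian of the quartic term
    produces.\<close>
  have "0 \<le> A * (q - B / (2 * A))\<^sup>2" using A by simp
  also have "A * (q - B / (2 * A))\<^sup>2 = A * q\<^sup>2 - B * q + B\<^sup>2 / (4 * A)"
    using A by (simp add: power2_eq_square field_simps)
  also have "B\<^sup>2 / (4 * A) = \<delta> * C" using pos by (simp add: defs(4))
  finally have quad: "B * q - A * q\<^sup>2 - \<delta> * C \<le> 0" by simp
  \<comment> \<open>Inside the ball \<open>y * q \<le> 1\<close>, so the square of the quartic
    term's gradient costs at most 8 \<gamma>^2 q^2. As \<gamma> - \<beta> = \<delta>/16, half of
    \<delta> \<gamma> q^2 survives, which is the origin of \<open>A\<close>.\<close>
  have "8 * \<gamma>\<^sup>2 * q\<^sup>2 * (y * q) \<le> 8 * \<gamma>\<^sup>2 * q\<^sup>2 * 1" using q by (intro mult_left_mono) auto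
  moreover have "8 * \<gamma>\<^sup>2 * q\<^sup>2 - (8 * \<beta> * \<gamma> + \<delta> * \<gamma>) * q\<^sup>2 = - A * q\<^sup>2"
  proof -
    have \<beta>: "\<beta> = \<gamma> - \<delta> / 16" using defs(1) by simp
    show ?thesis unfolding defs(2) \<beta> by (simp add: field_simps power2_eq_square)
  qed
  ultimately have "B * q - (8 * \<beta> * \<gamma> + \<delta> * \<gamma>) * q\<^sup>2 + 8 * \<gamma>\<^sup>2 * q\<^sup>2 * (y * q) - \<delta> * C \<le> 0"
    using quad by linarith
  then have "y * (B * q - (8 * \<beta> * \<gamma> + \<delta> * \<gamma>) * q\<^sup>2 + 8 * \<gamma>\<^sup>2 * q\<^sup>2 * (y * q) - \<delta> * C) \<le> 0"
    using q(3) by (simp add: mult_nonneg_nonpos)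
  moreover have "- (\<sigma>\<^sup>2 / 2 * (2 * N * (- \<beta> + 2 * \<gamma> * y * q) + 4 * q * (2 * \<gamma> * y)))
    + - (1 / 2) * (4 * q * (- \<beta> + 2 * \<gamma> * y * q)\<^sup>2) + \<delta> * (- (\<beta> * q + \<eta>) + \<gamma> * y * q\<^sup>2 + C * y)
    = - ((2 * \<beta>\<^sup>2 + \<delta> * \<beta>) * q + (\<delta> * \<eta> - N * \<sigma>\<^sup>2 * \<beta>))
      - y * (B * q - (8 * \<beta> * \<gamma> + \<delta> * \<gamma>) * q\<^sup>2 + 8 * \<gamma>\<^sup>2 * q\<^sup>2 * (y * q) - \<delta> * C)"
    unfolding defs(3) by algebra
  ultimately show ?thesis unfolding E by linarith
qed

text \<open>The comparison is applied to \<open>- v\<close>, whose equation has the opposite sign in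
  front of the squared gradient; a subsolution below \<open>v\<close> becomes a supersolution above
  \<open>- v\<close>.\<close>

lemma solution_lower_bound:
  fixes v :: "'a::euclidean_space \<Rightarrow> real"
  assumes A: "C2_approximation (\<sigma>\<^sup>2 / 2) (1 / 2) \<delta> (\<lambda>x. a * (norm x)\<^sup>2 + b) v w p s"
    and pos: "\<sigma> > 0" "\<delta> > 0" "\<beta> > 0"
    and E: "2 * \<beta>\<^sup>2 + \<delta> * \<beta> = a" "\<delta> * \<eta> = b + real DIM('a) * \<sigma>\<^sup>2 * \<beta>"
    and growth: "\<And>e. e > 0 \<Longrightarrow> \<exists>R0. \<forall>x. norm x \<ge> R0 \<longrightarrow> v x \<ge> - (e * (norm x)\<^sup>2)"
  shows "\<beta> * (norm x)\<^sup>2 + \<eta> \<le> v x"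
proof (rule field_le_epsilon)
  fix e :: real assume e: "e > 0"
  \<comment> \<open>The constant \<delta>/32 is half of \<gamma> - \<beta>. On the sphere of radius
    \<open>R\<close> the barrier above \<open>- v\<close> is at least \<delta>/16 R^2 - \<eta>; one
    half of the first term dominates \<open>- v\<close>, the other half absorbs \<eta>.\<close>
  obtain R0 where R0: "\<And>x. norm x \<ge> R0 \<Longrightarrow> v x \<ge> - (\<delta> / 32 * (norm x)\<^sup>2)"
    using growth[of "\<delta> / 32"] pos by auto
  define \<gamma> where "\<gamma> = \<beta> + \<delta> / 16"
  define A' where "A' = \<gamma> * \<delta> / 2"
  define B where "B = 2 * \<sigma>\<^sup>2 * \<gamma> * (real DIM('a) + 2)"
  define C where "C = B\<^sup>2 / (4 * A') / \<delta>"
  have \<gamma>: "\<gamma> > 0" using pos by (simp add: \<gamma>_def)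
  then have C0: "C \<ge> 0" using pos by (simp add: C_def A'_def)
  \<comment> \<open>The barrier differs from the explicit solution at \<open>x\<close> by K / R^2,
    hence the summand \<open>K / e\<close> in \<open>R\<close>.\<close>
  define K where "K = \<gamma> * ((norm x)\<^sup>2)\<^sup>2 + C"
  have K0: "K \<ge> 0" using \<gamma> C0 by (simp add: K_def)
  define R where "R = 1 + \<bar>R0\<bar> + norm x + 32 * \<bar>\<eta>\<bar> / \<delta> + K / e"
  have terms: "0 \<le> 32 * \<bar>\<eta>\<bar> / \<delta>" "0 \<le> K / e" using pos e K0 by auto
  then have R1: "R \<ge> 1" "R \<ge> R0" "norm x \<le> R" unfolding R_def using norm_ge_zero[of x] by linarith+
  then have RR: "R \<le> R\<^sup>2" by (simp add: power2_eq_square)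
  have R2: "R\<^sup>2 > 0" using R1 by simp
  have "32 * \<bar>\<eta>\<bar> / \<delta> \<le> R\<^sup>2" "K / e \<le> R\<^sup>2" using RR terms norm_ge_zero[of x] unfolding R_def by linarith+
  then have R: "32 * \<bar>\<eta>\<bar> \<le> \<delta> * R\<^sup>2" "K / R\<^sup>2 \<le> e"
    using pos e R2 by (simp_all add: divide_le_eq mult.commute)
  define Y where "Y = 1 / R\<^sup>2"
  have Y: "Y \<ge> 0" "Y * R\<^sup>2 = 1" using R2 by (auto simp: Y_def)
  let ?g = "\<lambda>q. - (\<beta> * q + \<eta>) + \<gamma> * Y * q\<^sup>2 + C * Y"
  have "- v x \<le> ?g ((norm x)\<^sup>2)"
  proof (rule radial_comparison[OF C2_approximation_uminus[OF A], where r = R and g = ?g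
        and g' = "\<lambda>q. - \<beta> + 2 * \<gamma> * Y * q" and g'' = "\<lambda>q. 2 * \<gamma> * Y" and F = "\<lambda>q. - (a * q + b)"])
    fix q :: real assume q: "0 \<le> q" "q \<le> R\<^sup>2"
    show "(?g has_real_derivative - \<beta> + 2 * \<gamma> * Y * q) (at q)"
      by (auto intro!: derivative_eq_intros)
    show "((\<lambda>q. - \<beta> + 2 * \<gamma> * Y * q) has_real_derivative 2 * \<gamma> * Y) (at q)"
      by (auto intro!: derivative_eq_intros)
    show "- (a * q + b) \<le> - (\<sigma>\<^sup>2 / 2 * (2 * real DIM('a) * (- \<beta> + 2 * \<gamma> * Y * q) + 4 * q * (2 * \<gamma> * Y)))
        + - (1 / 2) * (4 * q * (- \<beta> + 2 * \<gamma> * Y * q)\<^sup>2) + \<delta> * ?g q"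
      by (rule quartic_barrier_subsolution[OF pos(2,3) E q(1) _ _ \<gamma>_def A'_def B_def C_def])
         (use mult_left_mono[OF q(2) Y(1)] Y in auto)
  next
    fix y :: 'a assume y: "norm y = R"
    have "v y \<ge> - (\<delta> / 32 * R\<^sup>2)" using R0[of y] y R1 by simp
    moreover have "?g (R\<^sup>2) = \<delta> / 16 * R\<^sup>2 - \<eta> + C * Y"
    proof -
      have "Y * (R\<^sup>2)\<^sup>2 = (Y * R\<^sup>2) * R\<^sup>2" by (simp only: power2_eq_square[of "R\<^sup>2"] mult.assoc)
      then have "Y * (R\<^sup>2)\<^sup>2 = R\<^sup>2" unfolding Y(2) by simp
      then have "\<gamma> * Y * (R\<^sup>2)\<^sup>2 = \<gamma> * R\<^sup>2" by (simp add: mult.assoc)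
      then show ?thesis by (simp add: \<gamma>_def algebra_simps)
    qed
    moreover have "0 \<le> C * Y" using C0 Y(1) by simp
    ultimately show "- v y \<le> ?g (R\<^sup>2)" using R(1) by (simp only:)
  qed (use pos R1 in auto)
  moreover have "\<gamma> * Y * ((norm x)\<^sup>2)\<^sup>2 + C * Y = K / R\<^sup>2" by (simp add: K_def Y_def add_divide_distrib)
  ultimately show "\<beta> * (norm x)\<^sup>2 + \<eta> \<le> v x + e" using R(2) by linarith
qed

subsection \<open>The explicit solution\<close>

lemma integral_translation:
  fixes \<psi> :: "'a::euclidean_space \<Rightarrow> real"
  assumes "continuous_on UNIV \<psi>"
  shows "(LINT y|lebesgue. \<psi> (y + z)) = (LINT y|lebesgue. \<psi> y)"
proof -
  have m: "\<psi> \<in> borel_measurable borel" using assms by (rule borel_measurable_continuous_onI)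
  have "(LINT y|lborel. \<psi> y) = (LINT y|distr lborel borel ((+) z). \<psi> y)" by (simp add: lborel_distr_plus)
  also have "\<dots> = (LINT y|lborel. \<psi> (z + y))" using m by (subst integral_distr) auto
  finally show ?thesis using m by (simp add: integral_completion add.commute)
qed

text \<open>By translation invariance the integral of \<psi> (x + t i) over x is constant in t;
  differentiating under the integral at t = 0 gives the claim without iterated integrals.\<close>

lemma integral_directional_derivative_eq_0:
  fixes \<psi> :: "'a::euclidean_space \<Rightarrow> real"
  assumes i: "i \<in> Basis"
    and D: "\<And>x. ((\<lambda>t. \<psi> (x + t *\<^sub>R i)) has_real_derivative \<psi>' x) (at 0)"
    and c: "continuous_on UNIV \<psi>" "continuous_on UNIV \<psi>'"
    and z: "\<And>x. norm x > r \<Longrightarrow> \<psi> x = 0" "\<And>x. norm x > r \<Longrightarrow> \<psi>' x = 0"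
  shows "(LINT x|lebesgue. \<psi>' x) = 0"
proof -
  have one: "(\<lambda>_::'a. 1) \<in> Lp_loc 1" by (rule continuous_Lp_loc) auto
  obtain M where M: "\<And>x. \<bar>\<psi>' x\<bar> \<le> M" using continuous_compact_support_bounded[OF c(2) z(2)] by metis
  have "((\<lambda>t. LINT y|lebesgue. 1 * \<psi> (y + t *\<^sub>R i)) has_real_derivative
      (LINT y|lebesgue. 1 * \<psi>' (y + 0 *\<^sub>R i))) (at 0)"
  proof (rule DERIV_integral_kernel[OF one zero_less_one, where M = M and R = "r + 1"])
    fix t :: real and y :: 'a
    have "((\<lambda>a. \<psi> (y + (a + t) *\<^sub>R i)) has_real_derivative \<psi>' (y + t *\<^sub>R i)) (at 0)"
      using D[of "y + t *\<^sub>R i"] by (simp add: algebra_simps)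
    then show "((\<lambda>t. \<psi> (y + t *\<^sub>R i)) has_real_derivative \<psi>' (y + t *\<^sub>R i)) (at t)"
      using DERIV_shift[of "\<lambda>t. \<psi> (y + t *\<^sub>R i)" _ 0 t] by simp
    show "continuous_on UNIV (\<lambda>y. \<psi> (y + t *\<^sub>R i))"
      by (rule continuous_on_compose2[OF c(1)]) (auto intro!: continuous_intros)
    show "\<bar>\<psi>' (y + t *\<^sub>R i)\<bar> \<le> M" by (rule M)
    assume t: "\<bar>t - 0\<bar> < 1" and y: "norm y > r + 1"
    have "norm y \<le> norm (y + t *\<^sub>R i) + norm (t *\<^sub>R i)"
      using norm_triangle_ineq4[of "y + t *\<^sub>R i" "t *\<^sub>R i"] by simp
    then show "\<psi> (y + t *\<^sub>R i) = 0" using t y i by (intro z(1)) simp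
  qed
  moreover have "(LINT y|lebesgue. 1 * \<psi> (y + t *\<^sub>R i)) = (LINT y|lebesgue. \<psi> y)" for t
    using integral_translation[OF c(1), of "t *\<^sub>R i"] by simp
  ultimately have "((\<lambda>t::real. LINT y|lebesgue. \<psi> y) has_real_derivative (LINT y|lebesgue. \<psi>' y)) (at 0)"
    by simp
  then show ?thesis using DERIV_const DERIV_unique by blast
qed

lemma integration_by_parts_test_function:
  fixes u g :: "'a::euclidean_space \<Rightarrow> real"
  assumes i: "i \<in> Basis" and D: "\<And>x. ((\<lambda>t. u (x + t *\<^sub>R i)) has_real_derivative g x) (at 0)"
    and c: "continuous_on UNIV u" "continuous_on UNIV g" and \<phi>: "test_function \<phi>"
  shows "(LINT x|lebesgue. u x * iter_deriv [i] \<phi> x) = - (LINT x|lebesgue. g x * \<phi> x)"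
proof -
  have \<phi>': "test_function (iter_deriv [i] \<phi>)" by (rule test_function_iter_deriv[OF \<phi>]) (use i in auto)
  obtain r where r: "\<And>x. norm x > r \<Longrightarrow> \<phi> x = 0" using test_function_support_ball[OF \<phi>] by metis
  obtain r' where r': "\<And>x. norm x > r' \<Longrightarrow> iter_deriv [i] \<phi> x = 0" using test_function_support_ball[OF \<phi>'] by metis
  have cc: "continuous_on UNIV \<phi>" "continuous_on UNIV (iter_deriv [i] \<phi>)"
    using test_function_continuous \<phi> \<phi>' by auto
  have "(LINT x|lebesgue. u x * iter_deriv [i] \<phi> x + g x * \<phi> x) = 0"
  proof (rule integral_directional_derivative_eq_0[OF i, where \<psi> = "\<lambda>x. u x * \<phi> x" and r = "max r r'"])
    fix x
    have "((\<lambda>t. \<phi> (x + t *\<^sub>R i)) has_real_derivative iter_deriv [i] \<phi> x) (at 0)"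
      using test_function_directional_derivative[OF \<phi> i, of x 1 0] by simp
    from DERIV_mult[OF D this]
    show "((\<lambda>t. u (x + t *\<^sub>R i) * \<phi> (x + t *\<^sub>R i)) has_real_derivative u x * iter_deriv [i] \<phi> x + g x * \<phi> x) (at 0)"
      by (simp add: mult.commute add.commute)
  next
    fix x :: 'a assume "norm x > max r r'"
    then show "u x * \<phi> x = 0" "u x * iter_deriv [i] \<phi> x + g x * \<phi> x = 0" using r[of x] r'[of x] by simp_all
  qed (intro continuous_intros c cc)+
  moreover have "integrable lebesgue (\<lambda>x. u x * iter_deriv [i] \<phi> x)"
    by (rule integrable_mult_continuous_kernel[OF continuous_Lp_loc[OF c(1)] cc(2) r']) auto
  moreover have "integrable lebesgue (\<lambda>x. g x * \<phi> x)"
    by (rule integrable_mult_continuous_kernel[OF continuous_Lp_loc[OF c(2)] cc(1) r]) auto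
  ultimately show ?thesis by simp
qed

lemma has_weak_deriv_Nil:
  fixes u :: "'a::euclidean_space \<Rightarrow> real"
  assumes "continuous_on UNIV u" shows "has_weak_deriv [] u u"
  using continuous_Lp_loc[OF assms, of 1] by (simp add: has_weak_deriv_def)

text \<open>The head of the list is the outermost derivative on the test function, so integration by
  parts moves it onto \<open>u\<close> first and leaves the weak derivative of \<open>g\<close> for
  the tail.\<close>

lemma has_weak_deriv_Cons:
  fixes u g h :: "'a::euclidean_space \<Rightarrow> real"
  assumes i: "i \<in> Basis" and "is": "is \<in> lists Basis"
    and D: "\<And>x. ((\<lambda>t. u (x + t *\<^sub>R i)) has_real_derivative g x) (at 0)"
    and c: "continuous_on UNIV u" "continuous_on UNIV g" and h: "has_weak_deriv is g h"
  shows "has_weak_deriv (i # is) u h"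
  unfolding has_weak_deriv_def
proof (intro conjI allI impI)
  show "u \<in> Lp_loc 1" using c(1) by (rule continuous_Lp_loc) simp
  show "h \<in> Lp_loc 1" using h by (simp add: has_weak_deriv_def)
  fix \<phi> :: "'a \<Rightarrow> real" assume \<phi>: "test_function \<phi>"
  have "(LINT x|lebesgue. u x * iter_deriv [i] (iter_deriv is \<phi>) x) = - (LINT x|lebesgue. g x * iter_deriv is \<phi> x)"
    by (rule integration_by_parts_test_function[OF i D c test_function_iter_deriv[OF \<phi> "is"]])
  then show "(LINT x|lebesgue. u x * iter_deriv (i # is) \<phi> x) = (- 1) ^ length (i # is) * (LINT x|lebesgue. h x * \<phi> x)"
    using h \<phi> by (simp add: has_weak_deriv_def)
qed

lemma has_weak_deriv_quadratic:
  fixes \<beta> \<eta> :: real and i j :: "'a::euclidean_space"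
  assumes i: "i \<in> Basis"
  shows "has_weak_deriv [i] (\<lambda>x. \<beta> * (norm x)\<^sup>2 + \<eta>) (\<lambda>x. (2 * \<beta>) *\<^sub>R x \<bullet> i)"
    and "j \<in> Basis \<Longrightarrow> has_weak_deriv [i, j] (\<lambda>x. \<beta> * (norm x)\<^sup>2 + \<eta>) (\<lambda>x. 2 * \<beta> * (i \<bullet> j))"
proof -
  have c: "continuous_on UNIV (\<lambda>x::'a. \<beta> * (norm x)\<^sup>2 + \<eta>)" "continuous_on UNIV (\<lambda>x::'a. (2 * \<beta>) *\<^sub>R x \<bullet> i)"
    by (intro continuous_intros)+
  have D: "((\<lambda>t. \<beta> * (norm (x + t *\<^sub>R i))\<^sup>2 + \<eta>) has_real_derivative (2 * \<beta>) *\<^sub>R x \<bullet> i) (at 0)" for x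
    using DERIV_add[OF DERIV_cmult[OF DERIV_norm_power2_line[OF i, of x], of \<beta>] DERIV_const[of \<eta>]]
    by (simp add: mult_ac)
  show "has_weak_deriv [i] (\<lambda>x. \<beta> * (norm x)\<^sup>2 + \<eta>) (\<lambda>x. (2 * \<beta>) *\<^sub>R x \<bullet> i)"
    by (rule has_weak_deriv_Cons[OF i _ D c has_weak_deriv_Nil[OF c(2)]]) simp
  assume j: "j \<in> Basis"
  have c': "continuous_on UNIV (\<lambda>x::'a. 2 * \<beta> * (i \<bullet> j))" by (intro continuous_intros)
  have "((\<lambda>t. (2 * \<beta>) *\<^sub>R (x + t *\<^sub>R j) \<bullet> i) has_real_derivative 2 * \<beta> * (i \<bullet> j)) (at 0)" for x
  proof -
    have "(2 * \<beta>) *\<^sub>R (x + t *\<^sub>R j) \<bullet> i = 2 * \<beta> * (x \<bullet> i) + t * (2 * \<beta> * (i \<bullet> j))" for t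
      by (simp add: inner_add_left inner_commute[of i] distrib_left)
    then show ?thesis by (auto intro!: derivative_eq_intros)
  qed
  then have "has_weak_deriv [j] (\<lambda>x. (2 * \<beta>) *\<^sub>R x \<bullet> i) (\<lambda>x. 2 * \<beta> * (i \<bullet> j))"
    by (intro has_weak_deriv_Cons[OF j _ _ c(2) c' has_weak_deriv_Nil[OF c']]) auto
  then show "has_weak_deriv [i, j] (\<lambda>x. \<beta> * (norm x)\<^sup>2 + \<eta>) (\<lambda>x. 2 * \<beta> * (i \<bullet> j))"
    by (intro has_weak_deriv_Cons[OF i _ D c]) (use j in auto)
qed

lemma quadratic_admissible:
  fixes \<sigma> \<delta> a b \<beta> \<eta> :: real
  assumes pos: "\<beta> > 0" "\<eta> \<ge> 0"
    and E: "2 * \<beta>\<^sup>2 + \<delta> * \<beta> = a" "\<delta> * \<eta> = b + real DIM('a) * \<sigma>\<^sup>2 * \<beta>"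
  shows "admissible_solution \<sigma> \<delta> (\<lambda>x::'a::euclidean_space. a * (norm x)\<^sup>2 + b) (\<lambda>x. \<beta> * (norm x)\<^sup>2 + \<eta>)"
  unfolding admissible_solution_def
proof (intro conjI allI impI)
  let ?u = "\<lambda>x::'a. \<beta> * (norm x)\<^sup>2 + \<eta>"
  fix m :: real assume "m > real DIM('a)"
  then have m: "m \<ge> 0" using of_nat_0_le_iff[of "DIM('a)"] by linarith
  show "?u \<in> Sobolev_loc 2 m"
    unfolding Sobolev_loc_def
  proof (intro CollectI ballI impI)
    fix ks :: "'a list" assume ks: "ks \<in> lists Basis" and l: "length ks \<le> 2"
    consider "ks = []" | i where "ks = [i]" "i \<in> Basis" | i j where "ks = [i, j]" "i \<in> Basis" "j \<in> Basis"
    proof (cases ks)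
      case (Cons i xs)
      then show ?thesis using ks l that by (cases xs) auto
    qed (use that in blast)
    then show "\<exists>g\<in>Lp_loc m. has_weak_deriv ks ?u g"
    proof cases
      case 1
      have "continuous_on UNIV ?u" by (intro continuous_intros)
      from has_weak_deriv_Nil[OF this] continuous_Lp_loc[OF this m] show ?thesis using 1 by blast
    next
      case 2
      have "(\<lambda>x::'a. (2 * \<beta>) *\<^sub>R x \<bullet> i) \<in> Lp_loc m" by (intro continuous_Lp_loc m continuous_intros)
      then show ?thesis using has_weak_deriv_quadratic(1)[OF 2(2)] 2(1) by blast
    next
      case 3
      have "(\<lambda>x::'a. 2 * \<beta> * (i \<bullet> j)) \<in> Lp_loc m" by (intro continuous_Lp_loc m continuous_intros)
      then show ?thesis using has_weak_deriv_quadratic(2)[OF 3(2,3)] 3(1) by blast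
    qed
  qed
next
  let ?u = "\<lambda>x::'a. \<beta> * (norm x)\<^sup>2 + \<eta>"
  show "solves_HJ_ae \<sigma> \<delta> (\<lambda>x::'a. a * (norm x)\<^sup>2 + b) ?u"
    unfolding solves_HJ_ae_def
  proof (intro exI conjI AE_I2)
    show "has_weak_gradient ?u (\<lambda>x. (2 * \<beta>) *\<^sub>R x)"
      unfolding has_weak_gradient_def using has_weak_deriv_quadratic(1) by blast
    have "has_weak_deriv [i, i] ?u (\<lambda>x. 2 * \<beta> * (i \<bullet> i))" if "i \<in> Basis" for i
      using has_weak_deriv_quadratic(2)[OF that that] .
    then show "has_weak_Laplacian ?u (\<lambda>x. \<Sum>i\<in>(Basis::'a set). 2 * \<beta> * (i \<bullet> i))"
      unfolding has_weak_Laplacian_def by (intro exI[of _ "\<lambda>i x. 2 * \<beta> * (i \<bullet> i)"]) auto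
    fix x :: 'a
    have "(\<Sum>i\<in>(Basis::'a set). 2 * \<beta> * (i \<bullet> i)) = 2 * \<beta> * real DIM('a)" by simp
    moreover have "(norm ((2 * \<beta>) *\<^sub>R x))\<^sup>2 = 4 * \<beta>\<^sup>2 * (norm x)\<^sup>2"
      by (simp add: power_mult_distrib)
    moreover have "- (\<sigma>\<^sup>2 / 2) * (2 * \<beta> * real DIM('a)) + 1 / 2 * (4 * \<beta>\<^sup>2 * (norm x)\<^sup>2) + \<delta> * (\<beta> * (norm x)\<^sup>2 + \<eta>)
        = (2 * \<beta>\<^sup>2 + \<delta> * \<beta>) * (norm x)\<^sup>2 + (\<delta> * \<eta> - real DIM('a) * \<sigma>\<^sup>2 * \<beta>)"
      by algebra
    ultimately show "- (\<sigma>\<^sup>2 / 2) * (\<Sum>i\<in>(Basis::'a set). 2 * \<beta> * (i \<bullet> i)) + 1 / 2 * (norm ((2 * \<beta>) *\<^sub>R x))\<^sup>2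
        + \<delta> * ?u x = a * (norm x)\<^sup>2 + b"
      using E by (simp only:)
  qed
  \<comment> \<open>At the origin the quotient is 0 by the convention for division, so it is
    nonnegative everywhere.\<close>
  show "0 \<le> Liminf at_infinity (\<lambda>x::'a. ereal (?u x / (norm x)\<^sup>2))"
    by (rule Liminf_bounded) (use pos in \<open>auto intro!: always_eventually\<close>)
qed

section \<open>Uniqueness and conclusion\<close>

lemma admissible_solution_unique:
  fixes u :: "'a::euclidean_space \<Rightarrow> real"
  assumes u: "admissible_solution \<sigma> \<delta> (\<lambda>x. a * (norm x)\<^sup>2 + b) u"
    and pos: "\<sigma> > 0" "\<delta> > 0" "\<beta> > 0" "\<eta> \<ge> 0"
    and E: "2 * \<beta>\<^sup>2 + \<delta> * \<beta> = a" "\<delta> * \<eta> = b + real DIM('a) * \<sigma>\<^sup>2 * \<beta>"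
  shows "AE x in lebesgue. u x = \<beta> * (norm x)\<^sup>2 + \<eta>"
proof -
  let ?f = "\<lambda>x::'a. a * (norm x)\<^sup>2 + b"
  have S: "u \<in> Sobolev_loc 2 (real (2 * DIM('a) + 1))" and eq: "solves_HJ_ae \<sigma> \<delta> ?f u"
    using u unfolding admissible_solution_def by auto
  have "continuous_on UNIV ?f" by (intro continuous_intros)
  then obtain v w p s where v: "continuous_on UNIV v" "AE x in lebesgue. u x = v x"
    and A: "C2_approximation (\<sigma>\<^sup>2 / 2) (1 / 2) \<delta> ?f v w p s"
    by (rule solution_has_C2_approximation[OF S eq _ pos(1)])
  \<comment> \<open>The growth condition concerns the values of \<open>u\<close>, whereas the
    barrier needs it for \<open>v\<close>. The two agree almost everywhere, and a weak inequality
    between continuous functions extends from almost all points of an open set to all of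
    them.\<close>
  have growth: "\<exists>R0. \<forall>x. norm x \<ge> R0 \<longrightarrow> v x \<ge> - (e * (norm x)\<^sup>2)" if e: "e > 0" for e
  proof -
    have "ereal (- e) < Liminf at_infinity (\<lambda>x. ereal (u x / (norm x)\<^sup>2))"
      using u e unfolding admissible_solution_def by (auto intro: less_le_trans[of _ 0])
    from less_LiminfD[OF this] have "\<forall>\<^sub>F x in at_infinity. - e < u x / (norm x)\<^sup>2" by simp
    then obtain R where R: "\<And>x. norm x \<ge> R \<Longrightarrow> - e < u x / (norm x)\<^sup>2"
      unfolding eventually_at_infinity by blast
    \<comment> \<open>Open, for the extension by continuity; the maximum with 0 excludes the origin,
      so that |x|^2 can be multiplied out.\<close>
    let ?S = "{x::'a. max R 0 < norm x}"
    have "0 \<le> v x + e * (norm x)\<^sup>2" if "x \<in> ?S" for x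
    proof (rule AE_continuous_nonneg[OF _ _ _ that])
      show "open ?S" by (intro open_Collect_less continuous_intros)
      show "continuous_on ?S (\<lambda>x. v x + e * (norm x)\<^sup>2)"
        by (intro continuous_intros continuous_on_subset[OF v(1)]) auto
      show "AE x in lebesgue. x \<in> ?S \<longrightarrow> 0 \<le> v x + e * (norm x)\<^sup>2"
        using v(2)
      proof (rule eventually_mono, intro impI)
        fix x assume uv: "u x = v x" and x: "x \<in> ?S"
        then have "- e < u x / (norm x)\<^sup>2" "(norm x)\<^sup>2 > 0" using R[of x] by auto
        then have "- e * (norm x)\<^sup>2 < u x" by (simp only: pos_less_divide_eq)
        then show "0 \<le> v x + e * (norm x)\<^sup>2" using uv by simp
      qed
    qed
    then have pos': "0 \<le> v x + e * (norm x)\<^sup>2" if "max R 0 < norm x" for x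
      using that by blast
    \<comment> \<open>Adding 1 to the radius turns the strict condition on the norm into the
      required non-strict one.\<close>
    have "v x \<ge> - (e * (norm x)\<^sup>2)" if "max R 0 + 1 \<le> norm x" for x
      using pos'[of x] that by linarith
    then show ?thesis by blast
  qed
  have "v x = \<beta> * (norm x)\<^sup>2 + \<eta>" for x
    using solution_upper_bound[OF A v(1) pos E, of x]
      solution_lower_bound[OF A pos(1,2,3) E growth, of x] by linarith
  with v(2) show ?thesis by simp
qed

theorem theorem5p1:
  fixes \<sigma> \<delta> a b \<beta> \<eta> :: real and f :: "'a::euclidean_space \<Rightarrow> real"
  assumes "\<sigma> > 0" and "\<delta> > 0" and "a > 0" and "b \<ge> 0"
    and "f = (\<lambda>x. a * (norm x)\<^sup>2 + b)"
    and "\<beta> = (- \<delta> + sqrt (\<delta>\<^sup>2 + 8 * a)) / 4"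
    and "\<eta> = (b + real DIM('a) * \<sigma>\<^sup>2 * \<beta>) / \<delta>"
  shows "\<beta> > 0 \<and>
    admissible_solution \<sigma> \<delta> f (\<lambda>x. \<beta> * (norm x)\<^sup>2 + \<eta>) \<and>
    (\<forall>u. admissible_solution \<sigma> \<delta> f u \<longrightarrow> (AE x in lebesgue. u x = \<beta> * (norm x)\<^sup>2 + \<eta>))"
proof -
  have "sqrt (\<delta>\<^sup>2) < sqrt (\<delta>\<^sup>2 + 8 * a)" using assms(3) by (intro real_sqrt_less_mono) simp
  then have \<beta>: "\<beta> > 0" using assms(2,6) by simp
  have \<eta>: "\<eta> \<ge> 0" using assms \<beta> by simp
  \<comment> \<open>This is the square root of the discriminant; squaring it gives the quadratic
    equation of which \<open>\<beta>\<close> is the positive root.\<close>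
  have "4 * \<beta> + \<delta> = sqrt (\<delta>\<^sup>2 + 8 * a)" using assms(6) by simp
  then have "(4 * \<beta> + \<delta>)\<^sup>2 = \<delta>\<^sup>2 + 8 * a" using assms(3) by simp
  then have E1: "2 * \<beta>\<^sup>2 + \<delta> * \<beta> = a" by (simp add: power2_eq_square algebra_simps)
  have E2: "\<delta> * \<eta> = b + real DIM('a) * \<sigma>\<^sup>2 * \<beta>" using assms(2,7) by simp
  show ?thesis
    unfolding assms(5)
    using \<beta> quadratic_admissible[OF \<beta> \<eta> E1 E2] admissible_solution_unique[OF _ assms(1,2) \<beta> \<eta> E1 E2] by blast
qed

end
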